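(* Let $f,g\in\mathscr D'(\overset{\circ}{\mathbb T})$, $f\not\equiv0$, $g\not\equiv0$, satisfy $\operatorname{supp}_{\bmod\pi}f+\operatorname{supp}_{\bmod\pi}g\subset(-\frac\pi2,\frac\pi2)$. Then $f*g\in\mathscr D'(\overset{\circ}{\mathbb T})$, and for each $\kappa>0$ the following statements (A) and (B) are equivalent: (A) $\inf\operatorname{supp}_{\bmod\pi}(f*g)\ge\inf\operatorname{supp}_{\bmod\pi}f+\inf\operatorname{supp}_{\bmod\pi}g+\kappa$; (B) either $f\in\mathbf L^-_\kappa$ and $g\in\mathbf L^+_\kappa$, or $f\in\mathbf L^+_\kappa$ and $g\in\mathbf L^-_\kappa$. Similarly, the following statements (A') and (B') are equivalent: (A') $\sup\operatorname{supp}_{\bmod\pi}(f*g)\le\sup\operatorname{supp}_{\bmod\pi}f+\sup\operatorname{supp}_{\bmod\pi}g-\kappa$; (B') either $f\in\mathbf R^-_\kappa$ and $g\in\mathbf R^+_\kappa$, or $f\in\mathbf R^+_\kappa$ and $g\in\mathbf R^-_\kappa$.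
   Context: $\mathbb T=\mathbb R/2\pi\mathbb Z$, $\overset{\circ}{\mathbb T}=\mathbb T\setminus\{\pm\frac\pi2\}$, and $\mathscr D'(\overset{\circ}{\mathbb T})=\{f\in\mathscr D'(\mathbb T):\operatorname{supp}f\subset\overset{\circ}{\mathbb T}\}$. $f*g$ is convolution on the circle $\mathbb T$. For $f\in\mathscr D'(\overset{\circ}{\mathbb T})$, $$\operatorname{supp}_{\bmod\pi}f=\{p\in(-\tfrac\pi2,\tfrac\pi2):\ p\in\operatorname{supp}f\ \text{or}\ p+\pi\in\operatorname{supp}f\}.$$ For the empty set, $\inf\emptyset=+\infty$, $\sup\emptyset=-\infty$. $S_\pi$ is the shift $S_\pi f(\omega)=f(\omega+\pi)$. For $\kappa>0$ (intervals of $\mathbb R$ being understood modulo $2\pi$), $$\mathbf L^\pm_\kappa=\Big\{f\in\mathscr D'(\overset{\circ}{\mathbb T}):\ f\not\equiv0,\ f=\pm S_\pi f\ \text{on}\ \big(-\tfrac\pi2,\ \inf\operatorname{supp}_{\bmod\pi}f+\kappa\big)\Big\},$$ $$\mathbf R^\pm_\kappa=\Big\{f\in\mathscr D'(\overset{\circ}{\mathbb T}):\ f\not\equiv0,\ f=\pm S_\pi f\ \text{on}\ \big(\sup\operatorname{supp}_{\bmod\pi}f-\kappa,\ \tfrac\pi2\big)\Big\}.$$ *)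

theory Defs
  imports "HOL-Analysis.Analysis"
begin

text \<open>
  Functions on the circle \<open>\<real>/2\<pi>\<int>\<close> are represented by \<open>2\<pi>\<close>-periodic functions on the real line
  and subsets of the circle by their \<open>2\<pi>\<close>-periodic preimages in the real line.
\<close>

definition periodize :: "real set \<Rightarrow> real set" where
  "periodize U = {x + 2 * pi * of_int k | x k. x \<in> U}"

definition nth_deriv :: "nat \<Rightarrow> (real \<Rightarrow> complex) \<Rightarrow> real \<Rightarrow> complex" where
  "nth_deriv n = (\<lambda>\<phi> x. vector_derivative \<phi> (at x)) ^^ n"

definition circle_test :: "(real \<Rightarrow> complex) set" where
  "circle_test = {\<phi>. (\<forall>n x. nth_deriv n \<phi> differentiable (at x)) \<and> (\<forall>x. \<phi> (x + 2 * pi) = \<phi> x)}"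

text \<open>
  Distributions on the circle are the complex-linear functionals on \<open>circle_test\<close> that are
  continuous for the usual Frechet topology, i.e. bounded by finitely many of the seminorms
  \<open>sup |\<phi>\<^sup>(\<^sup>k\<^sup>)|\<close>. They are normalized to be \<open>0\<close> outside \<open>circle_test\<close>, so that equality of
  distributions is equality of functions and the zero distribution is \<open>\<lambda>_. 0\<close>.
\<close>

type_synonym functional = "(real \<Rightarrow> complex) \<Rightarrow> complex"

definition circle_dist :: "functional set" where
  "circle_dist = {f.
     (\<forall>\<phi>. \<phi> \<notin> circle_test \<longrightarrow> f \<phi> = 0) \<and>
     (\<forall>\<phi>\<in>circle_test. \<forall>\<psi>\<in>circle_test. f (\<lambda>x. \<phi> x + \<psi> x) = f \<phi> + f \<psi>) \<and>
     (\<forall>c. \<forall>\<phi>\<in>circle_test. f (\<lambda>x. c * \<phi> x) = c * f \<phi>) \<and>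
     (\<exists>C N. \<forall>\<phi>\<in>circle_test. norm (f \<phi>) \<le> C * (\<Sum>k\<le>N. SUP x. norm (nth_deriv k \<phi> x)))}"

text \<open>
  Equality of two distributions on the open subset of the circle that is the image of the
  open set \<open>U\<close> of reals, i.e. \<open>U\<close> is understood modulo \<open>2\<pi>\<close>.
\<close>

definition dist_eq_on :: "real set \<Rightarrow> functional \<Rightarrow> functional \<Rightarrow> bool" where
  "dist_eq_on U f g \<longleftrightarrow>
     (\<forall>\<phi>\<in>circle_test. closure {x. \<phi> x \<noteq> 0} \<subseteq> periodize U \<longrightarrow> f \<phi> = g \<phi>)"

definition dist_supp :: "functional \<Rightarrow> real set" where
  "dist_supp f = - \<Union>{U. open U \<and> dist_eq_on U f (\<lambda>_. 0)}"

definition punctured_circle :: "real set" where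
  "punctured_circle = - periodize {- pi / 2, pi / 2}"

definition punctured_dist :: "functional set" where
  "punctured_dist = {f \<in> circle_dist. dist_supp f \<subseteq> punctured_circle}"

text \<open>\<open>\<langle>f * g, \<phi>\<rangle> = \<langle>f(x), \<langle>g(y), \<phi>(x + y)\<rangle>\<rangle>\<close>\<close>

definition dist_conv :: "functional \<Rightarrow> functional \<Rightarrow> functional" where
  "dist_conv f g = (\<lambda>\<phi>. if \<phi> \<in> circle_test then f (\<lambda>x. g (\<lambda>y. \<phi> (x + y))) else 0)"

text \<open>The shift \<open>S\<^sub>\<pi> f(\<omega>) = f(\<omega> + \<pi>)\<close>, transposed onto the test function.\<close>

definition shift_pi :: "functional \<Rightarrow> functional" where
  "shift_pi f = (\<lambda>\<phi>. f (\<lambda>\<omega>. \<phi> (\<omega> - pi)))"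

definition supp_mod_pi :: "functional \<Rightarrow> real set" where
  "supp_mod_pi f = {p \<in> {- pi / 2 <..< pi / 2}. p \<in> dist_supp f \<or> p + pi \<in> dist_supp f}"

text \<open>In \<^typ>\<open>ereal\<close> the infimum of the empty set is \<open>\<infinity>\<close> and its supremum is \<open>-\<infinity>\<close>.\<close>

definition inf_supp :: "functional \<Rightarrow> ereal" where
  "inf_supp f = Inf (ereal ` supp_mod_pi f)"

definition sup_supp :: "functional \<Rightarrow> ereal" where
  "sup_supp f = Sup (ereal ` supp_mod_pi f)"

text \<open>The sign \<open>\<plusminus>\<close> of the classes is the parameter \<open>s\<close>, to be taken as \<open>1\<close> or \<open>- 1\<close>.\<close>

definition L_class :: "complex \<Rightarrow> real \<Rightarrow> functional set" where
  "L_class s \<kappa> = {f \<in> punctured_dist. f \<noteq> (\<lambda>_. 0) \<and>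
     dist_eq_on {x. - pi / 2 < x \<and> ereal x < inf_supp f + ereal \<kappa>} f (\<lambda>\<phi>. s * shift_pi f \<phi>)}"

definition R_class :: "complex \<Rightarrow> real \<Rightarrow> functional set" where
  "R_class s \<kappa> = {f \<in> punctured_dist. f \<noteq> (\<lambda>_. 0) \<and>
     dist_eq_on {x. sup_supp f - ereal \<kappa> < ereal x \<and> x < pi / 2} f (\<lambda>\<phi>. s * shift_pi f \<phi>)}"

end

theory Submission
  imports Defs
begin

text \<open>
  For \<open>s = \<plusminus>1\<close> put \<open>f\<^sub>s = f + s S\<^sub>\<pi> f\<close>. Then \<open>S\<^sub>\<pi> f\<^sub>s = s f\<^sub>s\<close>, \<open>f\<close> is half the sum of \<open>f\<^sub>+\<close> and
  \<open>f\<^sub>-\<close>, and \<open>f \<in> L\<^sup>s\<^sub>\<kappa>\<close> says that \<open>f\<^bsub>-s\<^esub>\<close> vanishes to the left of \<open>inf supp f + \<kappa>\<close>. Since a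
  convolution can be shifted in either factor, \<open>(f * g)\<^sub>s\<close> is half of \<open>f\<^sub>s * g\<^sub>s\<close>. Write \<open>a\<^sub>s\<close> and
  \<open>b\<^sub>s\<close> for the infima of the supports of \<open>f\<^sub>s\<close> and \<open>g\<^sub>s\<close>. The infima for \<open>f\<close> and \<open>g\<close> are
  \<open>a = min a\<^sub>+ a\<^sub>-\<close> and \<open>b = min b\<^sub>+ b\<^sub>-\<close>. Once it is known that \<open>f\<^sub>s * g\<^sub>s\<close> starts exactly at
  \<open>a\<^sub>s + b\<^sub>s\<close>, condition (A) reads \<open>min (a\<^sub>+ + b\<^sub>+) (a\<^sub>- + b\<^sub>-) \<ge> a + b + \<kappa>\<close>. If \<open>a = a\<^sub>+\<close>, this
  forces \<open>b\<^sub>+ \<ge> b + \<kappa>\<close>, hence \<open>b = b\<^sub>-\<close> and \<open>a\<^sub>- \<ge> a + \<kappa>\<close>, which is (B); the case \<open>a = a\<^sub>-\<close> is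
  symmetric, and the converse is immediate (\<open>ereal_min_sum_ge_iff\<close>, \<open>inf_supp_conv_iff\<close>).

  The additivity \<open>inf supp (f\<^sub>s * g\<^sub>s) = a\<^sub>s + b\<^sub>s\<close> is Titchmarsh's convolution theorem. A distribution
  with \<open>S\<^sub>\<pi> F = s F\<close> and support off \<open>\<plusminus>\<pi>/2\<close> is determined by its restriction to the
  arc \<open>(-\<pi>/2, \<pi>/2)\<close>, and the assumption on the sum of the supports keeps the convolution from wrapping around the circle, so that it is a
  convolution of compactly supported objects on the line. One inequality is the inclusion of
  \<open>supp (F * G)\<close> in \<open>supp F + supp G\<close> (\<open>inf_supp_conv_ge\<close>). For the other one (\<open>inf_supp_conv_le\<close>),
  \<open>F\<close> and \<open>G\<close> are mollified to continuous functions, for which the theorem is proved on the line.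

  The proof of Titchmarsh's theorem (\<open>titchmarsh_convolution\<close>) uses the Laplace transform on the
  natural numbers only. By an argument of Phragmen, \<open>u\<close> vanishes to the left of \<open>T\<close> if its transform
  is \<open>O(exp (- n T))\<close> there (\<open>vanish_of_laplace_decay\<close>). Let \<open>u * v\<close> vanish to the left of \<open>T\<close>, and look at
  the rates of decay of the products of the transforms of \<open>x^m u\<close> and \<open>y^n v\<close>. Because multiplication
  by the variable is a derivation for convolution, these rates satisfy a convexity inequality in
  \<open>m + n\<close>; as they are also bounded below, none of them is smaller than the rate \<open>T\<close> for \<open>m = n = 0\<close>.
  So \<open>(x^m u) * v\<close> vanishes to the left of \<open>T\<close> for every \<open>m\<close>, which says that all moments of
  \<open>r \<mapsto> u(r) v(t - r)\<close> are zero for \<open>t < T\<close>, and hence that \<open>u(r) v(t - r) = 0\<close>.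

  The statements about suprema follow by reflecting the circle.
\<close>

section \<open>Laplace transform and convolution on the line\<close>

definition Cc :: "(real \<Rightarrow> complex) set" where
  "Cc = {u. continuous_on UNIV u \<and> (\<exists>M. \<forall>x. u x \<noteq> 0 \<longrightarrow> \<bar>x\<bar> \<le> M)}"

lemma CcE:
  assumes "u \<in> Cc"
  obtains M where "M > 0" "continuous_on UNIV u" "\<And>x. u x \<noteq> 0 \<Longrightarrow> \<bar>x\<bar> \<le> M"
proof -
  from assms obtain M where "continuous_on UNIV u" "\<forall>x. u x \<noteq> 0 \<longrightarrow> \<bar>x\<bar> \<le> M"
    unfolding Cc_def by blast
  then show ?thesis by (intro that[of "max M 1"]) force+
qed

lemma Cc_times:
  assumes "u \<in> Cc" "continuous_on UNIV h"
  shows "(\<lambda>x. h x * u x) \<in> Cc"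
  using assms unfolding Cc_def by (auto intro!: continuous_intros)

text \<open>
  Stated for all Euclidean spaces because the interchange of integrals for a convolution needs it on
  the plane.
\<close>

lemma integrable_compact_support:
  fixes F :: "'a::euclidean_space \<Rightarrow> 'b::{banach,second_countable_topology}"
  assumes "continuous_on UNIV F" "compact K" "\<And>x. x \<notin> K \<Longrightarrow> F x = 0"
  shows "integrable lborel F"
proof -
  have "integrable lborel (\<lambda>x. indicator K x *\<^sub>R F x)"
    using assms continuous_on_subset by (intro borel_integrable_compact) blast+
  moreover have "(\<lambda>x. indicator K x *\<^sub>R F x) = F"
    using assms(3) by (auto simp: indicator_def)
  ultimately show ?thesis by simp
qed

lemma Cc_integrable:
  assumes "u \<in> Cc"
  shows "integrable lborel u"
proof -
  obtain M where M: "continuous_on UNIV u" "\<And>x. u x \<noteq> 0 \<Longrightarrow> \<bar>x\<bar> \<le> M"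
    using CcE[OF assms] by metis
  show ?thesis
    by (rule integrable_compact_support[of _ "{-M..M}"]) (use M in force)+
qed

lemma lborel_integral_eq_interval:
  fixes u :: "real \<Rightarrow> complex"
  assumes "continuous_on {a..b} u" "\<And>x. x \<notin> {a..b} \<Longrightarrow> u x = 0"
  shows "(LINT s|lborel. u s) = integral {a..b} u"
proof -
  have "set_integrable lborel {a..b} u"
    unfolding set_integrable_def by (rule borel_integrable_compact) (use assms in auto)
  then have "(LINT s:{a..b}|lborel. u s) = integral {a..b} u"
    by (rule set_borel_integral_eq_integral)
  moreover have "(LINT s:{a..b}|lborel. u s) = (LINT s|lborel. u s)"
    unfolding set_lebesgue_integral_def
    by (rule Bochner_Integration.integral_cong) (use assms(2) in \<open>auto simp: indicator_def\<close>)
  ultimately show ?thesis by simp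
qed

definition laplace :: "(real \<Rightarrow> complex) \<Rightarrow> real \<Rightarrow> complex" where
  "laplace u x = (LINT s|lborel. of_real (exp (- x * s)) * u s)"

definition line_conv :: "(real \<Rightarrow> complex) \<Rightarrow> (real \<Rightarrow> complex) \<Rightarrow> real \<Rightarrow> complex" where
  "line_conv u v t = (LINT s|lborel. u (t - s) * v s)"

lemma Cc_conv_integrand:
  assumes "u \<in> Cc" "v \<in> Cc"
  shows "(\<lambda>s. u (t - s) * v s) \<in> Cc"
proof -
  obtain M where "continuous_on UNIV u" using CcE[OF assms(1)] by metis
  then have "continuous_on UNIV (\<lambda>s. u (t - s))"
    by (rule continuous_on_compose2) (auto intro!: continuous_intros)
  then show ?thesis using Cc_times[OF assms(2)] by blast
qed

lemma line_conv_Cc: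
  assumes "u \<in> Cc" "v \<in> Cc"
  shows "line_conv u v \<in> Cc"
proof -
  obtain M where M: "continuous_on UNIV u" "\<And>x. u x \<noteq> 0 \<Longrightarrow> \<bar>x\<bar> \<le> M"
    using CcE[OF assms(1)] by metis
  obtain N where N: "continuous_on UNIV v" "\<And>x. v x \<noteq> 0 \<Longrightarrow> \<bar>x\<bar> \<le> N"
    using CcE[OF assms(2)] by metis
  have cont2: "continuous_on X (\<lambda>(t, s). u (t - s) * v s)" for X
    unfolding case_prod_beta
    by (intro continuous_intros continuous_on_compose2[OF M(1)] continuous_on_compose2[OF N(1)]) auto
  have eq: "line_conv u v t = integral (cbox (-N) N) (\<lambda>s. u (t - s) * v s)" for t
    unfolding line_conv_def cbox_interval
    by (rule lborel_integral_eq_interval)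
       (use N(2) in \<open>force intro!: continuous_intros continuous_on_compose2[OF M(1)] continuous_on_compose2[OF N(1)]\<close>)+
  have "continuous_on UNIV (\<lambda>t. integral (cbox (-N) N) (\<lambda>s. u (t - s) * v s))"
    by (rule integral_continuous_on_param[OF cont2])
  moreover have "\<bar>t\<bar> \<le> M + N" if "line_conv u v t \<noteq> 0" for t
  proof (rule ccontr)
    assume t: "\<not> \<bar>t\<bar> \<le> M + N"
    have "(\<lambda>s. u (t - s) * v s) = (\<lambda>s. 0)"
    proof
      fix s show "u (t - s) * v s = 0"
        using M(2)[of "t - s"] N(2)[of s] t by (cases "v s = 0") force+
    qed
    then show False using that by (simp add: line_conv_def)
  qed
  ultimately show ?thesis unfolding Cc_def eq by blast
qed

lemma laplace_line_conv:
  assumes "u \<in> Cc" "v \<in> Cc"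
  shows "laplace (line_conv u v) x = laplace u x * laplace v x"
proof -
  obtain M where M: "continuous_on UNIV u" "\<And>x. u x \<noteq> 0 \<Longrightarrow> \<bar>x\<bar> \<le> M"
    using CcE[OF assms(1)] by metis
  obtain N where N: "continuous_on UNIV v" "\<And>x. v x \<noteq> 0 \<Longrightarrow> \<bar>x\<bar> \<le> N"
    using CcE[OF assms(2)] by metis
  define F where "F t s = of_real (exp (- x * t)) * (u (t - s) * v s)" for t s
  have "integrable lborel (case_prod F)"
  proof (rule integrable_compact_support[of _ "{-(M+N)..M+N} \<times> {-N..N}"])
    show "continuous_on UNIV (case_prod F)"
      unfolding case_prod_beta F_def
      by (intro continuous_intros continuous_on_compose2[OF M(1)] continuous_on_compose2[OF N(1)]) auto
    show "case_prod F p = 0" if "p \<notin> {-(M+N)..M+N} \<times> {-N..N}" for p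
    proof (cases p)
      case (Pair t s)
      then show ?thesis
        using that M(2)[of "t - s"] N(2)[of s] by (cases "v s = 0"; cases "u (t - s) = 0") (force simp: F_def)+
    qed
  qed (auto intro: compact_Times)
  then have int: "integrable (lborel \<Otimes>\<^sub>M lborel) (case_prod F)"
    by (simp add: lborel_prod)
  have "laplace (line_conv u v) x = (LINT t|lborel. LINT s|lborel. F t s)"
    unfolding laplace_def line_conv_def F_def by simp
  also have "\<dots> = (LINT s|lborel. LINT t|lborel. F t s)"
    by (rule lborel_pair.Fubini_integral[symmetric, OF int])
  also have "(\<lambda>s. LINT t|lborel. F t s) = (\<lambda>s. laplace u x * (of_real (exp (- x * s)) * v s))"
  proof
    fix s
    have "(LINT t|lborel. F t s) = (LINT t|lborel. F (s + 1 * t) s)"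
      by (subst lborel_integral_real_affine[where c=1 and t=s]) auto
    also have "\<dots> = (LINT t|lborel. (of_real (exp (- x * t)) * u t) * (of_real (exp (- x * s)) * v s))"
      by (rule Bochner_Integration.integral_cong)
         (simp_all add: F_def exp_add[symmetric] algebra_simps flip: of_real_mult)
    also have "\<dots> = laplace u x * (of_real (exp (- x * s)) * v s)"
      unfolding laplace_def by (rule integral_mult_left_zero)
    finally show "(LINT t|lborel. F t s) = laplace u x * (of_real (exp (- x * s)) * v s)" .
  qed
  also have "(LINT s|lborel. laplace u x * (of_real (exp (- x * s)) * v s)) = laplace u x * laplace v x"
    unfolding laplace_def by (rule integral_mult_right_zero)
  finally show ?thesis .
qed

text \<open>
  This is used with \<open>y s = - exp (n (t - s))\<close>, to expand a smoothed step function, and with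
  \<open>y s = - x s\<close>, to expand the Laplace transform in moments. The exponential series dominates on the
  support of \<open>u\<close>, where \<open>y\<close> is bounded.
\<close>

lemma sums_integral_exp:
  assumes "u \<in> Cc" "continuous_on UNIV y"
  shows "(\<lambda>k. LINT s|lborel. of_real (y s ^ k / fact k) * u s) sums
         (LINT s|lborel. of_real (exp (y s)) * u s)"
proof -
  obtain M where M: "continuous_on UNIV u" "\<And>x. u x \<noteq> 0 \<Longrightarrow> \<bar>x\<bar> \<le> M"
    using CcE[OF assms(1)] by metis
  have "compact (y ` {-M..M})"
    using assms(2) by (intro compact_continuous_image continuous_on_subset[OF assms(2)]) auto
  then obtain Y where Y: "\<And>s. s \<in> {-M..M} \<Longrightarrow> \<bar>y s\<bar> \<le> Y"
    by (meson bounded_real compact_imp_bounded image_eqI)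
  define F where "F k s = of_real (y s ^ k / fact k) * u s" for k s
  have Fcc: "F k \<in> Cc" for k
    unfolding F_def by (rule Cc_times[OF assms(1)]) (auto intro!: continuous_intros assms(2))
  have bd: "norm (F k s) \<le> \<bar>Y\<bar> ^ k / fact k * norm (u s)" for k s
  proof (cases "u s = 0")
    case False
    then have "\<bar>y s\<bar> \<le> \<bar>Y\<bar>" using M(2)[OF False] Y[of s] by force
    then have "\<bar>y s\<bar> ^ k \<le> \<bar>Y\<bar> ^ k" by (intro power_mono) auto
    then show ?thesis
      by (auto simp: F_def norm_mult norm_divide norm_power power_abs intro!: mult_right_mono divide_right_mono)
  qed (simp add: F_def)
  have sumexp: "summable (\<lambda>k. \<bar>Y\<bar> ^ k / fact k)"
    using summable_exp[of "\<bar>Y\<bar>"] by (simp add: field_simps)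
  have iu: "integrable lborel (\<lambda>s. norm (u s))"
    using Cc_integrable[OF assms(1)] by simp
  have "(\<lambda>k. LINT s|lborel. F k s) sums (LINT s|lborel. (\<Sum>k. F k s))"
  proof (rule sums_integral)
    show "integrable lborel (F k)" for k by (rule Cc_integrable[OF Fcc])
    show "AE s in lborel. summable (\<lambda>k. norm (F k s))"
      by (rule AE_I2, rule summable_comparison_test'[OF summable_mult2[OF sumexp]])
         (use bd in auto)
    show "summable (\<lambda>k. LINT s|lborel. norm (F k s))"
    proof (rule summable_comparison_test'[OF summable_mult2[OF sumexp]])
      fix k :: nat
      have "(LINT s|lborel. norm (F k s)) \<le> (LINT s|lborel. \<bar>Y\<bar> ^ k / fact k * norm (u s))"
        by (rule integral_mono) (use Cc_integrable[OF Fcc] iu bd in auto)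
      then show "norm (LINT s|lborel. norm (F k s)) \<le> \<bar>Y\<bar> ^ k / fact k * (LINT s|lborel. norm (u s))"
        by simp
    qed
  qed
  moreover have "(\<Sum>k. F k s) = of_real (exp (y s)) * u s" for s
  proof -
    have "(\<lambda>k. y s ^ k / fact k) sums exp (y s)"
      using exp_converges[of "y s"] by (simp add: field_simps)
    then have "(\<lambda>k. F k s) sums (of_real (exp (y s)) * u s)"
      unfolding F_def by (intro sums_mult2 sums_of_real)
    then show ?thesis by (simp add: sums_iff)
  qed
  ultimately show ?thesis by (simp add: F_def)
qed

definition decays :: "real \<Rightarrow> (nat \<Rightarrow> complex) \<Rightarrow> bool" where
  "decays \<tau> \<Phi> \<longleftrightarrow> (\<exists>C. \<forall>k. norm (\<Phi> k) \<le> C * exp (- real k * \<tau>))"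

lemma laplace_decay_of_vanish:
  assumes "u \<in> Cc" "\<And>s. s < T \<Longrightarrow> u s = 0"
  shows "decays T (\<lambda>n. laplace u (real n))"
  unfolding decays_def
proof (intro exI allI)
  fix n
  define x where "x = real n"
  have x: "x \<ge> 0" by (simp add: x_def)
  have iu: "integrable lborel (\<lambda>s. norm (u s))"
    using Cc_integrable[OF assms(1)] by simp
  have int: "integrable lborel (\<lambda>s. of_real (exp (- x * s)) * u s)"
    by (rule Cc_integrable[OF Cc_times[OF assms(1)]]) (auto intro!: continuous_intros)
  have "norm (laplace u x) \<le> (LINT s|lborel. norm (of_real (exp (- x * s)) * u s))"
    unfolding laplace_def by (rule integral_norm_bound)
  also have "\<dots> \<le> (LINT s|lborel. exp (- x * T) * norm (u s))"
  proof (rule integral_mono)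
    show "norm (of_real (exp (- x * s)) * u s) \<le> exp (- x * T) * norm (u s)" for s
    proof (cases "s < T")
      case False
      then have "exp (- x * s) \<le> exp (- x * T)" using x by (simp add: mult_left_mono)
      then show ?thesis by (simp add: norm_mult mult_right_mono)
    qed (use assms(2) in auto)
  qed (use int iu in auto)
  finally show "norm (laplace u (real n)) \<le> (LINT s|lborel. norm (u s)) * exp (- real n * T)"
    by (simp add: x_def mult.commute)
qed

lemma exp_minus_nat_tendsto_0:
  fixes c :: real
  assumes "c > 0"
  shows "(\<lambda>n. exp (- (real n * c))) \<longlonglongrightarrow> 0"
  by (rule filterlim_compose[OF exp_at_bot])
     (use assms in \<open>auto simp: filterlim_uminus_at_bot intro!: filterlim_at_top_mult_tendsto_pos[OF tendsto_const] filterlim_real_sequentially\<close>)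

text \<open>
  Phragmen's argument. As \<open>n\<close> grows, \<open>exp (- exp (n (t - s)))\<close> tends to the indicator function of
  \<open>s > t\<close>, so its integral against \<open>u\<close> tends to the integral of \<open>u\<close> over \<open>{t<..}\<close>. On the other hand,
  expanding the outer exponential gives a series in the values of the Laplace transform at the
  points \<open>k n\<close>. If \<open>t < T\<close>, the decay makes everything but the term \<open>k = 0\<close>, the full integral of
  \<open>u\<close>, tend to zero. So the integral of \<open>u\<close> over \<open>{..t}\<close> is zero for all \<open>t < T\<close>; differentiate in \<open>t\<close>.
\<close>

lemma vanish_of_laplace_decay:
  assumes u: "u \<in> Cc" and "decays T (\<lambda>n. laplace u (real n))" and "t0 < T"
  shows "u t0 = 0"
proof -
  obtain C where dec: "\<And>n. norm (laplace u (real n)) \<le> C * exp (- real n * T)"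
    using assms(2) unfolding decays_def by blast
  obtain M where M: "M > 0" "continuous_on UNIV u" "\<And>x. u x \<noteq> 0 \<Longrightarrow> \<bar>x\<bar> \<le> M"
    using CcE[OF u] by metis
  have iu: "integrable lborel u" by (rule Cc_integrable[OF u])
  have C: "C \<ge> 0" using order_trans[OF norm_ge_zero dec[of 0]] by simp
  have J: "(LINT s|lborel. indicator {..t} s *\<^sub>R u s) = 0" if "t < T" for t
  proof -
    define D where "D n = (LINT s|lborel. of_real (exp (- exp (real n * (t - s)))) * u s)" for n
    have "D \<longlonglongrightarrow> (LINT s|lborel. indicator {t<..} s *\<^sub>R u s)"
      unfolding D_def
    proof (rule integral_dominated_convergence[where w="\<lambda>s. norm (u s)"])
      show "AE s in lborel. (\<lambda>n. of_real (exp (- exp (real n * (t - s)))) * u s) \<longlonglongrightarrow> indicator {t<..} s *\<^sub>R u s"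
      proof (rule AE_mp[OF AE_lborel_singleton[of t]], rule AE_I2, rule impI)
        fix s assume "s \<noteq> t"
        have "(\<lambda>n. exp (- exp (real n * (t - s)))) \<longlonglongrightarrow> indicator {t<..} s"
        proof (cases "s < t")
          case True
          have "filterlim (\<lambda>n. real n * (t - s)) at_top sequentially"
            using True by (intro filterlim_at_top_mult_tendsto_pos[OF tendsto_const] filterlim_real_sequentially) auto
          then have "filterlim (\<lambda>n. exp (real n * (t - s))) at_top sequentially"
            by (rule filterlim_compose[OF exp_at_top])
          then have "filterlim (\<lambda>n. - exp (real n * (t - s))) at_bot sequentially"
            by (simp add: filterlim_uminus_at_bot)
          then have "(\<lambda>n. exp (- exp (real n * (t - s)))) \<longlonglongrightarrow> 0"
            by (rule filterlim_compose[OF exp_at_bot])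
          then show ?thesis using True by simp
        next
          case False
          then have st: "s > t" using \<open>s \<noteq> t\<close> by simp
          have "(\<lambda>n. exp (- (real n * (s - t)))) \<longlonglongrightarrow> 0"
            by (rule exp_minus_nat_tendsto_0) (use st in simp)
          then have "(\<lambda>n. exp (- exp (- (real n * (s - t))))) \<longlonglongrightarrow> exp (- 0)"
            by (intro tendsto_intros)
          then show ?thesis using st by (simp add: algebra_simps)
        qed
        then show "(\<lambda>n. of_real (exp (- exp (real n * (t - s)))) * u s) \<longlonglongrightarrow> indicator {t<..} s *\<^sub>R u s"
          unfolding scaleR_conv_of_real by (intro tendsto_intros)
      qed
      show "AE s in lborel. norm (of_real (exp (- exp (real n * (t - s)))) * u s) \<le> norm (u s)" for n
        by (rule AE_I2) (simp add: norm_mult mult_left_le_one_le)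
      show "integrable lborel (\<lambda>s. norm (u s))" using iu by simp
      show "(\<lambda>s. indicator {t<..} s *\<^sub>R u s) \<in> borel_measurable lborel"
        using borel_measurable_integrable[OF iu] by simp
      show "(\<lambda>s. of_real (exp (- exp (real n * (t - s)))) * u s) \<in> borel_measurable lborel" for n
        using borel_measurable_integrable[OF iu] by simp
    qed
    moreover have "D \<longlonglongrightarrow> (LINT s|lborel. u s)"
    proof -
      have bd: "norm (D n - (LINT s|lborel. u s)) \<le> C * (exp (exp (- (real n * (T - t)))) - 1)" for n
      proof -
        define a where "a k = (LINT s|lborel. of_real ((- exp (real n * (t - s))) ^ k / fact k) * u s)" for k
        define r where "r = exp (- (real n * (T - t)))"
        have a: "a sums D n"
          unfolding a_def D_def by (rule sums_integral_exp[OF u]) (auto intro!: continuous_intros)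
        have "a 0 = (LINT s|lborel. u s)" by (simp add: a_def)
        with a have s1: "(\<lambda>k. a (Suc k)) sums (D n - (LINT s|lborel. u s))"
          by (simp add: sums_Suc_iff)
        have ak: "norm (a k) \<le> C * (r ^ k / fact k)" for k
        proof -
          have "a k = (LINT s|lborel. of_real ((-1)^k * exp (real (k * n) * t) / fact k) * (of_real (exp (- real (k * n) * s)) * u s))"
            unfolding a_def
          proof (rule Bochner_Integration.integral_cong[OF refl])
            fix s
            have "(- exp (real n * (t - s))) ^ k = (-1)^k * exp (real (k * n) * t) * exp (- real (k * n) * s)"
              by (subst power_minus) (simp add: exp_of_nat_mult[symmetric] exp_add[symmetric] algebra_simps)
            then show "of_real ((- exp (real n * (t - s))) ^ k / fact k) * u s =
              of_real ((-1)^k * exp (real (k * n) * t) / fact k) * (of_real (exp (- real (k * n) * s)) * u s)"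
              by simp
          qed
          also have "\<dots> = of_real ((-1)^k * exp (real (k * n) * t) / fact k) * laplace u (real (k * n))"
            unfolding laplace_def by (rule integral_mult_right_zero)
          finally have "norm (a k) = exp (real (k * n) * t) / fact k * norm (laplace u (real (k * n)))"
            by (simp add: norm_mult norm_divide norm_power)
          also have "\<dots> \<le> exp (real (k * n) * t) / fact k * (C * exp (- real (k * n) * T))"
            by (intro mult_left_mono dec) auto
          also have "\<dots> = C * ((exp (real (k * n) * t) * exp (- real (k * n) * T)) / fact k)"
            by simp
          also have "exp (real (k * n) * t) * exp (- real (k * n) * T) = r ^ k"
            unfolding r_def by (simp add: exp_of_nat_mult[symmetric] exp_add[symmetric] algebra_simps)
          finally show ?thesis .
        qed
        have "(\<lambda>k. r ^ k / fact k) sums exp r"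
          using exp_converges[of r] by (simp add: field_simps)
        then have "(\<lambda>k. r ^ Suc k / fact (Suc k)) sums (exp r - 1)"
          by (subst sums_Suc_iff) simp
        then have s2: "(\<lambda>k. C * (r ^ Suc k / fact (Suc k))) sums (C * (exp r - 1))"
          by (rule sums_mult)
        have "norm (\<Sum>k. a (Suc k)) \<le> (\<Sum>k. C * (r ^ Suc k / fact (Suc k)))"
          by (rule norm_suminf_le) (use ak s2 sums_summable in blast)+
        then show ?thesis using s1 s2 unfolding r_def by (simp add: sums_iff)
      qed
      have "(\<lambda>n. exp (- (real n * (T - t)))) \<longlonglongrightarrow> 0"
        by (rule exp_minus_nat_tendsto_0) (use that in simp)
      then have "(\<lambda>n. C * (exp (exp (- (real n * (T - t)))) - 1)) \<longlonglongrightarrow> C * (exp 0 - 1)"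
        by (intro tendsto_intros)
      then have "(\<lambda>n. D n - (LINT s|lborel. u s)) \<longlonglongrightarrow> 0"
        using Lim_null_comparison[OF always_eventually[OF allI[OF bd]]] by simp
      then show ?thesis by (simp add: LIM_zero_iff)
    qed
    ultimately have "(LINT s|lborel. indicator {t<..} s *\<^sub>R u s) = (LINT s|lborel. u s)"
      using LIMSEQ_unique by blast
    moreover have "(LINT s|lborel. u s) = (LINT s|lborel. indicator {..t} s *\<^sub>R u s + indicator {t<..} s *\<^sub>R u s)"
      by (rule Bochner_Integration.integral_cong) (auto simp: indicator_def)
    moreover have "\<dots> = (LINT s|lborel. indicator {..t} s *\<^sub>R u s) + (LINT s|lborel. indicator {t<..} s *\<^sub>R u s)"
      by (rule Bochner_Integration.integral_add; rule integrable_mult_indicator[OF _ iu]; simp)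
    ultimately show ?thesis by simp
  qed
  \<comment> \<open>To the left of \<open>u\<close>, and of \<open>t0\<close> so that \<open>t0\<close> is interior to the interval of integration.\<close>
  define A where "A = min (- M) t0 - 1"
  have J2: "integral {A..t} u = 0" if "t < T" for t
  proof -
    have "(LINT s|lborel. indicator {..t} s *\<^sub>R u s) = (LINT s:{A..t}|lborel. u s)"
      unfolding set_lebesgue_integral_def
      by (rule Bochner_Integration.integral_cong) (use M(3) in \<open>force simp: indicator_def A_def\<close>)+
    also have "\<dots> = integral {A..t} u"
      by (rule set_borel_integral_eq_integral) 
         (auto simp: set_integrable_def intro!: borel_integrable_compact continuous_on_subset[OF M(2)])
    finally show ?thesis using J[OF that] by simp
  qed
  define B where "B = (t0 + T) / 2"
  have B: "t0 < B" "B < T" using \<open>t0 < T\<close> by (auto simp: B_def)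
  have "((\<lambda>t. integral {A..t} u) has_vector_derivative u t0) (at t0 within {A..B})"
    using B by (intro integral_has_vector_derivative continuous_on_subset[OF M(2)]) (auto simp: A_def)
  then have "((\<lambda>t. integral {A..t} u) has_vector_derivative u t0) (at t0)"
    using at_within_interior[of t0 "{A..B}"] B by (simp add: A_def)
  moreover have "((\<lambda>t. integral {A..t} u) has_vector_derivative 0) (at t0)"
  proof (rule has_vector_derivative_transform_within_open[of "\<lambda>_. 0" _ _ "{..<T}"])
  qed (use J2 \<open>t0 < T\<close> in auto)
  ultimately show ?thesis by (rule vector_derivative_unique_at)
qed

section \<open>Titchmarsh's convolution theorem\<close>

text \<open>
  The moments are, up to factors, the Taylor coefficients of the Laplace transform at \<open>0\<close>. It is
  therefore identically zero, and in particular decays at every rate.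
\<close>

lemma vanish_of_moments_zero:
  assumes u: "u \<in> Cc" and mom: "\<And>m::nat. (LINT s|lborel. of_real s ^ m * u s) = 0"
  shows "u t = 0"
proof -
  have "laplace u x = 0" for x
  proof -
    have "(\<lambda>k. LINT s|lborel. of_real ((- x * s) ^ k / fact k) * u s) sums laplace u x"
      unfolding laplace_def by (rule sums_integral_exp[OF u]) (auto intro!: continuous_intros)
    moreover have "(LINT s|lborel. of_real ((- x * s) ^ k / fact k) * u s) = 0" for k
    proof -
      have "(LINT s|lborel. of_real ((- x * s) ^ k / fact k) * u s)
          = (LINT s|lborel. of_real ((- x) ^ k / fact k) * (of_real s ^ k * u s))"
        by (rule Bochner_Integration.integral_cong[OF refl], subst power_mult_distrib) simp
      also have "\<dots> = of_real ((- x) ^ k / fact k) * (LINT s|lborel. of_real s ^ k * u s)"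
        by (rule integral_mult_right_zero)
      finally show ?thesis by (simp add: mom)
    qed
    ultimately show ?thesis by (simp add: sums_iff)
  qed
  then have "decays (t + 1) (\<lambda>n. laplace u (real n))" by (auto simp: decays_def intro!: exI[of _ 0])
  then show ?thesis by (rule vanish_of_laplace_decay[OF u]) simp
qed

definition xpow :: "nat \<Rightarrow> (real \<Rightarrow> complex) \<Rightarrow> real \<Rightarrow> complex" where
  "xpow m u = (\<lambda>s. of_real s ^ m * u s)"

lemma xpow_Cc: "u \<in> Cc \<Longrightarrow> xpow m u \<in> Cc"
  unfolding xpow_def by (rule Cc_times) (auto intro!: continuous_intros)

text \<open>
  Multiplication by the variable is a derivation for convolution, since \<open>t = (t - s) + s\<close> under the
  convolution integral.
\<close>

lemma laplace_derivation:
  assumes "u \<in> Cc" "v \<in> Cc"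
  shows "laplace (xpow 1 (line_conv u v)) x
       = laplace (xpow 1 u) x * laplace v x + laplace u x * laplace (xpow 1 v) x"
proof -
  have p: "xpow 1 u \<in> Cc" "xpow 1 v \<in> Cc" by (auto intro: xpow_Cc assms)
  have "xpow 1 (line_conv u v) = (\<lambda>t. line_conv (xpow 1 u) v t + line_conv u (xpow 1 v) t)"
  proof
    fix t
    have "line_conv (xpow 1 u) v t + line_conv u (xpow 1 v) t =
       (LINT s|lborel. xpow 1 u (t - s) * v s + u (t - s) * xpow 1 v s)"
      unfolding line_conv_def
      by (rule Bochner_Integration.integral_add[symmetric]; rule Cc_integrable; rule Cc_conv_integrand)
         (use assms p in auto)
    also have "\<dots> = (LINT s|lborel. of_real t * (u (t - s) * v s))"
      by (rule Bochner_Integration.integral_cong) (simp_all add: xpow_def algebra_simps)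
    also have "\<dots> = xpow 1 (line_conv u v) t"
      unfolding xpow_def line_conv_def by simp
    finally show "xpow 1 (line_conv u v) t = line_conv (xpow 1 u) v t + line_conv u (xpow 1 v) t" by simp
  qed
  then have "laplace (xpow 1 (line_conv u v)) x = (LINT t|lborel.
      of_real (exp (- x * t)) * line_conv (xpow 1 u) v t + of_real (exp (- x * t)) * line_conv u (xpow 1 v) t)"
    by (simp add: laplace_def algebra_simps)
  also have "\<dots> = laplace (line_conv (xpow 1 u) v) x + laplace (line_conv u (xpow 1 v)) x"
    unfolding laplace_def
    by (rule Bochner_Integration.integral_add; rule Cc_integrable; rule Cc_times)
       (use assms p in \<open>auto intro!: continuous_intros line_conv_Cc simp del: One_nat_def\<close>)
  finally show ?thesis unfolding laplace_line_conv[OF p(1) assms(2)] laplace_line_conv[OF assms(1) p(2)] .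
qed

lemma decays_mono: "decays \<tau> \<Phi> \<Longrightarrow> \<sigma> \<le> \<tau> \<Longrightarrow> decays \<sigma> \<Phi>"
proof -
  assume "decays \<tau> \<Phi>" and st: "\<sigma> \<le> \<tau>"
  then obtain C where C: "\<And>k. norm (\<Phi> k) \<le> C * exp (- real k * \<tau>)"
    unfolding decays_def by blast
  have "C \<ge> 0" using order_trans[OF norm_ge_zero C[of 0]] by simp
  have "norm (\<Phi> k) \<le> C * exp (- real k * \<sigma>)" for k
    by (rule order_trans[OF C]) (use \<open>C \<ge> 0\<close> st in \<open>auto intro!: mult_left_mono\<close>)
  then show ?thesis unfolding decays_def by blast
qed

text \<open>
  From \<open>w1\<^sup>2 = w1 (w1 + w2) - w1 w2\<close> one gets \<open>|w1|\<^sup>2 \<le> |w1| A + B\<close>, hence \<open>|w1| \<le> A + sqrt B\<close>, with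
  \<open>A = O(exp (- k \<tau>))\<close> and \<open>B = O(exp (- k (\<tau> + \<sigma>)))\<close>. Since \<open>\<sigma> \<le> \<tau>\<close>, the second summand decides.
\<close>

lemma decays_convex:
  fixes w1 w2 :: "nat \<Rightarrow> complex"
  assumes sum: "decays \<tau> (\<lambda>k. w1 k + w2 k)" and prod: "decays (\<tau> + \<sigma>) (\<lambda>k. w1 k * w2 k)" and "\<sigma> \<le> \<tau>"
  shows "decays ((\<tau> + \<sigma>) / 2) w1"
proof -
  have "decays ((\<tau> + \<sigma>) / 2) (\<lambda>k. w1 k + w2 k)"
    by (rule decays_mono[OF sum]) (use \<open>\<sigma> \<le> \<tau>\<close> in simp)
  then obtain A where A: "\<And>k. norm (w1 k + w2 k) \<le> A * exp (- real k * ((\<tau> + \<sigma>) / 2))"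
    unfolding decays_def by blast
  obtain B where B: "\<And>k. norm (w1 k * w2 k) \<le> B * exp (- real k * (\<tau> + \<sigma>))"
    using prod unfolding decays_def by blast
  have A0: "A \<ge> 0" using order_trans[OF norm_ge_zero A[of 0]] by simp
  have B0: "B \<ge> 0" using order_trans[OF norm_ge_zero B[of 0]] by simp
  have "norm (w1 k) \<le> (A + sqrt B) * exp (- real k * ((\<tau> + \<sigma>) / 2))" for k
  proof (rule ccontr)
    define E where "E = exp (- real k * ((\<tau> + \<sigma>) / 2))"
    define a where "a = norm (w1 k)"
    assume "\<not> ?thesis"
    then have gt: "(A + sqrt B) * E < a" by (simp add: a_def E_def)
    have E0: "E > 0" by (simp add: E_def)
    have E2: "exp (- real k * (\<tau> + \<sigma>)) = E\<^sup>2"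
      by (simp add: E_def power2_eq_square flip: exp_add)
    have "w1 k * w1 k = w1 k * (w1 k + w2 k) - w1 k * w2 k" by (simp add: algebra_simps)
    then have "norm (w1 k * w1 k) \<le> norm (w1 k * (w1 k + w2 k)) + norm (w1 k * w2 k)"
      by (metis norm_triangle_ineq4)
    also have "\<dots> \<le> a * (A * E) + B * E\<^sup>2"
      using mult_left_mono[OF A[of k, folded E_def], of a] B[of k, unfolded E2] unfolding norm_mult a_def by simp
    finally have le: "a * (a - A * E) \<le> B * E\<^sup>2" by (simp add: norm_mult a_def algebra_simps)
    have sE: "sqrt B * E \<ge> 0" "A * E \<ge> 0" using A0 B0 E0 by auto
    have 1: "sqrt B * E < a - A * E" using gt by (simp add: algebra_simps)
    have 2: "sqrt B * E < a" using 1 sE by linarith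
    have "(sqrt B * E) * (sqrt B * E) < a * (a - A * E)"
      using mult_strict_mono'[OF 2 1] sE by simp
    moreover have "(sqrt B * E) * (sqrt B * E) = B * E\<^sup>2"
      using B0 by (simp add: power_mult_distrib flip: power2_eq_square)
    ultimately show False using le by simp
  qed
  then show ?thesis unfolding decays_def by blast
qed

text \<open>
  If some increment of \<open>d\<close> is positive, then the midpoint inequality makes the next one at least as
  large, and so on; \<open>d\<close> would grow at least linearly.
\<close>

lemma bounded_increments_nonpos:
  fixes d :: "nat \<Rightarrow> real"
  assumes bound: "\<And>k. d k \<le> M" and "d 0 \<le> 0"
    and mid: "\<And>k. d (Suc k) \<le> (d k + max (d k) (d (Suc (Suc k)))) / 2"
  shows "d k \<le> 0"
proof -
  have step: "d (Suc k) \<le> d k" for k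
  proof (rule ccontr)
    assume neg: "\<not> ?thesis"
    define \<delta> where "\<delta> = d (Suc k) - d k"
    have "\<delta> > 0" using neg by (simp add: \<delta>_def)
    have inc: "d (Suc (k + j)) - d (k + j) \<ge> \<delta>" for j
    proof (induction j)
      case (Suc j)
      then show ?case using mid[of "k + j"] \<open>\<delta> > 0\<close> by (auto simp: max_def split: if_splits)
    qed (simp add: \<delta>_def)
    have lin: "d (k + j) \<ge> d k + real j * \<delta>" for j
    proof (induction j)
      case (Suc j)
      then show ?case using inc[of j] by (simp add: algebra_simps)
    qed simp
    obtain j :: nat where "real j * \<delta> > M - d k"
      using reals_Archimedean3[OF \<open>\<delta> > 0\<close>] by blast
    then show False using lin[of j] bound[of "k + j"] by linarith
  qed
  show ?thesis by (induction k) (use step \<open>d 0 \<le> 0\<close> order_trans in blast)+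
qed

text \<open>
  With \<open>w = (x^m u) * (y^n v)\<close>, \<open>w1 = (x^(m+1) u) * (y^n v)\<close> and \<open>w2 = (x^m u) * (y^(n+1) v)\<close>, the sum \<open>w1 + w2\<close>
  is the product of \<open>w\<close> by the variable, and so starts no earlier than \<open>w\<close>; and the transform of
  \<open>w1 * w2\<close> is also that of \<open>w\<close> times that of \<open>(x^(m+1) u) * (y^(n+1) v)\<close>. Let the
  level \<open>K\<close> collect the pairs with \<open>m + n = K\<close>. By \<open>decays_convex\<close>, if the rate of decay does not grow from level \<open>m + n\<close> to level \<open>m + n + 2\<close>, then at level \<open>m + n + 1\<close> it is at
  least the mean of the two.
\<close>

theorem titchmarsh_convolution:
  assumes u: "u \<in> Cc" and v: "v \<in> Cc"
    and conv: "\<And>t. t < T \<Longrightarrow> line_conv u v t = 0"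
    and "x + y < T"
  shows "u x = 0 \<or> v y = 0"
proof -
  define U where "U m k = laplace (xpow m u) (real k)" for m k
  define V where "V n k = laplace (xpow n v) (real k)" for n k
  define A where "A K \<tau> \<longleftrightarrow> (\<forall>m n. m + n = K \<longrightarrow> decays \<tau> (\<lambda>k. U m k * V n k))" for K :: nat and \<tau>
  have UV: "U m k * V n k = laplace (line_conv (xpow m u) (xpow n v)) (real k)" for m n k
    by (simp add: U_def V_def laplace_line_conv xpow_Cc u v)
  have cw: "line_conv (xpow m u) (xpow n v) \<in> Cc" for m n by (intro line_conv_Cc xpow_Cc u v)
  have vanish: "line_conv (xpow m u) (xpow n v) s = 0" if "decays \<tau> (\<lambda>k. U m k * V n k)" "s < \<tau>" for m n \<tau> s
    using that unfolding UV by (rule vanish_of_laplace_decay[OF cw])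
  have Amono: "A K \<sigma>" if "A K \<tau>" "\<sigma> \<le> \<tau>" for K \<sigma> \<tau>
    using that decays_mono unfolding A_def by blast
  have A0: "A 0 T"
  proof -
    have "decays T (\<lambda>k. U 0 k * V 0 k)"
      unfolding UV by (rule laplace_decay_of_vanish[OF cw]) (use conv in \<open>simp add: xpow_def\<close>)
    then show ?thesis by (simp add: A_def)
  qed
  \<comment> \<open>All functions \<open>(x\<^sup>m u) * (y\<^sup>n v)\<close> are supported to the right of one point, whatever \<open>m\<close> and \<open>n\<close>.\<close>
  have lower: "\<exists>c\<le>T. \<forall>K. A K c"
  proof -
    obtain M where M: "\<And>x. u x \<noteq> 0 \<Longrightarrow> \<bar>x\<bar> \<le> M" using CcE[OF u] by metis
    obtain N where N: "\<And>x. v x \<noteq> 0 \<Longrightarrow> \<bar>x\<bar> \<le> N" using CcE[OF v] by metis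
    have "decays (- M - N) (\<lambda>k. U m k * V n k)" for m n
      unfolding UV
    proof (rule laplace_decay_of_vanish[OF cw])
      fix t assume t: "t < - M - N"
      have "(\<lambda>s. xpow m u (t - s) * xpow n v s) = (\<lambda>s. 0)"
      proof
        fix s show "xpow m u (t - s) * xpow n v s = 0"
          using M[of "t - s"] N[of s] t by (cases "v s = 0"; cases "u (t - s) = 0") (auto simp: xpow_def)
      qed
      then show "line_conv (xpow m u) (xpow n v) t = 0" by (simp add: line_conv_def)
    qed
    then show ?thesis
      by (intro exI[of _ "min T (- M - N)"]) (auto simp: A_def intro: decays_mono[OF _ min.cobounded2])
  qed
  then obtain c where c: "c \<le> T" "\<And>K. A K c" by blast
  have step: "A (Suc K) ((\<tau> + \<sigma>) / 2)" if \<tau>: "A K \<tau>" and \<sigma>: "A (Suc (Suc K)) \<sigma>" and "\<sigma> \<le> \<tau>" for K \<tau> \<sigma>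
  proof -
    have both: "decays ((\<tau> + \<sigma>) / 2) (\<lambda>k. U (Suc m) k * V n k) \<and> decays ((\<tau> + \<sigma>) / 2) (\<lambda>k. U m k * V (Suc n) k)"
      if mn: "m + n = K" for m n
    proof -
      have d0: "decays \<tau> (\<lambda>k. U m k * V n k)" using \<tau> mn by (simp add: A_def)
      have d2: "decays \<sigma> (\<lambda>k. U (Suc m) k * V (Suc n) k)" using \<sigma> mn by (simp add: A_def)
      let ?w = "line_conv (xpow m u) (xpow n v)"
      have pp: "xpow 1 (xpow m z) = xpow (Suc m) z" for m z by (auto simp: xpow_def)
      have "decays \<tau> (\<lambda>k. laplace (xpow 1 ?w) (real k))"
        by (rule laplace_decay_of_vanish[OF xpow_Cc[OF cw]]) (use vanish[OF d0] in \<open>simp add: xpow_def\<close>)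
      moreover have "laplace (xpow 1 ?w) (real k) = U (Suc m) k * V n k + U m k * V (Suc n) k" for k
        using laplace_derivation[OF xpow_Cc[OF u] xpow_Cc[OF v], of m n "real k"]
        by (simp add: pp U_def V_def del: One_nat_def)
      ultimately have sum: "decays \<tau> (\<lambda>k. U (Suc m) k * V n k + U m k * V (Suc n) k)"
        by simp
      have prod: "decays (\<tau> + \<sigma>) (\<lambda>k. (U (Suc m) k * V n k) * (U m k * V (Suc n) k))"
      proof -
        obtain C where C: "\<And>k. norm (U m k * V n k) \<le> C * exp (- real k * \<tau>)"
          using d0 unfolding decays_def by blast
        obtain D where D: "\<And>k. norm (U (Suc m) k * V (Suc n) k) \<le> D * exp (- real k * \<sigma>)"
          using d2 unfolding decays_def by blast
        have "norm ((U (Suc m) k * V n k) * (U m k * V (Suc n) k)) \<le> (C * D) * exp (- real k * (\<tau> + \<sigma>))" for k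
        proof -
          have "norm ((U (Suc m) k * V n k) * (U m k * V (Suc n) k))
              = norm (U m k * V n k) * norm (U (Suc m) k * V (Suc n) k)"
            by (simp add: norm_mult)
          also have "\<dots> \<le> (C * exp (- real k * \<tau>)) * (D * exp (- real k * \<sigma>))"
            by (intro mult_mono C D order_trans[OF norm_ge_zero C]) auto
          also have "\<dots> = (C * D) * exp (- real k * (\<tau> + \<sigma>))"
            by (simp add: algebra_simps exp_add flip: exp_add)
          finally show ?thesis .
        qed
        then show ?thesis unfolding decays_def by blast
      qed
      show ?thesis
        using decays_convex[OF sum prod \<open>\<sigma> \<le> \<tau>\<close>]
          decays_convex[of \<tau> "\<lambda>k. U m k * V (Suc n) k" "\<lambda>k. U (Suc m) k * V n k" \<sigma>] sum prod \<open>\<sigma> \<le> \<tau>\<close>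
        by (simp add: add.commute mult.commute)
    qed
    show ?thesis unfolding A_def
    proof (intro allI impI)
      fix m n assume mn: "m + n = Suc K"
      show "decays ((\<tau> + \<sigma>) / 2) (\<lambda>k. U m k * V n k)"
      proof (cases m)
        case 0
        then show ?thesis using both[of 0 K] mn by simp
      next
        case (Suc m')
        then show ?thesis using both[of m' n] mn by simp
      qed
    qed
  qed
  \<comment> \<open>The optimal rate of decay at level \<open>K\<close>, truncated at \<open>T\<close> because it may be infinite.\<close>
  define s where "s K = Sup {\<tau>. \<tau> \<le> T \<and> A K \<tau>}" for K
  have ne: "{\<tau>. \<tau> \<le> T \<and> A K \<tau>} \<noteq> {}" for K using c by auto
  have bdd: "bdd_above {\<tau>. \<tau> \<le> T \<and> A K \<tau>}" for K by (rule bdd_aboveI[of _ T]) auto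
  have sT: "s K \<le> T" for K unfolding s_def by (rule cSup_least[OF ne]) auto
  have sA: "A K \<tau>" if "\<tau> < s K" for K \<tau>
    using less_cSupD[OF ne that[unfolded s_def]] Amono by force
  have sge: "\<tau> \<le> s K" if "\<tau> \<le> T" "A K \<tau>" for K \<tau>
    unfolding s_def by (rule cSup_upper[OF _ bdd]) (use that in auto)
  have "T - s K \<le> 0" for K
  proof (rule bounded_increments_nonpos[of "\<lambda>K. T - s K" "T - c"])
    show "T - s k \<le> T - c" for k using sge[OF c(1) c(2)] by simp
    show "T - s 0 \<le> 0" using sge[OF order_refl A0] by simp
    fix k
    define p where "p = s k"
    define q where "q = min (s k) (s (Suc (Suc k)))"
    have "(p + q) / 2 \<le> s (Suc k)"
    proof (rule field_le_epsilon)
      fix e :: real assume "e > 0"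
      have "A (Suc k) (((p - e) + (q - e)) / 2)"
        by (rule step; (rule sA)?) (use \<open>e > 0\<close> in \<open>auto simp: p_def q_def\<close>)
      moreover have "((p - e) + (q - e)) / 2 \<le> T"
        using sT[of k] \<open>e > 0\<close> by (auto simp: p_def q_def min_def)
      ultimately have "((p - e) + (q - e)) / 2 \<le> s (Suc k)" by (intro sge)
      then show "(p + q) / 2 \<le> s (Suc k) + e" by (simp add: field_simps)
    qed
    then show "T - s (Suc k) \<le> (T - s k + max (T - s k) (T - s (Suc (Suc k)))) / 2"
      by (auto simp: p_def q_def min_def max_def split: if_splits)
  qed
  then have sK: "s K = T" for K using sT[of K] by (simp add: order_antisym)
  define t where "t = x + y"
  have tT: "t < T" using \<open>x + y < T\<close> by (simp add: t_def)
  have zero: "line_conv (xpow m u) (xpow 0 v) t = 0" for m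
  proof (rule vanish)
    show "t < (t + T) / 2" using tT by simp
    have "A m ((t + T) / 2)" by (rule sA) (use tT sK in simp)
    then show "decays ((t + T) / 2) (\<lambda>k. U m k * V 0 k)" by (simp add: A_def)
  qed
  have "(\<lambda>r. v (t - r) * u r) \<in> Cc" by (rule Cc_conv_integrand[OF v u])
  then have "v (t - x) * u x = 0"
  proof (rule vanish_of_moments_zero)
    fix m
    have "(LINT r|lborel. of_real r ^ m * (v (t - r) * u r)) =
        (LINT s|lborel. of_real (t + - 1 * s) ^ m * (v (t - (t + - 1 * s)) * u (t + - 1 * s)))"
      by (subst lborel_integral_real_affine[where c="- 1" and t=t]) auto
    also have "\<dots> = line_conv (xpow m u) (xpow 0 v) t"
      unfolding line_conv_def
      by (rule Bochner_Integration.integral_cong) (auto simp: xpow_def)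
    finally show "(LINT r|lborel. of_real r ^ m * (v (t - r) * u r)) = 0" by (simp add: zero)
  qed
  then show ?thesis by (auto simp: t_def)
qed

section \<open>Test functions on the circle\<close>

lemma nth_deriv_0 [simp]: "nth_deriv 0 \<phi> = \<phi>"
  by (simp add: nth_deriv_def)

lemma nth_deriv_Suc: "nth_deriv (Suc n) \<phi> = (\<lambda>x. vector_derivative (nth_deriv n \<phi>) (at x))"
  by (simp add: nth_deriv_def)

lemma nth_deriv_add: "nth_deriv n (nth_deriv m \<phi>) = nth_deriv (n + m) \<phi>"
  by (simp add: nth_deriv_def funpow_add)

text \<open>
  The way in which all derivatives of explicitly given functions are computed below: guess the whole
  sequence \<open>h\<close> and check one derivative at a time.
\<close>

lemma nth_deriv_chain:
  assumes "\<And>n x. (h n has_vector_derivative h (Suc n) x) (at x)"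
  shows "nth_deriv n (h 0) = h n"
proof (induction n)
  case (Suc n)
  then show ?case
    using assms vector_derivative_at by (fastforce simp: nth_deriv_Suc)
qed simp

lemma circle_test_chain:
  assumes "\<And>n x. (h n has_vector_derivative h (Suc n) x) (at x)" "\<And>x. h 0 (x + 2 * pi) = h 0 x"
  shows "h 0 \<in> circle_test"
  unfolding circle_test_def
  using assms nth_deriv_chain[of h, OF assms(1)] by (auto intro: differentiableI_vector)

lemma circle_test_deriv:
  assumes "\<phi> \<in> circle_test"
  shows "(nth_deriv n \<phi> has_vector_derivative nth_deriv (Suc n) \<phi> x) (at x)"
  using assms vector_derivative_works by (auto simp: circle_test_def nth_deriv_Suc)

lemma circle_test_deriv_shift:
  assumes "\<phi> \<in> circle_test"
  shows "((\<lambda>y. nth_deriv n \<phi> (y + c)) has_vector_derivative nth_deriv (Suc n) \<phi> (x + c)) (at x)"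
proof -
  have "((nth_deriv n \<phi> \<circ> (\<lambda>y. y + c)) has_vector_derivative 1 *\<^sub>R nth_deriv (Suc n) \<phi> (x + c)) (at x)"
    by (rule vector_diff_chain_at) (auto intro!: derivative_eq_intros circle_test_deriv[OF assms])
  then show ?thesis by (simp add: o_def)
qed

lemma circle_test_per:
  assumes "\<phi> \<in> circle_test"
  shows "nth_deriv n \<phi> (x + 2 * pi) = nth_deriv n \<phi> x"
proof (induction n arbitrary: x)
  case 0
  then show ?case using assms by (simp add: circle_test_def)
next
  case (Suc n)
  have "(\<lambda>y. nth_deriv n \<phi> (y + 2 * pi)) = nth_deriv n \<phi>" using Suc by auto
  then show ?case
    using circle_test_deriv_shift[OF assms, of n "2 * pi" x] circle_test_deriv[OF assms, of n x]
    by (metis vector_derivative_unique_at)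
qed

lemma circle_test_nth_deriv:
  assumes "\<phi> \<in> circle_test"
  shows "nth_deriv m \<phi> \<in> circle_test"
  using circle_test_chain[of "\<lambda>n. nth_deriv (m + n) \<phi>"] circle_test_deriv[OF assms] circle_test_per[OF assms]
  by simp

lemma periodic_int_shift:
  fixes \<phi> :: "real \<Rightarrow> 'a"
  assumes "\<And>x. \<phi> (x + 2 * pi) = \<phi> x"
  shows "\<phi> (x + 2 * pi * of_int k) = \<phi> x"
proof -
  have n: "\<phi> (x + 2 * pi * real n) = \<phi> x" for n x
  proof (induction n arbitrary: x)
    case (Suc n)
    then show ?case using assms[of "x + 2 * pi * real n"] by (simp add: algebra_simps)
  qed simp
  show ?thesis
  proof (cases k)
    case (nonneg n)
    then show ?thesis using n by simp
  next
    case (neg n)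
    then have rk: "real_of_int k = - real (Suc n)" by simp
    have eq: "x + 2 * pi * of_int k + 2 * pi * real (Suc n) = x" unfolding rk by (simp del: of_nat_Suc)
    show ?thesis using n[of "x + 2 * pi * of_int k" "Suc n"] unfolding eq by simp
  qed
qed

lemma reduce_mod_2pi:
  fixes x a :: real
  obtains k :: int where "a \<le> x - 2 * pi * of_int k" "x - 2 * pi * of_int k < a + 2 * pi"
proof -
  define k where "k = \<lfloor>(x - a) / (2 * pi)\<rfloor>"
  have "of_int k \<le> (x - a) / (2 * pi)" "(x - a) / (2 * pi) < of_int k + 1"
    unfolding k_def by linarith+
  then have "a \<le> x - 2 * pi * of_int k" "x - 2 * pi * of_int k < a + 2 * pi"
    by (simp_all add: field_simps)
  then show ?thesis by (rule that)
qed

lemma circle_test_cont: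
  assumes "\<phi> \<in> circle_test"
  shows "continuous_on X (nth_deriv n \<phi>)"
  using circle_test_deriv[OF assms]
  by (meson continuous_at_imp_continuous_on has_vector_derivative_continuous)

lemma circle_test_cont0: "\<phi> \<in> circle_test \<Longrightarrow> continuous_on X \<phi>"
  using circle_test_cont[of \<phi> X 0] by simp

lemma circle_test_per0: "\<phi> \<in> circle_test \<Longrightarrow> \<phi> (x + 2 * pi) = \<phi> x"
  using circle_test_per[of \<phi> 0] by simp

text \<open>
  Two points at distance below \<open>1\<close> are moved together into a neighbourhood of one period, on which
  compactness applies.
\<close>

lemma periodic_uniformly_continuous:
  fixes h :: "real \<Rightarrow> complex"
  assumes "continuous_on UNIV h" "\<And>x. h (x + 2 * pi) = h x" "e > 0"
  shows "\<exists>d>0. \<forall>x y. \<bar>x - y\<bar> < d \<longrightarrow> norm (h x - h y) < e"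
proof -
  have "uniformly_continuous_on {-1..2*pi+1} h"
    using continuous_on_subset[OF assms(1)] by (intro compact_uniformly_continuous) auto
  then obtain d where d: "d > 0" "\<And>x y. x \<in> {-1..2*pi+1} \<Longrightarrow> y \<in> {-1..2*pi+1} \<Longrightarrow> \<bar>x - y\<bar> < d \<Longrightarrow> norm (h x - h y) < e"
    using \<open>e > 0\<close> unfolding uniformly_continuous_on_def dist_norm real_norm_def by meson
  have "norm (h x - h y) < e" if "\<bar>x - y\<bar> < min d 1" for x y
  proof -
    obtain k where k: "0 \<le> x - 2 * pi * of_int k" "x - 2 * pi * of_int k < 0 + 2 * pi"
      by (rule reduce_mod_2pi)
    have "norm (h (x - 2 * pi * of_int k) - h (y - 2 * pi * of_int k)) < e"
      by (rule d(2)) (use k that in \<open>auto simp: abs_less_iff\<close>)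
    then show ?thesis
      using periodic_int_shift[of h, OF assms(2), of x "- k"] periodic_int_shift[of h, OF assms(2), of y "- k"] by simp
  qed
  then show ?thesis using d(1) by (intro exI[of _ "min d 1"]) auto
qed

lemma circle_test_uniformly_continuous:
  assumes "\<phi> \<in> circle_test" "e > 0"
  shows "\<exists>d>0. \<forall>x y. \<bar>x - y\<bar> < d \<longrightarrow> norm (nth_deriv n \<phi> x - nth_deriv n \<phi> y) < e"
  by (rule periodic_uniformly_continuous) (use assms circle_test_cont circle_test_per in auto)

lemma periodic_bounded:
  fixes h :: "real \<Rightarrow> complex"
  assumes "continuous_on UNIV h" "\<And>x. h (x + 2 * pi) = h x"
  shows "\<exists>B. \<forall>x. norm (h x) \<le> B"
proof -
  have "compact (h ` {0..2*pi})"
    using continuous_on_subset[OF assms(1)] by (intro compact_continuous_image) auto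
  then obtain B where B: "\<And>x. x \<in> {0..2*pi} \<Longrightarrow> norm (h x) \<le> B"
    by (meson bounded_iff compact_imp_bounded image_eqI)
  have "norm (h x) \<le> B" for x
  proof -
    obtain k where k: "0 \<le> x - 2 * pi * of_int k" "x - 2 * pi * of_int k < 0 + 2 * pi"
      by (rule reduce_mod_2pi)
    then show ?thesis
      using B[of "x - 2 * pi * of_int k"] periodic_int_shift[of h, OF assms(2), of x "- k"] by simp
  qed
  then show ?thesis by blast
qed

lemma circle_test_bdd: "\<phi> \<in> circle_test \<Longrightarrow> bdd_above (range (\<lambda>x. norm (nth_deriv n \<phi> x)))"
  using periodic_bounded[of "nth_deriv n \<phi>"] circle_test_cont circle_test_per
  by (metis (mono_tags, lifting) bdd_aboveI2)

lemma circle_test_add: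
  assumes "\<phi> \<in> circle_test" "\<psi> \<in> circle_test"
  shows "(\<lambda>x. \<phi> x + \<psi> x) \<in> circle_test" (is ?A)
    and "nth_deriv n (\<lambda>x. \<phi> x + \<psi> x) = (\<lambda>x. nth_deriv n \<phi> x + nth_deriv n \<psi> x)" (is ?B)
proof -
  define h where "h n = (\<lambda>x. nth_deriv n \<phi> x + nth_deriv n \<psi> x)" for n
  have "(h n has_vector_derivative h (Suc n) x) (at x)" for n x
    unfolding h_def by (intro has_vector_derivative_add circle_test_deriv assms)
  from nth_deriv_chain[of h, OF this] circle_test_chain[of h, OF this]
  show ?A ?B
    by (simp_all add: h_def circle_test_per0 assms)
qed

lemma circle_test_scale:
  assumes "\<phi> \<in> circle_test"
  shows "(\<lambda>x. c * \<phi> x) \<in> circle_test" (is ?A)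
    and "nth_deriv n (\<lambda>x. c * \<phi> x) = (\<lambda>x. c * nth_deriv n \<phi> x)" (is ?B)
proof -
  define h where "h n = (\<lambda>x. c * nth_deriv n \<phi> x)" for n
  have "(h n has_vector_derivative h (Suc n) x) (at x)" for n x
    unfolding h_def by (intro has_vector_derivative_mult_right circle_test_deriv assms)
  from nth_deriv_chain[of h, OF this] circle_test_chain[of h, OF this]
  show ?A ?B
    by (simp_all add: h_def circle_test_per0 assms)
qed

lemma circle_test_diff:
  assumes "\<phi> \<in> circle_test" "\<psi> \<in> circle_test"
  shows "(\<lambda>x. \<phi> x - \<psi> x) \<in> circle_test" "nth_deriv n (\<lambda>x. \<phi> x - \<psi> x) = (\<lambda>x. nth_deriv n \<phi> x - nth_deriv n \<psi> x)"
  using circle_test_add[OF assms(1) circle_test_scale(1)[OF assms(2), of "- 1"]] circle_test_scale(2)[OF assms(2), of _ "- 1"]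
  by simp_all

lemma circle_test_shift:
  assumes "\<phi> \<in> circle_test"
  shows "(\<lambda>x. \<phi> (x + c)) \<in> circle_test" (is ?A)
    and "nth_deriv n (\<lambda>x. \<phi> (x + c)) = (\<lambda>x. nth_deriv n \<phi> (x + c))" (is ?B)
proof -
  define h where "h n = (\<lambda>x. nth_deriv n \<phi> (x + c))" for n
  have "(h n has_vector_derivative h (Suc n) x) (at x)" for n x
    unfolding h_def by (rule circle_test_deriv_shift[OF assms])
  from nth_deriv_chain[of h, OF this] circle_test_chain[of h, OF this]
  show ?A ?B
    using circle_test_per0[OF assms] by (simp_all add: h_def add.assoc add.commute[of _ c]) (simp_all add: add.assoc[symmetric])
qed

lemma circle_test_shift':
  assumes "\<phi> \<in> circle_test"
  shows "(\<lambda>x. \<phi> (c + x)) \<in> circle_test" "nth_deriv n (\<lambda>x. \<phi> (c + x)) = (\<lambda>x. nth_deriv n \<phi> (c + x))"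
    "(\<lambda>x. \<phi> (x - c)) \<in> circle_test" "nth_deriv n (\<lambda>x. \<phi> (x - c)) = (\<lambda>x. nth_deriv n \<phi> (x - c))"
  using circle_test_shift(1)[OF assms, of c] circle_test_shift(2)[OF assms, of n c]
    circle_test_shift(1)[OF assms, of "- c"] circle_test_shift(2)[OF assms, of n "- c"] by (simp_all add: add.commute)

lemma circle_test_reflect:
  assumes "\<phi> \<in> circle_test"
  shows "(\<lambda>x. \<phi> (- x)) \<in> circle_test" (is ?A)
    and "nth_deriv n (\<lambda>x. \<phi> (- x)) = (\<lambda>x. (- 1) ^ n * nth_deriv n \<phi> (- x))" (is ?B)
proof -
  define h where "h n = (\<lambda>x. (- 1) ^ n * nth_deriv n \<phi> (- x))" for n
  have *: "((\<lambda>y. nth_deriv n \<phi> (- y)) has_vector_derivative - nth_deriv (Suc n) \<phi> (- x)) (at x)" for n x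
  proof -
    have "((nth_deriv n \<phi> \<circ> (\<lambda>y. - y)) has_vector_derivative (- 1) *\<^sub>R nth_deriv (Suc n) \<phi> (- x)) (at x)"
      by (rule vector_diff_chain_at) (auto intro!: derivative_eq_intros circle_test_deriv[OF assms])
    then show ?thesis by (simp add: o_def)
  qed
  have "(h n has_vector_derivative h (Suc n) x) (at x)" for n x
    using has_vector_derivative_mult_right[OF *, of "(- 1) ^ n"] by (simp add: h_def)
  from nth_deriv_chain[of h, OF this] circle_test_chain[of h, OF this]
  show ?A ?B
    using circle_test_per0[OF assms, of "- x - 2 * pi" for x] by (simp_all add: h_def)
qed

section \<open>Distributions on the circle\<close>

lemma circle_dist_add:
  "f \<in> circle_dist \<Longrightarrow> \<phi> \<in> circle_test \<Longrightarrow> \<psi> \<in> circle_test \<Longrightarrow> f (\<lambda>x. \<phi> x + \<psi> x) = f \<phi> + f \<psi>"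
  by (simp add: circle_dist_def)

lemma circle_dist_scale:
  "f \<in> circle_dist \<Longrightarrow> \<phi> \<in> circle_test \<Longrightarrow> f (\<lambda>x. c * \<phi> x) = c * f \<phi>"
  by (simp add: circle_dist_def)

lemma circle_dist_outside: "f \<in> circle_dist \<Longrightarrow> \<phi> \<notin> circle_test \<Longrightarrow> f \<phi> = 0"
  by (simp add: circle_dist_def)

lemma circle_dist_diff:
  assumes "f \<in> circle_dist" "\<phi> \<in> circle_test" "\<psi> \<in> circle_test"
  shows "f (\<lambda>x. \<phi> x - \<psi> x) = f \<phi> - f \<psi>"
  using circle_dist_add[OF assms(1,2) circle_test_scale(1)[OF assms(3), of "- 1"]]
    circle_dist_scale[OF assms(1,3), of "- 1"] by simp

text \<open>
  Continuity with a common bound \<open>e\<close> on finitely many derivatives instead of suprema. With this form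
  and its converse \<open>circle_distI\<close>, continuity is used and proved without suprema.
\<close>

definition order_bound :: "real \<Rightarrow> nat \<Rightarrow> functional \<Rightarrow> bool" where
  "order_bound C N f \<longleftrightarrow> C > 0 \<and>
     (\<forall>\<phi>\<in>circle_test. \<forall>e. (\<forall>k\<le>N. \<forall>x. norm (nth_deriv k \<phi> x) \<le> e) \<longrightarrow> norm (f \<phi>) \<le> C * e)"

lemma order_boundD:
  assumes "order_bound C N f"
  shows "C > 0"
    and "\<phi> \<in> circle_test \<Longrightarrow> (\<And>k x. k \<le> N \<Longrightarrow> norm (nth_deriv k \<phi> x) \<le> e) \<Longrightarrow> norm (f \<phi>) \<le> C * e"
  using assms by (auto simp: order_bound_def)

lemma circle_dist_bound:
  assumes "f \<in> circle_dist"
  obtains C N where "order_bound C N f"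
proof -
  obtain C N where CN: "\<And>\<phi>. \<phi> \<in> circle_test \<Longrightarrow> norm (f \<phi>) \<le> C * (\<Sum>k\<le>N. SUP x. norm (nth_deriv k \<phi> x))"
    using assms unfolding circle_dist_def by blast
  have "norm (f \<phi>) \<le> ((\<bar>C\<bar> + 1) * real (Suc N)) * e" if \<phi>: "\<phi> \<in> circle_test" and e: "\<And>k x. k \<le> N \<Longrightarrow> norm (nth_deriv k \<phi> x) \<le> e" for \<phi> e
  proof -
    have 1: "(SUP x. norm (nth_deriv k \<phi> x)) \<le> e" if "k \<le> N" for k
      by (rule cSUP_least) (use e that in auto)
    have 2: "0 \<le> (SUP x. norm (nth_deriv k \<phi> x))" for k
      by (rule cSUP_upper2[OF circle_test_bdd[OF \<phi>], of 0]) auto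
    have "C * (\<Sum>k\<le>N. SUP x. norm (nth_deriv k \<phi> x)) \<le> (\<bar>C\<bar> + 1) * (\<Sum>k\<le>N. SUP x. norm (nth_deriv k \<phi> x))"
      by (intro mult_right_mono sum_nonneg 2) auto
    also have "\<dots> \<le> (\<bar>C\<bar> + 1) * (real (Suc N) * e)"
      using sum_bounded_above[of "{..N}" "\<lambda>k. SUP x. norm (nth_deriv k \<phi> x)" e] 1
      by (intro mult_left_mono) auto
    finally show ?thesis using CN[OF \<phi>] by (simp add: mult.assoc)
  qed
  then show ?thesis
    by (intro that[of "(\<bar>C\<bar> + 1) * real (Suc N)" N]) (auto simp: order_bound_def)
qed

lemma circle_distI:
  assumes "\<And>\<phi>. \<phi> \<notin> circle_test \<Longrightarrow> f \<phi> = 0"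
    "\<And>\<phi> \<psi>. \<phi> \<in> circle_test \<Longrightarrow> \<psi> \<in> circle_test \<Longrightarrow> f (\<lambda>x. \<phi> x + \<psi> x) = f \<phi> + f \<psi>"
    "\<And>c \<phi>. \<phi> \<in> circle_test \<Longrightarrow> f (\<lambda>x. c * \<phi> x) = c * f \<phi>"
    "C \<ge> 0" "\<And>\<phi> e. \<phi> \<in> circle_test \<Longrightarrow> (\<And>k x. k \<le> N \<Longrightarrow> norm (nth_deriv k \<phi> x) \<le> e) \<Longrightarrow> norm (f \<phi>) \<le> C * e"
  shows "f \<in> circle_dist"
proof -
  have "norm (f \<phi>) \<le> C * (\<Sum>k\<le>N. SUP x. norm (nth_deriv k \<phi> x))" if \<phi>: "\<phi> \<in> circle_test" for \<phi>
  proof (rule assms(5)[OF \<phi>])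
    fix k x assume "k \<le> N"
    have 2: "0 \<le> (SUP x. norm (nth_deriv k \<phi> x))" for k
      by (rule cSUP_upper2[OF circle_test_bdd[OF \<phi>], of 0]) auto
    have "norm (nth_deriv k \<phi> x) \<le> (SUP x. norm (nth_deriv k \<phi> x))"
      by (rule cSUP_upper[OF _ circle_test_bdd[OF \<phi>]]) simp
    also have "\<dots> \<le> (\<Sum>k\<le>N. SUP x. norm (nth_deriv k \<phi> x))"
      by (rule member_le_sum) (use \<open>k \<le> N\<close> 2 in auto)
    finally show "norm (nth_deriv k \<phi> x) \<le> (\<Sum>k\<le>N. SUP x. norm (nth_deriv k \<phi> x))" .
  qed
  with assms(1-3) show ?thesis unfolding circle_dist_def by blast
qed

lemma common_radius:
  assumes "\<And>k::nat. k \<le> N \<Longrightarrow> \<exists>d>0. P k (d::real)" "\<And>k d d'. P k d \<Longrightarrow> 0 < d' \<Longrightarrow> d' \<le> d \<Longrightarrow> P k d'"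
  shows "\<exists>d>0. \<forall>k\<le>N. P k d"
  using assms(1)
proof (induction N)
  case (Suc N)
  then obtain d d' where "d > 0" "d' > 0" "\<forall>k\<le>N. P k d" "P (Suc N) d'" by (metis le_Suc_eq)
  then show ?case
    by (intro exI[of _ "min d d'"]) (auto simp: le_Suc_eq intro: assms(2))
qed auto

text \<open>
  A distribution may be applied to a difference quotient that converges uniformly with all its
  derivatives. The convergence is written without division so that it can be compared with the
  definition of the derivative.
\<close>

lemma circle_dist_has_deriv:
  assumes f: "f \<in> circle_dist" and \<Phi>: "\<And>t. \<Phi> t \<in> circle_test" and \<Psi>: "\<Psi> \<in> circle_test"
    and conv: "\<And>k e. e > 0 \<Longrightarrow> \<exists>d>0. \<forall>t y. \<bar>t - t0\<bar> < d \<longrightarrow>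
       norm (nth_deriv k (\<Phi> t) y - nth_deriv k (\<Phi> t0) y - of_real (t - t0) * nth_deriv k \<Psi> y) \<le> e * \<bar>t - t0\<bar>"
  shows "((\<lambda>t. f (\<Phi> t)) has_vector_derivative f \<Psi>) (at t0)"
  unfolding has_vector_derivative_def has_derivative_at_alt
proof (intro conjI allI impI)
  show "bounded_linear (\<lambda>x. x *\<^sub>R f \<Psi>)" by (rule bounded_linear_scaleR_left)
  fix e :: real assume "e > 0"
  obtain C N where "order_bound C N f" by (rule circle_dist_bound[OF f])
  note CN = order_boundD[OF this]
  define P where "P k d \<longleftrightarrow> (\<forall>t y. \<bar>t - t0\<bar> < d \<longrightarrow>
       norm (nth_deriv k (\<Phi> t) y - nth_deriv k (\<Phi> t0) y - of_real (t - t0) * nth_deriv k \<Psi> y) \<le> (e / C) * \<bar>t - t0\<bar>)" for k d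
  have "\<exists>d>0. \<forall>k\<le>N. P k d"
    by (rule common_radius) (use conv[of "e / C"] \<open>e > 0\<close> CN(1) in \<open>auto simp: P_def\<close>)
  then obtain d where d: "d > 0" "\<And>k. k \<le> N \<Longrightarrow> P k d" by blast
  have "norm (f (\<Phi> t) - f (\<Phi> t0) - (t - t0) *\<^sub>R f \<Psi>) \<le> e * norm (t - t0)" if t: "norm (t - t0) < d" for t
  proof -
    define \<phi> where "\<phi> = (\<lambda>y. (\<Phi> t y - \<Phi> t0 y) - of_real (t - t0) * \<Psi> y)"
    have \<phi>: "\<phi> \<in> circle_test"
      unfolding \<phi>_def by (intro circle_test_diff circle_test_scale \<Phi> \<Psi>)
    have "f \<phi> = f (\<Phi> t) - f (\<Phi> t0) - of_real (t - t0) * f \<Psi>"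
      unfolding \<phi>_def
        circle_dist_diff[OF f circle_test_diff(1)[OF \<Phi> \<Phi>] circle_test_scale(1)[OF \<Psi>]]
        circle_dist_diff[OF f \<Phi> \<Phi>] circle_dist_scale[OF f \<Psi>] ..
    moreover have "norm (f \<phi>) \<le> C * ((e / C) * \<bar>t - t0\<bar>)"
    proof (rule CN(2)[OF \<phi>])
      fix k y assume "k \<le> N"
      have "nth_deriv k \<phi> y = nth_deriv k (\<Phi> t) y - nth_deriv k (\<Phi> t0) y - of_real (t - t0) * nth_deriv k \<Psi> y"
        unfolding \<phi>_def
        by (simp add: circle_test_diff(2)[OF circle_test_diff(1)[OF \<Phi> \<Phi>] circle_test_scale(1)[OF \<Psi>]] circle_test_diff(2)[OF \<Phi> \<Phi>] circle_test_scale(2)[OF \<Psi>]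
            del: of_real_diff)
      then show "norm (nth_deriv k \<phi> y) \<le> (e / C) * \<bar>t - t0\<bar>"
        using d(2)[OF \<open>k \<le> N\<close>] t unfolding P_def by simp
    qed
    ultimately show ?thesis using CN(1) by (simp add: scaleR_conv_of_real)
  qed
  then show "\<exists>d>0. \<forall>y. norm (y - t0) < d \<longrightarrow> norm (f (\<Phi> y) - f (\<Phi> t0) - (y - t0) *\<^sub>R f \<Psi>) \<le> e * norm (y - t0)"
    using d(1) by blast
qed

lemma circle_dist_tendsto:
  assumes f: "f \<in> circle_dist" and \<Phi>: "\<And>n::nat. \<Phi> n \<in> circle_test" and \<Psi>: "\<Psi> \<in> circle_test"
    and conv: "\<And>k e. e > 0 \<Longrightarrow> \<forall>\<^sub>F n in sequentially. \<forall>y. norm (nth_deriv k (\<Phi> n) y - nth_deriv k \<Psi> y) \<le> e"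
  shows "(\<lambda>n. f (\<Phi> n)) \<longlonglongrightarrow> f \<Psi>"
proof (rule tendstoI)
  fix e :: real assume "e > 0"
  obtain C N where "order_bound C N f" by (rule circle_dist_bound[OF f])
  note CN = order_boundD[OF this]
  have "\<forall>\<^sub>F n in sequentially. \<forall>k\<in>{..N}. \<forall>y. norm (nth_deriv k (\<Phi> n) y - nth_deriv k \<Psi> y) \<le> e / (2 * C)"
    by (intro eventually_ball_finite ballI conv) (use \<open>e > 0\<close> CN(1) in auto)
  then show "\<forall>\<^sub>F n in sequentially. dist (f (\<Phi> n)) (f \<Psi>) < e"
  proof eventually_elim
    case (elim n)
    have "norm (f (\<lambda>y. \<Phi> n y - \<Psi> y)) \<le> C * (e / (2 * C))"
      by (rule CN(2)) (use elim in \<open>auto simp: circle_test_diff \<Phi> \<Psi>\<close>)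
    then show ?case using CN(1) \<open>e > 0\<close> by (simp add: circle_dist_diff f \<Phi> \<Psi> dist_norm)
  qed
qed

lemma circle_test_taylor:
  assumes "\<phi> \<in> circle_test" "e > 0"
  shows "\<exists>d>0. \<forall>s t. \<bar>t - s\<bar> < d \<longrightarrow>
    norm (nth_deriv k \<phi> t - nth_deriv k \<phi> s - of_real (t - s) * nth_deriv (Suc k) \<phi> s) \<le> e * \<bar>t - s\<bar>"
proof -
  obtain d where d: "d > 0" "\<And>x y. \<bar>x - y\<bar> < d \<Longrightarrow> norm (nth_deriv (Suc k) \<phi> x - nth_deriv (Suc k) \<phi> y) < e"
    using circle_test_uniformly_continuous[OF assms] by blast
  have "norm (nth_deriv k \<phi> t - nth_deriv k \<phi> s - of_real (t - s) * nth_deriv (Suc k) \<phi> s) \<le> e * \<bar>t - s\<bar>"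
    if "\<bar>t - s\<bar> < d" for s t
  proof -
    have "norm (nth_deriv k \<phi> t - nth_deriv k \<phi> s - (t - s) *\<^sub>R nth_deriv (Suc k) \<phi> s) \<le> norm (t - s) * e"
    proof (rule vector_differentiable_bound_linearization[where S="closed_segment s t"])
      show "(nth_deriv k \<phi> has_vector_derivative nth_deriv (Suc k) \<phi> x) (at x within closed_segment s t)" for x
        by (rule has_vector_derivative_at_within[OF circle_test_deriv[OF assms(1)]])
      show "norm (nth_deriv (Suc k) \<phi> x - nth_deriv (Suc k) \<phi> s) \<le> e" if "x \<in> closed_segment s t" for x
        using d(2)[of x s] that \<open>\<bar>t - s\<bar> < d\<close>
        by (intro less_imp_le d(2)) (auto simp: closed_segment_eq_real_ivl split: if_splits)
    qed auto
    then show ?thesis by (simp add: scaleR_conv_of_real mult.commute)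
  qed
  then show ?thesis using d(1) by blast
qed

lemma circle_dist_translate_deriv:
  assumes f: "f \<in> circle_dist" and \<phi>: "\<phi> \<in> circle_test"
  shows "((\<lambda>x. f (\<lambda>y. \<phi> (x + y))) has_vector_derivative f (\<lambda>y. nth_deriv 1 \<phi> (x + y))) (at x)"
proof (rule circle_dist_has_deriv[OF f])
  fix k :: nat and e :: real assume "e > 0"
  then obtain d where d: "d > 0" "\<And>s t. \<bar>t - s\<bar> < d \<Longrightarrow>
    norm (nth_deriv k \<phi> t - nth_deriv k \<phi> s - of_real (t - s) * nth_deriv (Suc k) \<phi> s) \<le> e * \<bar>t - s\<bar>"
    using circle_test_taylor[OF \<phi>] by blast
  have "norm (nth_deriv k (\<lambda>y. \<phi> (t + y)) y - nth_deriv k (\<lambda>y. \<phi> (x + y)) y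
      - of_real (t - x) * nth_deriv k (\<lambda>y. nth_deriv 1 \<phi> (x + y)) y) \<le> e * \<bar>t - x\<bar>" if "\<bar>t - x\<bar> < d" for t y
    using d(2)[of "t + y" "x + y"] that
    by (simp add: circle_test_shift'(2) \<phi> circle_test_nth_deriv nth_deriv_add)
  then show "\<exists>d>0. \<forall>t y. \<bar>t - x\<bar> < d \<longrightarrow> norm (nth_deriv k (\<lambda>y. \<phi> (t + y)) y - nth_deriv k (\<lambda>y. \<phi> (x + y)) y
      - of_real (t - x) * nth_deriv k (\<lambda>y. nth_deriv 1 \<phi> (x + y)) y) \<le> e * \<bar>t - x\<bar>"
    using d(1) by blast
qed (auto intro: circle_test_shift' \<phi> circle_test_nth_deriv simp del: One_nat_def)

text \<open>
  Differentiation under the distribution. In particular the inner function in the definition of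
  \<open>dist_conv\<close> is a test function.
\<close>

lemma circle_dist_translate:
  assumes f: "f \<in> circle_dist" and \<phi>: "\<phi> \<in> circle_test"
  shows "(\<lambda>x. f (\<lambda>y. \<phi> (x + y))) \<in> circle_test" (is ?A)
    and "nth_deriv n (\<lambda>x. f (\<lambda>y. \<phi> (x + y))) = (\<lambda>x. f (\<lambda>y. nth_deriv n \<phi> (x + y)))" (is ?B)
proof -
  define h where "h n = (\<lambda>x. f (\<lambda>y. nth_deriv n \<phi> (x + y)))" for n
  have "(h n has_vector_derivative h (Suc n) x) (at x)" for n x
    using circle_dist_translate_deriv[OF f circle_test_nth_deriv[OF \<phi>, of n], of x]
    by (simp add: h_def nth_deriv_add)
  from nth_deriv_chain[of h, OF this] circle_test_chain[of h, OF this]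
  show ?A ?B
  proof -
    assume *: "(\<And>x. h 0 (x + 2 * pi) = h 0 x) \<Longrightarrow> h 0 \<in> circle_test" "\<And>n. nth_deriv n (h 0) = h n"
    have "\<phi> (x + 2 * pi + y) = \<phi> (x + y)" for x y
      using circle_test_per0[OF \<phi>, of "x + y"] by (simp add: algebra_simps)
    then show ?A ?B
      using * by (simp_all add: h_def)
  qed
qed

text \<open>
  Each derivative of \<open>x \<mapsto> g (\<phi> (x + \<cdot>))\<close> is \<open>g\<close> applied to a derivative of \<open>\<phi>\<close>, so the orders of \<open>f\<close>
  and \<open>g\<close> add up.
\<close>

lemma dist_conv_circle_dist:
  assumes f: "f \<in> circle_dist" and g: "g \<in> circle_dist"
  shows "dist_conv f g \<in> circle_dist"
proof -
  obtain C N where "order_bound C N f" by (rule circle_dist_bound[OF f])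
  note CN = order_boundD[OF this]
  obtain D M where "order_bound D M g" by (rule circle_dist_bound[OF g])
  note DM = order_boundD[OF this]
  show ?thesis
  proof (rule circle_distI[where C="C * D" and N="M + N"])
    fix \<phi> \<psi> c assume \<phi>: "\<phi> \<in> circle_test"
    show "dist_conv f g (\<lambda>x. c * \<phi> x) = c * dist_conv f g \<phi>"
      by (simp add: dist_conv_def \<phi> circle_test_scale circle_dist_scale[OF g circle_test_shift'(1)[OF \<phi>]]
          circle_dist_scale[OF f circle_dist_translate(1)[OF g \<phi>]])
    show "dist_conv f g (\<lambda>x. \<phi> x + \<psi> x) = dist_conv f g \<phi> + dist_conv f g \<psi>" if \<psi>: "\<psi> \<in> circle_test"
      using that by (simp add: dist_conv_def \<phi> circle_test_add
          circle_dist_add[OF g circle_test_shift'(1)[OF \<phi>] circle_test_shift'(1)[OF \<psi>]]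
          circle_dist_add[OF f circle_dist_translate(1)[OF g \<phi>] circle_dist_translate(1)[OF g \<psi>]])
  next
    fix \<phi> e assume \<phi>: "\<phi> \<in> circle_test" and e: "\<And>k x. k \<le> M + N \<Longrightarrow> norm (nth_deriv k \<phi> x) \<le> e"
    have "norm (f (\<lambda>x. g (\<lambda>y. \<phi> (x + y)))) \<le> C * (D * e)"
    proof (rule CN(2))
      show "(\<lambda>x. g (\<lambda>y. \<phi> (x + y))) \<in> circle_test" by (rule circle_dist_translate[OF g \<phi>])
      fix k x assume k: "k \<le> N"
      have "norm (g (\<lambda>y. nth_deriv k \<phi> (x + y))) \<le> D * e"
      proof (rule DM(2))
        show "(\<lambda>y. nth_deriv k \<phi> (x + y)) \<in> circle_test" by (intro circle_test_shift' circle_test_nth_deriv \<phi>)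
        show "norm (nth_deriv j (\<lambda>y. nth_deriv k \<phi> (x + y)) z) \<le> e" if "j \<le> M" for j z
          using e[of "j + k"] that k by (simp add: circle_test_shift'(2) circle_test_nth_deriv \<phi> nth_deriv_add)
      qed
      then show "norm (nth_deriv k (\<lambda>x. g (\<lambda>y. \<phi> (x + y))) x) \<le> D * e"
        by (simp add: circle_dist_translate(2)[OF g \<phi>])
    qed
    then show "norm (dist_conv f g \<phi>) \<le> C * D * e" by (simp add: dist_conv_def \<phi> mult.assoc)
  qed (use CN(1) DM(1) in \<open>auto simp: dist_conv_def\<close>)
qed

section \<open>Averages of translates\<close>

text \<open>
  The partial integrals of the circle convolution of \<open>\<psi>\<close> and \<open>\<phi>\<close>. The bounds are free because the
  interchange of a distribution with the integral is proved by differentiating in the upper bound.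
\<close>

definition avg :: "(real \<Rightarrow> complex) \<Rightarrow> real \<Rightarrow> real \<Rightarrow> (real \<Rightarrow> complex) \<Rightarrow> real \<Rightarrow> complex" where
  "avg \<psi> a b \<phi> y = integral {a..b} (\<lambda>s. \<psi> s * \<phi> (y - s))"

lemma avg_integrable:
  assumes "continuous_on UNIV \<psi>" "\<phi> \<in> circle_test"
  shows "(\<lambda>s. \<psi> s * nth_deriv n \<phi> (y - s)) integrable_on {a..b}"
  by (intro integrable_continuous_real continuous_intros continuous_on_subset[OF assms(1)]
       continuous_on_compose2[OF circle_test_cont[OF assms(2), of UNIV]]) auto

lemma avg_integrable0:
  assumes "continuous_on UNIV \<psi>" "\<phi> \<in> circle_test"
  shows "(\<lambda>s. \<psi> s * \<phi> (y - s)) integrable_on {a..b}"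
  using avg_integrable[OF assms, of 0] by simp

lemma avg_test:
  assumes \<psi>: "continuous_on UNIV \<psi>" and \<phi>: "\<phi> \<in> circle_test"
  shows "avg \<psi> a b \<phi> \<in> circle_test" (is ?A)
    and "nth_deriv n (avg \<psi> a b \<phi>) = avg \<psi> a b (nth_deriv n \<phi>)" (is ?B)
proof -
  define h where "h n = avg \<psi> a b (nth_deriv n \<phi>)" for n
  have "(h n has_vector_derivative h (Suc n) x) (at x)" for n x
  proof -
    have "((\<lambda>y. integral (cbox a b) (\<lambda>s. \<psi> s * nth_deriv n \<phi> (y - s))) has_vector_derivative
       integral (cbox a b) (\<lambda>s. \<psi> s * nth_deriv (Suc n) \<phi> (x - s))) (at x within UNIV)"
    proof (rule leibniz_rule_vector_derivative)
      fix y s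
      show "((\<lambda>x. \<psi> s * nth_deriv n \<phi> (x - s)) has_vector_derivative \<psi> s * nth_deriv (Suc n) \<phi> (y - s)) (at y within UNIV)"
        using has_vector_derivative_mult_right[OF circle_test_deriv_shift[OF \<phi>, of n "- s" y]] by simp
      show "(\<lambda>s. \<psi> s * nth_deriv n \<phi> (y - s)) integrable_on cbox a b"
        unfolding cbox_interval by (rule avg_integrable[OF \<psi> \<phi>])
    next
      show "continuous_on (UNIV \<times> cbox a b) (\<lambda>(x, t). \<psi> t * nth_deriv (Suc n) \<phi> (x - t))"
        unfolding case_prod_beta
        by (intro continuous_intros continuous_on_compose2[OF \<psi>] continuous_on_compose2[OF circle_test_cont[OF \<phi>, of UNIV]]) auto
    qed auto
    then show ?thesis by (simp add: h_def avg_def[abs_def])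
  qed
  from nth_deriv_chain[of h, OF this] circle_test_chain[of h, OF this]
  have *: "(\<And>x. h 0 (x + 2 * pi) = h 0 x) \<Longrightarrow> h 0 \<in> circle_test" "\<And>n. nth_deriv n (h 0) = h n" by blast+
  have "\<phi> (x + 2 * pi - s) = \<phi> (x - s)" for x s
    using circle_test_per0[OF \<phi>, of "x - s"] by (simp add: algebra_simps)
  then show ?A ?B
    using * by (simp_all add: h_def avg_def[abs_def])
qed

lemma avg_combine:
  assumes "continuous_on UNIV \<psi>" "\<phi> \<in> circle_test" "a \<le> b" "b \<le> c"
  shows "avg \<psi> a b \<phi> y + avg \<psi> b c \<phi> y = avg \<psi> a c \<phi> y"
  unfolding avg_def using Henstock_Kurzweil_Integration.integral_combine[OF assms(3,4) avg_integrable0[OF assms(1,2)]] by simp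

lemma norm_avg_diff_le:
  assumes \<psi>: "continuous_on UNIV \<psi>" and \<phi>: "\<phi> \<in> circle_test" and ab: "a \<le> b"
    and e: "\<And>s. s \<in> {a..b} \<Longrightarrow> norm (\<psi> s * nth_deriv k \<phi> (y - s) - c) \<le> e"
  shows "norm (avg \<psi> a b (nth_deriv k \<phi>) y - of_real (b - a) * c) \<le> e * (b - a)"
proof -
  have "avg \<psi> a b (nth_deriv k \<phi>) y - of_real (b - a) * c = integral {a..b} (\<lambda>s. \<psi> s * nth_deriv k \<phi> (y - s) - c)"
    unfolding avg_def
    by (subst Henstock_Kurzweil_Integration.integral_diff[OF avg_integrable[OF \<psi> \<phi>]])
       (use ab in \<open>auto simp: scaleR_conv_of_real\<close>)
  also have "norm \<dots> \<le> e * (b - a)"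
  proof (rule integral_bound[OF ab])
    show "continuous_on {a..b} (\<lambda>s. \<psi> s * nth_deriv k \<phi> (y - s) - c)"
      by (intro continuous_intros continuous_on_subset[OF \<psi>] continuous_on_compose2[OF circle_test_cont[OF \<phi>, of UNIV]]) auto
  qed (use e in auto)
  finally show ?thesis .
qed

text \<open>
  A distribution commutes with the integral. As functions of the upper bound \<open>t\<close>, both sides have
  the derivative \<open>\<psi> t * f (\<phi> (\<cdot> - t))\<close>: for the left side because the difference quotients of the
  average converge uniformly with all derivatives.
\<close>

lemma circle_dist_avg:
  assumes f: "f \<in> circle_dist" and \<psi>: "continuous_on UNIV \<psi>" and \<phi>: "\<phi> \<in> circle_test" and ab: "a \<le> b"
  shows "f (avg \<psi> a b \<phi>) = integral {a..b} (\<lambda>s. \<psi> s * f (\<lambda>y. \<phi> (y - s)))"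
proof -
  \<comment> \<open>Integrals from a point left of \<open>a\<close>, so that they have a two-sided derivative at \<open>a\<close> as well.\<close>
  define A where "A = a - 1"
  have der: "((\<lambda>t. f (avg \<psi> A t \<phi>)) has_vector_derivative f (\<lambda>y. \<psi> t0 * \<phi> (y - t0))) (at t0)"
    if t0: "t0 > A" for t0
  proof (rule circle_dist_has_deriv[OF f])
    fix k :: nat and e :: real assume e: "e > 0"
    obtain B where B: "\<And>x. norm (nth_deriv k \<phi> x) \<le> B"
      using periodic_bounded[of "nth_deriv k \<phi>"] circle_test_cont[OF \<phi>] circle_test_per[OF \<phi>] by metis
    have B0: "B \<ge> 0" using order_trans[OF norm_ge_zero B] .
    define P where "P = norm (\<psi> t0) + 1"
    have P: "P > 0" by (simp add: P_def add_nonneg_pos)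
    have "continuous (at t0) \<psi>" using \<psi> by (simp add: continuous_on_eq_continuous_at)
    then obtain d1 where d1: "d1 > 0" "\<And>s. \<bar>s - t0\<bar> < d1 \<Longrightarrow> norm (\<psi> s - \<psi> t0) < e / (2 * (B + 1))"
      unfolding continuous_at_eps_delta dist_norm real_norm_def
      using e B0 by (metis divide_pos_pos mult_pos_pos zero_less_numeral add_nonneg_pos zero_less_one)
    obtain d2 where d2: "d2 > 0" "\<And>x y. \<bar>x - y\<bar> < d2 \<Longrightarrow> norm (nth_deriv k \<phi> x - nth_deriv k \<phi> y) < e / (2 * P)"
      using circle_test_uniformly_continuous[OF \<phi>, of "e / (2 * P)" k] e P by auto
    define d where "d = min (t0 - A) (min d1 d2)"
    have d: "d > 0" using t0 d1(1) d2(1) by (simp add: d_def)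
    have near: "norm (\<psi> s * nth_deriv k \<phi> (y - s) - \<psi> t0 * nth_deriv k \<phi> (y - t0)) \<le> e" if s: "\<bar>s - t0\<bar> < d" for s y
    proof -
      have "\<psi> s * nth_deriv k \<phi> (y - s) - \<psi> t0 * nth_deriv k \<phi> (y - t0)
          = (\<psi> s - \<psi> t0) * nth_deriv k \<phi> (y - s) + \<psi> t0 * (nth_deriv k \<phi> (y - s) - nth_deriv k \<phi> (y - t0))"
        by (simp add: algebra_simps)
      then have "norm (\<psi> s * nth_deriv k \<phi> (y - s) - \<psi> t0 * nth_deriv k \<phi> (y - t0))
          \<le> norm (\<psi> s - \<psi> t0) * norm (nth_deriv k \<phi> (y - s)) + norm (\<psi> t0) * norm (nth_deriv k \<phi> (y - s) - nth_deriv k \<phi> (y - t0))"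
        by (metis norm_mult norm_triangle_ineq)
      also have "\<dots> \<le> (e / (2 * (B + 1))) * (B + 1) + P * (e / (2 * P))"
      proof (rule add_mono; rule mult_mono)
        show "norm (\<psi> s - \<psi> t0) \<le> e / (2 * (B + 1))" using d1(2)[of s] s by (simp add: d_def)
        show "norm (nth_deriv k \<phi> (y - s)) \<le> B + 1" using B[of "y - s"] by simp
        show "norm (nth_deriv k \<phi> (y - s) - nth_deriv k \<phi> (y - t0)) \<le> e / (2 * P)"
          using d2(2)[of "y - s" "y - t0"] s by (simp add: d_def abs_minus_commute)
      qed (use e B0 P in \<open>auto simp: P_def\<close>)
      also have "\<dots> = e" using B0 P by (simp add: field_simps)
      finally show ?thesis .
    qed
    have "norm (nth_deriv k (avg \<psi> A t \<phi>) y - nth_deriv k (avg \<psi> A t0 \<phi>) y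
        - of_real (t - t0) * nth_deriv k (\<lambda>y. \<psi> t0 * \<phi> (y - t0)) y) \<le> e * \<bar>t - t0\<bar>" if t: "\<bar>t - t0\<bar> < d" for t y
    proof -
      have tA: "A \<le> t" "A \<le> t0" using t t0 by (auto simp: d_def)
      have rhs: "nth_deriv k (\<lambda>y. \<psi> t0 * \<phi> (y - t0)) y = \<psi> t0 * nth_deriv k \<phi> (y - t0)"
        by (simp add: circle_test_scale(2) circle_test_shift' \<phi>)
      have comb: "a \<le> b \<Longrightarrow> b \<le> c \<Longrightarrow> avg \<psi> a c (nth_deriv k \<phi>) y = avg \<psi> a b (nth_deriv k \<phi>) y + avg \<psi> b c (nth_deriv k \<phi>) y" for a b c
        by (rule avg_combine[OF \<psi> circle_test_nth_deriv[OF \<phi>], symmetric])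
      show ?thesis
      proof (cases "t0 \<le> t")
        case True
        then have "norm (avg \<psi> t0 t (nth_deriv k \<phi>) y - of_real (t - t0) * (\<psi> t0 * nth_deriv k \<phi> (y - t0))) \<le> e * (t - t0)"
          by (intro norm_avg_diff_le[OF \<psi> \<phi>] near) (use t in auto)
        then show ?thesis
          using True unfolding rhs avg_test(2)[OF \<psi> \<phi>] comb[OF tA(2) True] by simp
      next
        case False
        then have "norm (avg \<psi> t t0 (nth_deriv k \<phi>) y - of_real (t0 - t) * (\<psi> t0 * nth_deriv k \<phi> (y - t0))) \<le> e * (t0 - t)"
          by (intro norm_avg_diff_le[OF \<psi> \<phi>] near) (use t in auto)
        moreover have "nth_deriv k (avg \<psi> A t \<phi>) y - nth_deriv k (avg \<psi> A t0 \<phi>) y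
            - of_real (t - t0) * nth_deriv k (\<lambda>y. \<psi> t0 * \<phi> (y - t0)) y
            = - (avg \<psi> t t0 (nth_deriv k \<phi>) y - of_real (t0 - t) * (\<psi> t0 * nth_deriv k \<phi> (y - t0)))"
          unfolding rhs avg_test(2)[OF \<psi> \<phi>] using comb[OF tA(1), of t0] False by (simp add: algebra_simps)
        ultimately show ?thesis using False by (simp only: norm_minus_cancel) simp
      qed
    qed
    then show "\<exists>d>0. \<forall>t y. \<bar>t - t0\<bar> < d \<longrightarrow> norm (nth_deriv k (avg \<psi> A t \<phi>) y - nth_deriv k (avg \<psi> A t0 \<phi>) y
        - of_real (t - t0) * nth_deriv k (\<lambda>y. \<psi> t0 * \<phi> (y - t0)) y) \<le> e * \<bar>t - t0\<bar>"
      using d by blast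
  qed (auto intro!: avg_test \<psi> \<phi> circle_test_scale circle_test_shift')
  have "((\<lambda>t. f (\<lambda>y. \<psi> t * \<phi> (y - t))) has_integral (f (avg \<psi> A b \<phi>) - f (avg \<psi> A a \<phi>))) {a..b}"
    by (rule fundamental_theorem_of_calculus[OF ab], rule has_vector_derivative_at_within, rule der)
       (simp add: A_def)
  then have "integral {a..b} (\<lambda>t. f (\<lambda>y. \<psi> t * \<phi> (y - t))) = f (avg \<psi> A b \<phi>) - f (avg \<psi> A a \<phi>)"
    by (rule integral_unique)
  moreover have "f (\<lambda>y. \<psi> t * \<phi> (y - t)) = \<psi> t * f (\<lambda>y. \<phi> (y - t))" for t
    by (rule circle_dist_scale[OF f circle_test_shift'(3)[OF \<phi>]])
  moreover have "f (avg \<psi> A b \<phi>) - f (avg \<psi> A a \<phi>) = f (avg \<psi> a b \<phi>)"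
  proof -
    have "avg \<psi> a b \<phi> = (\<lambda>y. avg \<psi> A b \<phi> y - avg \<psi> A a \<phi> y)"
      using avg_combine[OF \<psi> \<phi>, of A a b] ab by (simp add: A_def algebra_simps fun_eq_iff)
    then show ?thesis by (simp add: circle_dist_diff[OF f avg_test(1)[OF \<psi> \<phi>] avg_test(1)[OF \<psi> \<phi>]])
  qed
  ultimately show ?thesis by simp
qed

text \<open>
  Reduce \<open>c\<close> to \<open>[-\<pi>, \<pi>)\<close>, then move the part of the interval that sticks out by one period.
\<close>

lemma integral_period_shift:
  fixes h :: "real \<Rightarrow> complex"
  assumes h: "continuous_on UNIV h" and per: "\<And>x. h (x + 2 * pi) = h x"
  shows "integral {c - pi..c + pi} h = integral {- pi..pi} h"
proof -
  have int: "h integrable_on {a..b}" for a b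
    by (rule integrable_continuous_real[OF continuous_on_subset[OF h]]) simp
  have shift1: "integral {a + 2 * pi..b + 2 * pi} h = integral {a..b} h" for a b
    using integral_shift_Icc_real[of a b h "2 * pi"] per by (simp add: o_def add.commute[of "2 * pi"])
  obtain k :: int where k: "- pi \<le> c - 2 * pi * of_int k" "c - 2 * pi * of_int k < - pi + 2 * pi"
    by (rule reduce_mod_2pi)
  define d where "d = c - 2 * pi * of_int k"
  have shiftk: "integral {a + 2 * pi * real n..b + 2 * pi * real n} h = integral {a..b} h" for a b and n
  proof (induction n arbitrary: a b)
    case (Suc n)
    show ?case using Suc[of "a + 2 * pi" "b + 2 * pi"] shift1[of a b] by (simp add: algebra_simps)
  qed simp
  have "integral {c - pi..c + pi} h = integral {d - pi..d + pi} h"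
  proof (cases k)
    case (nonneg n)
    then show ?thesis using shiftk[of "d - pi" n "d + pi"] by (simp add: d_def algebra_simps)
  next
    case (neg n)
    then have rk: "real_of_int k = - real (Suc n)" by simp
    have "d = c + 2 * pi * real (Suc n)" unfolding d_def rk by (simp del: of_nat_Suc)
    then show ?thesis using shiftk[of "c - pi" "Suc n" "c + pi"] by (simp add: algebra_simps del: of_nat_Suc)
  qed
  also have "\<dots> = integral {- pi..pi} h"
  proof (cases "d \<ge> 0")
    case True
    have "integral {-pi..d - pi} h + integral {d - pi..pi} h = integral {-pi..pi} h"
      by (rule Henstock_Kurzweil_Integration.integral_combine) (use True k int d_def in auto)
    moreover have "integral {d - pi..pi} h + integral {pi..d + pi} h = integral {d - pi..d + pi} h"
      by (rule Henstock_Kurzweil_Integration.integral_combine) (use True k int d_def in auto)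
    moreover have "integral {pi..d + pi} h = integral {- pi..d - pi} h"
      using shift1[of "- pi" "d - pi"] by (simp add: algebra_simps)
    ultimately show ?thesis by (metis add.commute)
  next
    case False
    have "integral {-pi..d + pi} h + integral {d + pi..pi} h = integral {-pi..pi} h"
      by (rule Henstock_Kurzweil_Integration.integral_combine) (use False k int d_def in auto)
    moreover have "integral {d - pi..-pi} h + integral {-pi..d + pi} h = integral {d - pi..d + pi} h"
      by (rule Henstock_Kurzweil_Integration.integral_combine) (use False k int d_def in auto)
    moreover have "integral {d + pi..pi} h = integral {d - pi..-pi} h"
      using shift1[of "d - pi" "- pi"] by (simp add: algebra_simps)
    ultimately show ?thesis by (metis add.commute)
  qed
  finally show ?thesis .
qed

lemma integral_period_reflect:
  fixes h :: "real \<Rightarrow> complex"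
  assumes h: "continuous_on UNIV h" and per: "\<And>x. h (x + 2 * pi) = h x"
  shows "integral {- pi..pi} (\<lambda>s. h (c - s)) = integral {- pi..pi} h"
proof -
  have "integral {- pi..pi} (\<lambda>s. h (c - s)) = integral {- pi..pi} (\<lambda>s. h (c + s))"
    using Henstock_Kurzweil_Integration.integral_reflect_real[of "pi" "- pi" "\<lambda>s. h (c + s)"] by simp
  also have "\<dots> = integral {c - pi..c + pi} h"
    using integral_shift_Icc_real[of "- pi" pi h c] by (simp add: o_def add.commute)
  finally show ?thesis using integral_period_shift[OF assms] by simp
qed

lemma integral_period_translate:
  fixes h :: "real \<Rightarrow> complex"
  assumes h: "continuous_on UNIV h" and per: "\<And>x. h (x + 2 * pi) = h x"
  shows "integral {- pi..pi} (\<lambda>s. h (s + c)) = integral {- pi..pi} h"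
proof -
  have "integral {- pi..pi} (\<lambda>s. h (s + c)) = integral {c - pi..c + pi} h"
    using integral_shift_Icc_real[of "- pi" pi h c] by (simp add: o_def add.commute)
  then show ?thesis using integral_period_shift[OF assms] by simp
qed

section \<open>Mollifiers\<close>

text \<open>
  The functions \<open>p(1/y) exp (- 1/y)\<close>, extended by \<open>0\<close> to \<open>y \<le> 0\<close>. With \<open>p\<close> arbitrary the family is closed
  under differentiation, which gives smoothness at \<open>0\<close>.
\<close>

definition flat :: "real poly \<Rightarrow> real \<Rightarrow> real" where
  "flat p y = (if y > 0 then poly p (1 / y) * exp (- (1 / y)) else 0)"

lemma flat_tendsto_0: "(flat p \<longlongrightarrow> 0) (at 0)"
proof -
  have "((\<lambda>x. \<Sum>i\<le>degree p. coeff p i * (x ^ i / exp x)) \<longlongrightarrow> (\<Sum>i\<le>degree p. coeff p i * 0)) at_top"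
    by (intro tendsto_sum tendsto_mult tendsto_const tendsto_power_div_exp_0)
  then have "((\<lambda>x. poly p x * exp (- x)) \<longlongrightarrow> 0) at_top"
    by (simp add: poly_altdef sum_distrib_right exp_minus divide_inverse mult.assoc)
  moreover have "\<forall>\<^sub>F x in at_top. poly p x * exp (- x) = flat p (inverse x)"
    using eventually_gt_at_top[of 0] by eventually_elim (simp add: flat_def divide_inverse)
  ultimately have "((\<lambda>x. flat p (inverse x)) \<longlongrightarrow> 0) at_top"
    by (rule Lim_transform_eventually)
  then have r: "(flat p \<longlongrightarrow> 0) (at_right 0)"
    by (simp add: filterlim_at_right_to_top)
  have "\<forall>\<^sub>F x in at_left (0::real). 0 = flat p x"
    by (auto simp: eventually_at_filter flat_def)
  then have l: "(flat p \<longlongrightarrow> 0) (at_left 0)"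
    by (rule Lim_transform_eventually[OF tendsto_const])
  show ?thesis by (rule filterlim_split_at[OF l r])
qed

lemma flat_deriv:
  "(flat p has_real_derivative flat (monom 1 2 * (p - pderiv p)) y) (at y)"
proof (cases y "0 :: real" rule: linorder_cases)
  case less
  have "((\<lambda>_. 0) has_real_derivative 0) (at y)" by simp
  then have "(flat p has_real_derivative 0) (at y)"
    by (rule has_field_derivative_transform_within_open[of _ _ _ "{..<0}"]) (use less in \<open>auto simp: flat_def\<close>)
  then show ?thesis using less by (simp add: flat_def)
next
  case equal
  have "(flat p y - flat p 0) / (y - 0) = flat (pCons 0 p) y" if "y \<noteq> 0" for y
    using that by (simp add: flat_def)
  then have "\<forall>\<^sub>F y in at 0. flat (pCons 0 p) y = (flat p y - flat p 0) / (y - 0)"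
    by (auto simp: eventually_at_filter)
  from Lim_transform_eventually[OF flat_tendsto_0 this]
  show ?thesis using equal by (simp add: has_field_derivative_iff flat_def)
next
  case greater
  have inv: "((\<lambda>y. 1 / y) has_real_derivative - (1 / y\<^sup>2)) (at y)"
    using greater by (auto intro!: derivative_eq_intros simp: power2_eq_square)
  have "((\<lambda>y. poly p (1 / y) * exp (- (1 / y))) has_real_derivative
     (poly (pderiv p) (1 / y) * - (1 / y\<^sup>2)) * exp (- (1 / y)) + (exp (- (1 / y)) * - (- (1 / y\<^sup>2))) * poly p (1 / y)) (at y)"
    by (rule DERIV_mult[OF DERIV_chain2[OF poly_DERIV inv] DERIV_chain2[OF DERIV_exp DERIV_minus[OF inv]]])
  then have "((\<lambda>y. poly p (1 / y) * exp (- (1 / y))) has_real_derivative flat (monom 1 2 * (p - pderiv p)) y) (at y)"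
    using greater by (simp add: flat_def poly_monom algebra_simps power_divide)
  then show ?thesis
    by (rule has_field_derivative_transform_within_open[of _ _ _ "{0<..}"]) (use greater in \<open>auto simp: flat_def\<close>)
qed

text \<open>
  A finite order version of smoothness, for which the product rule can be proved by induction.
\<close>

definition diff_upto :: "nat \<Rightarrow> (real \<Rightarrow> complex) \<Rightarrow> bool" where
  "diff_upto n \<phi> \<longleftrightarrow> (\<forall>k<n. \<forall>x. nth_deriv k \<phi> differentiable (at x))"

lemma diff_upto_0 [simp]: "diff_upto 0 \<phi>" by (simp add: diff_upto_def)

lemma diff_upto_SucI:
  assumes "\<And>x. (\<phi> has_vector_derivative \<phi>' x) (at x)" "diff_upto n \<phi>'"
  shows "diff_upto (Suc n) \<phi>"
proof -
  have 1: "nth_deriv 1 \<phi> = \<phi>'"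
    using assms(1) vector_derivative_at by (fastforce simp: nth_deriv_Suc)
  have "nth_deriv (Suc k) \<phi> = nth_deriv k \<phi>'" for k
    using nth_deriv_add[of k 1 \<phi>] 1 by simp
  then show ?thesis
    using assms differentiableI_vector[OF assms(1)]
    by (auto simp: diff_upto_def less_Suc_eq_0_disj)
qed

lemma diff_upto_SucE:
  assumes "diff_upto (Suc n) \<phi>"
  obtains \<phi>' where "\<And>x. (\<phi> has_vector_derivative \<phi>' x) (at x)" "diff_upto n \<phi>'"
proof (rule that[of "nth_deriv 1 \<phi>"])
  have "\<phi> differentiable (at x)" for x using assms by (force simp: diff_upto_def)
  then show "(\<phi> has_vector_derivative nth_deriv 1 \<phi> x) (at x)" for x
    using vector_derivative_works by (auto simp: nth_deriv_Suc)
  show "diff_upto n (nth_deriv 1 \<phi>)"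
    using assms by (auto simp: diff_upto_def nth_deriv_add simp del: One_nat_def)
qed

lemma diff_upto_mono: "diff_upto n \<phi> \<Longrightarrow> m \<le> n \<Longrightarrow> diff_upto m \<phi>"
  by (auto simp: diff_upto_def)

lemma diff_upto_add: "diff_upto n \<phi> \<Longrightarrow> diff_upto n \<psi> \<Longrightarrow> diff_upto n (\<lambda>x. \<phi> x + \<psi> x)"
proof (induction n arbitrary: \<phi> \<psi>)
  case (Suc n)
  obtain \<phi>' where \<phi>': "\<And>x. (\<phi> has_vector_derivative \<phi>' x) (at x)" "diff_upto n \<phi>'"
    using diff_upto_SucE[OF Suc.prems(1)] by metis
  obtain \<psi>' where \<psi>': "\<And>x. (\<psi> has_vector_derivative \<psi>' x) (at x)" "diff_upto n \<psi>'"
    using diff_upto_SucE[OF Suc.prems(2)] by metis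
  show ?case
    by (rule diff_upto_SucI[OF has_vector_derivative_add[OF \<phi>'(1) \<psi>'(1)] Suc.IH[OF \<phi>'(2) \<psi>'(2)]])
qed simp

lemma diff_upto_mult: "diff_upto n \<phi> \<Longrightarrow> diff_upto n \<psi> \<Longrightarrow> diff_upto n (\<lambda>x. \<phi> x * \<psi> x)"
proof (induction n arbitrary: \<phi> \<psi>)
  case (Suc n)
  obtain \<phi>' where \<phi>': "\<And>x. (\<phi> has_vector_derivative \<phi>' x) (at x)" "diff_upto n \<phi>'"
    using diff_upto_SucE[OF Suc.prems(1)] by metis
  obtain \<psi>' where \<psi>': "\<And>x. (\<psi> has_vector_derivative \<psi>' x) (at x)" "diff_upto n \<psi>'"
    using diff_upto_SucE[OF Suc.prems(2)] by metis
  have d: "diff_upto n \<phi>" "diff_upto n \<psi>" using Suc.prems diff_upto_mono by (meson le_SucI order_refl)+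
  show ?case
    by (rule diff_upto_SucI[OF has_vector_derivative_mult[OF \<phi>'(1) \<psi>'(1)]
         diff_upto_add[OF Suc.IH[OF d(1) \<psi>'(2)] Suc.IH[OF \<phi>'(2) d(2)]]])
qed simp

lemma has_vector_derivative_complex_of_real:
  assumes "(f has_real_derivative f') (at x)"
  shows "((\<lambda>x. complex_of_real (f x)) has_vector_derivative complex_of_real f') (at x)"
  by (rule has_vector_derivative_of_real[OF assms])

lemma diff_upto_trig: "diff_upto n (\<lambda>x. of_real (sin x)) \<and> diff_upto n (\<lambda>x. of_real (- sin x)) \<and>
  diff_upto n (\<lambda>x. of_real (cos x)) \<and> diff_upto n (\<lambda>x. of_real (- cos x))"
proof (induction n)
  case (Suc n)
  have d: "(sin has_real_derivative cos x) (at x)" "((\<lambda>x. - sin x) has_real_derivative - cos x) (at x)"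
    "(cos has_real_derivative - sin x) (at x)" "((\<lambda>x. - cos x) has_real_derivative sin x) (at x)" for x :: real
    by (auto intro!: derivative_eq_intros)
  show ?case
    using Suc diff_upto_SucI[OF has_vector_derivative_complex_of_real[OF d(1)]]
      diff_upto_SucI[OF has_vector_derivative_complex_of_real[OF d(2)]]
      diff_upto_SucI[OF has_vector_derivative_complex_of_real[OF d(3)]]
      diff_upto_SucI[OF has_vector_derivative_complex_of_real[OF d(4)]] by blast
qed simp

lemma diff_upto_flat_cos: "diff_upto n (\<lambda>x. of_real (flat p (cos x - c)))"
proof (induction n arbitrary: p)
  case (Suc n)
  show ?case
  proof (rule diff_upto_SucI)
    fix x
    have "((\<lambda>x. flat p (cos x - c)) has_real_derivative flat (monom 1 2 * (p - pderiv p)) (cos x - c) * (- sin x)) (at x)"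
      by (rule DERIV_chain2[OF flat_deriv]) (auto intro!: derivative_eq_intros)
    from has_vector_derivative_complex_of_real[OF this]
    show "((\<lambda>x. complex_of_real (flat p (cos x - c))) has_vector_derivative
       of_real (flat (monom 1 2 * (p - pderiv p)) (cos x - c)) * of_real (- sin x)) (at x)"
      by simp
    show "diff_upto n (\<lambda>x. complex_of_real (flat (monom 1 2 * (p - pderiv p)) (cos x - c)) * of_real (- sin x))"
      by (rule diff_upto_mult[OF Suc.IH]) (use diff_upto_trig in blast)
  qed
qed simp

text \<open>
  Composing with the cosine makes the bump periodic for free; for \<open>p = 1\<close> it is positive exactly
  where \<open>cos x > c\<close>.
\<close>

lemma bump_test: "(\<lambda>x. complex_of_real (flat p (cos x - c))) \<in> circle_test"
  unfolding circle_test_def using diff_upto_flat_cos[of _ p c] by (auto simp: diff_upto_def)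

text \<open>
  The distance from \<open>x\<close> to \<open>2\<pi>\<int>\<close> is less than \<open>e\<close>.
\<close>

definition near :: "real \<Rightarrow> real \<Rightarrow> bool" where
  "near e x \<longleftrightarrow> (\<exists>k::int. \<bar>x - 2 * pi * of_int k\<bar> < e)"

lemma near_of_cos:
  assumes "0 < e" "e \<le> pi" "cos x > cos e"
  shows "near e x"
proof -
  obtain k where k: "- pi \<le> x - 2 * pi * of_int k" "x - 2 * pi * of_int k < - pi + 2 * pi"
    by (rule reduce_mod_2pi)
  define y where "y = x - 2 * pi * of_int k"
  have "cos y = cos x"
    unfolding y_def using periodic_int_shift[of cos x "- k"] by (simp add: cos_periodic)
  then have "cos \<bar>y\<bar> > cos e" using assms(3) by simp
  then have "\<bar>y\<bar> < e"
    using cos_monotone_0_pi_le[of e "\<bar>y\<bar>"] assms k by (fastforce simp: y_def abs_le_iff)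
  then show ?thesis unfolding near_def y_def by blast
qed

definition mollifier :: "real \<Rightarrow> (real \<Rightarrow> real) \<Rightarrow> bool" where
  "mollifier e r \<longleftrightarrow> (\<lambda>x. complex_of_real (r x)) \<in> circle_test \<and> (\<forall>x. 0 \<le> r x) \<and>
     (\<forall>x. r x \<noteq> 0 \<longrightarrow> near e x) \<and> integral {- pi..pi} r = 1"

lemma mollifier_exists:
  assumes "0 < e" "e \<le> pi"
  shows "\<exists>r. mollifier e r"
proof -
  define b where "b x = flat 1 (cos x - cos e)" for x
  define I where "I = integral {- pi..pi} b"
  have bt: "(\<lambda>x. complex_of_real (b x)) \<in> circle_test" unfolding b_def by (rule bump_test)
  have b0: "b x \<ge> 0" for x by (simp add: b_def flat_def)
  have bc: "continuous_on {- pi..pi} b"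
    using continuous_on_Re[OF circle_test_cont0[OF bt]] by simp
  have "cos e < 1" using cos_monotone_0_pi[of 0 e] assms by simp
  then have "b 0 \<noteq> 0" by (simp add: b_def flat_def)
  then have "I \<noteq> 0"
    unfolding I_def by (subst integral_eq_0_iff[OF bc]) (use b0 in \<open>auto intro!: bexI[of _ 0]\<close>)
  moreover have "I \<ge> 0" unfolding I_def by (rule Henstock_Kurzweil_Integration.integral_nonneg[OF integrable_continuous_real[OF bc] b0])
  ultimately have I: "I > 0" by simp
  have "mollifier e (\<lambda>x. b x / I)"
    unfolding mollifier_def
  proof (intro conjI allI impI)
    show "(\<lambda>x. complex_of_real (b x / I)) \<in> circle_test"
      using circle_test_scale(1)[OF bt, of "of_real (1 / I)"] by simp
    show "0 \<le> b x / I" for x using b0 I by simp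
    show "near e x" if "b x / I \<noteq> 0" for x
      using that by (intro near_of_cos assms) (auto simp: b_def flat_def split: if_splits)
    show "integral {- pi..pi} (\<lambda>x. b x / I) = 1" using I by (simp add: I_def[symmetric])
  qed
  then show ?thesis by blast
qed

text \<open>
  The average of \<open>\<phi> (y - s)\<close> with a weight of total mass one concentrated at \<open>s\<close> near \<open>2\<pi>\<int>\<close>.
\<close>

lemma avg_mollifier_close:
  assumes r: "mollifier e r" and \<phi>: "\<phi> \<in> circle_test"
    and d: "\<And>x y. \<bar>x - y\<bar> < e \<Longrightarrow> norm (nth_deriv k \<phi> x - nth_deriv k \<phi> y) \<le> \<delta>"
  shows "norm (nth_deriv k (avg (\<lambda>x. of_real (r x)) (- pi) pi \<phi>) y - nth_deriv k \<phi> y) \<le> \<delta>"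
proof -
  let ?h = "nth_deriv k \<phi>"
  have rt: "(\<lambda>x. complex_of_real (r x)) \<in> circle_test" and r0: "\<And>x. 0 \<le> r x"
    and rn: "\<And>x. r x \<noteq> 0 \<Longrightarrow> near e x" and r1: "integral {- pi..pi} r = 1"
    using r by (auto simp: mollifier_def)
  have rc: "continuous_on UNIV (\<lambda>x. complex_of_real (r x))" by (rule circle_test_cont0[OF rt])
  have "continuous_on {- pi..pi} r" using continuous_on_Re[OF circle_test_cont0[OF rt]] by simp
  then have ri: "r integrable_on {- pi..pi}" by (rule integrable_continuous_real)
  have i1: "(\<lambda>s. of_real (r s) * ?h (y - s)) integrable_on {- pi..pi}" by (rule avg_integrable[OF rc \<phi>])
  have i2: "(\<lambda>s. r s *\<^sub>R ?h y) integrable_on {- pi..pi}"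
    using integrable_linear[OF ri bounded_linear_scaleR_left] by (simp add: o_def)
  have "?h y = integral {- pi..pi} (\<lambda>s. r s *\<^sub>R ?h y)"
    using integral_linear[OF ri bounded_linear_scaleR_left, of "?h y"] r1 by (simp add: o_def)
  then have "nth_deriv k (avg (\<lambda>x. of_real (r x)) (- pi) pi \<phi>) y - ?h y
      = integral {- pi..pi} (\<lambda>s. of_real (r s) * ?h (y - s) - r s *\<^sub>R ?h y)"
    unfolding avg_test(2)[OF rc \<phi>] avg_def Henstock_Kurzweil_Integration.integral_diff[OF i1 i2] by simp
  also have "norm \<dots> \<le> integral {- pi..pi} (\<lambda>s. r s * \<delta>)"
  proof (rule Henstock_Kurzweil_Integration.integral_norm_bound_integral)
    show "(\<lambda>s. of_real (r s) * ?h (y - s) - r s *\<^sub>R ?h y) integrable_on {- pi..pi}"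
      by (rule Henstock_Kurzweil_Integration.integrable_diff[OF i1 i2])
    show "(\<lambda>s. r s * \<delta>) integrable_on {- pi..pi}" by (rule integrable_on_mult_left[OF ri])
    fix s
    have "of_real (r s) * ?h (y - s) - r s *\<^sub>R ?h y = of_real (r s) * (?h (y - s) - ?h y)"
      by (simp add: scaleR_conv_of_real algebra_simps)
    then have eq: "norm (of_real (r s) * ?h (y - s) - r s *\<^sub>R ?h y) = r s * norm (?h (y - s) - ?h y)"
      by (simp add: norm_mult r0)
    show "norm (of_real (r s) * ?h (y - s) - r s *\<^sub>R ?h y) \<le> r s * \<delta>"
    proof (cases "r s = 0")
      case False
      then obtain j :: int where "\<bar>s - 2 * pi * of_int j\<bar> < e" using rn unfolding near_def by blast
      then have "norm (?h (y - (s - 2 * pi * of_int j)) - ?h y) \<le> \<delta>"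
        by (intro d) simp
      moreover have "?h (y - (s - 2 * pi * of_int j)) = ?h (y - s)"
        using periodic_int_shift[of ?h "y - s" j, OF circle_test_per[OF \<phi>]] by (simp add: algebra_simps)
      ultimately show ?thesis unfolding eq using r0 by (simp add: mult_left_mono)
    qed simp
  qed
  also have "\<dots> = \<delta>" using r1 by simp
  finally show ?thesis .
qed

definition moll :: "nat \<Rightarrow> real \<Rightarrow> complex" where
  "moll n = (\<lambda>x. of_real ((SOME r. mollifier (1 / real (Suc n)) r) x))"

lemma moll:
  obtains r where "mollifier (1 / real (Suc n)) r" "moll n = (\<lambda>x. of_real (r x))"
proof -
  have "1 / real (Suc n) \<le> 1" by simp
  then have "1 / real (Suc n) \<le> pi" using pi_gt3 by linarith
  then have "\<exists>r. mollifier (1 / real (Suc n)) r" by (intro mollifier_exists) auto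
  from someI_ex[OF this] show ?thesis by (rule that) (simp add: moll_def)
qed

lemma moll_test: "moll n \<in> circle_test"
  by (rule moll[of n]) (simp add: mollifier_def)

text \<open>
  The convolution of \<open>f\<close> with the reflection of \<open>\<rho>\<close>, as a function. Concentrating \<open>\<rho>\<close> at the origin
  makes it an approximation of \<open>f\<close>.
\<close>

definition smear :: "functional \<Rightarrow> (real \<Rightarrow> complex) \<Rightarrow> real \<Rightarrow> complex" where
  "smear f \<rho> x = f (\<lambda>y. \<rho> (y - x))"

lemma avg_commute:
  assumes "\<phi> \<in> circle_test" "\<psi> \<in> circle_test"
  shows "avg \<phi> (- pi) pi \<psi> = avg \<psi> (- pi) pi \<phi>"
proof
  fix y
  have per: "\<psi> (x + 2 * pi) * \<phi> (y - (x + 2 * pi)) = \<psi> x * \<phi> (y - x)" for x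
    using circle_test_per0[OF assms(1), of "y - (x + 2 * pi)"] circle_test_per0[OF assms(2), of x] by simp
  have "integral {- pi..pi} (\<lambda>s. \<psi> (y - s) * \<phi> (y - (y - s))) = integral {- pi..pi} (\<lambda>s. \<psi> s * \<phi> (y - s))"
    by (rule integral_period_reflect)
       (auto intro!: continuous_intros per circle_test_cont0[OF assms(2)] continuous_on_compose2[OF circle_test_cont0[OF assms(1), of UNIV]])
  then show "avg \<phi> (- pi) pi \<psi> y = avg \<psi> (- pi) pi \<phi> y"
    by (simp add: avg_def mult.commute)
qed

lemma circle_dist_avg_smear:
  assumes "f \<in> circle_dist" "\<phi> \<in> circle_test" "\<rho> \<in> circle_test"
  shows "f (avg \<rho> (- pi) pi \<phi>) = integral {- pi..pi} (\<lambda>x. \<phi> x * smear f \<rho> x)"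
  unfolding avg_commute[OF assms(3,2)] smear_def
  by (rule circle_dist_avg) (use assms circle_test_cont0 in auto)

text \<open>
  The mollified test functions converge to \<open>\<phi>\<close> with all derivatives, and \<open>circle_dist_avg\<close> moves the
  mollifier from the test function to the distribution.
\<close>

lemma smear_tendsto:
  assumes f: "f \<in> circle_dist" and \<phi>: "\<phi> \<in> circle_test"
  shows "(\<lambda>n. integral {- pi..pi} (\<lambda>x. \<phi> x * smear f (moll n) x)) \<longlonglongrightarrow> f \<phi>"
  unfolding circle_dist_avg_smear[OF f \<phi> moll_test, symmetric]
proof (rule circle_dist_tendsto[OF f _ \<phi>])
  show "avg (moll n) (- pi) pi \<phi> \<in> circle_test" for n
    by (rule avg_test(1)[OF circle_test_cont0[OF moll_test] \<phi>])
  fix k :: nat and e :: real assume "e > 0"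
  then obtain d where d: "d > 0" "\<And>x y. \<bar>x - y\<bar> < d \<Longrightarrow> norm (nth_deriv k \<phi> x - nth_deriv k \<phi> y) < e"
    using circle_test_uniformly_continuous[OF \<phi>] by blast
  have "\<forall>\<^sub>F n in sequentially. inverse (real (Suc n)) < d"
    by (rule order_tendstoD(2)[OF LIMSEQ_inverse_real_of_nat d(1)])
  then show "\<forall>\<^sub>F n in sequentially. \<forall>y. norm (nth_deriv k (avg (moll n) (- pi) pi \<phi>) y - nth_deriv k \<phi> y) \<le> e"
  proof eventually_elim
    case (elim n)
    obtain r where r: "mollifier (1 / real (Suc n)) r" "moll n = (\<lambda>x. of_real (r x))" by (rule moll)
    show ?case unfolding r(2)
      by (intro allI avg_mollifier_close[OF r(1) \<phi>] less_imp_le d(2)) (use elim in \<open>simp add: inverse_eq_divide\<close>)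
  qed
qed

lemma smear_continuous:
  assumes "f \<in> circle_dist" "\<rho> \<in> circle_test"
  shows "continuous_on UNIV (smear f \<rho>)"
proof -
  have "continuous_on UNIV (\<lambda>x. f (\<lambda>y. \<rho> (x + y)))"
    by (rule circle_test_cont0[OF circle_dist_translate(1)[OF assms]])
  then have "continuous_on UNIV (\<lambda>x. f (\<lambda>y. \<rho> (- x + y)))"
    by (rule continuous_on_compose2) (auto intro!: continuous_intros)
  then show ?thesis by (simp add: smear_def[abs_def])
qed

lemma smear_per:
  assumes "\<rho> \<in> circle_test"
  shows "smear f \<rho> (x + 2 * pi) = smear f \<rho> x"
proof -
  have "\<rho> (y - (x + 2 * pi)) = \<rho> (y - x)" for y
    using circle_test_per0[OF assms, of "y - (x + 2 * pi)"] by simp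
  then show ?thesis by (simp add: smear_def)
qed

text \<open>
  Smearing turns the convolution of distributions into one of functions: apply \<open>circle_dist_avg\<close>
  to \<open>f\<close> and to \<open>g\<close>, and reparametrize the integrals over a period.
\<close>

lemma smear_conv:
  assumes f: "f \<in> circle_dist" and g: "g \<in> circle_dist" and \<rho>: "\<rho> \<in> circle_test" and \<sigma>: "\<sigma> \<in> circle_test"
  shows "smear (dist_conv f g) (avg \<rho> (- pi) pi \<sigma>) w = integral {- pi..pi} (\<lambda>s. smear f \<rho> (w - s) * smear g \<sigma> s)"
proof -
  note c = smear_continuous[OF f \<rho>] smear_continuous[OF g \<sigma>] circle_test_cont0[OF \<rho>, of UNIV] circle_test_cont0[OF \<sigma>, of UNIV]
  have p: "smear f \<rho> (a - (b + 2 * pi)) = smear f \<rho> (a - b)" "smear g \<sigma> (a - (b + 2 * pi)) = smear g \<sigma> (a - b)"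
    "\<rho> (a - (b + 2 * pi)) = \<rho> (a - b)" "\<sigma> (a - (b + 2 * pi)) = \<sigma> (a - b)" for a b
    using smear_per[OF \<rho>, of f "a - (b + 2 * pi)"] smear_per[OF \<sigma>, of g "a - (b + 2 * pi)"]
      circle_test_per0[OF \<rho>, of "a - (b + 2 * pi)"] circle_test_per0[OF \<sigma>, of "a - (b + 2 * pi)"] by simp_all
  have "integral {- pi..pi} (\<lambda>s. smear f \<rho> (w - s) * smear g \<sigma> s)
      = integral {- pi..pi} (\<lambda>s. smear f \<rho> (w - (w - s)) * smear g \<sigma> (w - s))"
    by (rule integral_period_reflect[symmetric])
       (auto simp: p smear_per[OF \<sigma>] intro!: continuous_intros c(2) continuous_on_compose2[OF c(1)])
  also have "\<dots> = integral {- pi..pi} (\<lambda>s. smear g \<sigma> (w - s) * f (\<lambda>x. \<rho> (x - s)))"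
    by (simp add: smear_def mult.commute)
  also have "\<dots> = f (avg (\<lambda>s. smear g \<sigma> (w - s)) (- pi) pi \<rho>)"
    by (rule circle_dist_avg[OF f _ \<rho>, symmetric]) (auto intro!: continuous_intros continuous_on_compose2[OF c(2)])
  also have "avg (\<lambda>s. smear g \<sigma> (w - s)) (- pi) pi \<rho> = (\<lambda>x. g (\<lambda>y. avg \<rho> (- pi) pi \<sigma> (x + y - w)))"
  proof
    fix x
    have "avg (\<lambda>s. smear g \<sigma> (w - s)) (- pi) pi \<rho> x
        = integral {- pi..pi} (\<lambda>s. smear g \<sigma> (w - (w - s)) * \<rho> (x - (w - s)))"
      unfolding avg_def
      by (rule integral_period_reflect[symmetric])
         (auto simp: p intro!: continuous_intros continuous_on_compose2[OF c(2)] continuous_on_compose2[OF c(3)])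
    also have "\<dots> = integral {- pi..pi} (\<lambda>s. \<rho> (s + (x - w)) * g (\<lambda>y. \<sigma> (y - s)))"
      by (simp add: smear_def algebra_simps)
    also have "\<dots> = g (avg (\<lambda>s. \<rho> (s + (x - w))) (- pi) pi \<sigma>)"
      by (rule circle_dist_avg[OF g _ \<sigma>, symmetric]) (auto intro!: continuous_intros continuous_on_compose2[OF c(3)])
    also have "avg (\<lambda>s. \<rho> (s + (x - w))) (- pi) pi \<sigma> = (\<lambda>y. avg \<rho> (- pi) pi \<sigma> (x + y - w))"
    proof
      fix y
      have "avg (\<lambda>s. \<rho> (s + (x - w))) (- pi) pi \<sigma> y
         = integral {- pi..pi} (\<lambda>s. \<rho> (s + (x - w)) * \<sigma> ((x + y - w) - (s + (x - w))))"
        by (simp add: avg_def algebra_simps)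
      also have "\<dots> = integral {- pi..pi} (\<lambda>s. \<rho> s * \<sigma> ((x + y - w) - s))"
        by (rule integral_period_translate)
           (auto simp: p circle_test_per0[OF \<rho>] intro!: continuous_intros c(3) continuous_on_compose2[OF c(4)])
      finally show "avg (\<lambda>s. \<rho> (s + (x - w))) (- pi) pi \<sigma> y = avg \<rho> (- pi) pi \<sigma> (x + y - w)"
        by (simp add: avg_def)
    qed
    finally show "avg (\<lambda>s. smear g \<sigma> (w - s)) (- pi) pi \<rho> x = g (\<lambda>y. avg \<rho> (- pi) pi \<sigma> (x + y - w))" .
  qed
  also have "f \<dots> = smear (dist_conv f g) (avg \<rho> (- pi) pi \<sigma>) w"
    by (simp add: smear_def dist_conv_def circle_test_shift'(3)[OF avg_test(1)[OF c(3) \<sigma>]])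
  finally show ?thesis ..
qed

section \<open>Supports\<close>

lemma mem_periodize_ball: "y \<in> periodize (ball x d) \<longleftrightarrow> near d (y - x)"
proof
  assume "y \<in> periodize (ball x d)"
  then obtain z k where "y = z + 2 * pi * of_int k" "\<bar>x - z\<bar> < d"
    by (auto simp: periodize_def dist_real_def)
  then show "near d (y - x)" unfolding near_def by (intro exI[of _ k]) (simp add: abs_minus_commute)
next
  assume "near d (y - x)"
  then obtain k :: int where "\<bar>y - x - 2 * pi * of_int k\<bar> < d" by (auto simp: near_def)
  then show "y \<in> periodize (ball x d)"
    unfolding periodize_def by (auto intro!: exI[of _ "y - 2 * pi * of_int k"] exI[of _ k] simp: dist_real_def)
qed

lemma periodize_mono: "U \<subseteq> V \<Longrightarrow> periodize U \<subseteq> periodize V"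
  by (auto simp: periodize_def)

lemma dist_eq_on_mono: "dist_eq_on V f g \<Longrightarrow> U \<subseteq> V \<Longrightarrow> dist_eq_on U f g"
  unfolding dist_eq_on_def using periodize_mono by blast

lemma dist_eq_on_zeroD:
  "dist_eq_on U f (\<lambda>_. 0) \<Longrightarrow> \<phi> \<in> circle_test \<Longrightarrow> closure {x. \<phi> x \<noteq> 0} \<subseteq> periodize U \<Longrightarrow> f \<phi> = 0"
  by (simp add: dist_eq_on_def)

lemma closed_dist_supp: "closed (dist_supp f)"
  unfolding dist_supp_def by (intro closed_Compl open_Union) auto

lemma notin_dist_supp_iff: "x \<notin> dist_supp f \<longleftrightarrow> (\<exists>d>0. dist_eq_on (ball x d) f (\<lambda>_. 0))"
proof
  assume "x \<notin> dist_supp f"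
  then obtain U where "open U" "dist_eq_on U f (\<lambda>_. 0)" "x \<in> U" by (auto simp: dist_supp_def)
  then show "\<exists>d>0. dist_eq_on (ball x d) f (\<lambda>_. 0)"
    by (meson dist_eq_on_mono openE)
next
  assume "\<exists>d>0. dist_eq_on (ball x d) f (\<lambda>_. 0)"
  then show "x \<notin> dist_supp f"
    unfolding dist_supp_def by (auto intro: centre_in_ball[THEN iffD2])
qed

lemma notin_dist_suppI: "open U \<Longrightarrow> dist_eq_on U f (\<lambda>_. 0) \<Longrightarrow> x \<in> U \<Longrightarrow> x \<notin> dist_supp f"
  unfolding dist_supp_def by blast

lemma near_shift: "near d (x + 2 * pi * of_int k) \<longleftrightarrow> near d x"
proof
  assume "near d (x + 2 * pi * of_int k)"
  then obtain j :: int where "\<bar>x + 2 * pi * of_int k - 2 * pi * of_int j\<bar> < d" by (auto simp: near_def)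
  then show "near d x" unfolding near_def by (intro exI[of _ "j - k"]) (simp add: algebra_simps)
next
  assume "near d x"
  then obtain j :: int where "\<bar>x - 2 * pi * of_int j\<bar> < d" by (auto simp: near_def)
  then show "near d (x + 2 * pi * of_int k)" unfolding near_def
    by (intro exI[of _ "j + k"]) (simp add: algebra_simps)
qed

lemma dist_supp_shift: "x + 2 * pi * of_int k \<in> dist_supp f \<longleftrightarrow> x \<in> dist_supp f"
proof -
  have "periodize (ball (x + 2 * pi * of_int k) d) = periodize (ball x d)" for d
  proof (intro set_eqI)
    fix y show "y \<in> periodize (ball (x + 2 * pi * of_int k) d) \<longleftrightarrow> y \<in> periodize (ball x d)"
      unfolding mem_periodize_ball using near_shift[of d "y - x" "- k"] by (simp add: algebra_simps)
  qed
  then have "x + 2 * pi * of_int k \<notin> dist_supp f \<longleftrightarrow> x \<notin> dist_supp f"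
    unfolding notin_dist_supp_iff by (simp add: dist_eq_on_def)
  then show ?thesis by blast
qed

lemma closure_nonzero_shift:
  fixes \<phi> :: "real \<Rightarrow> complex"
  shows "closure {y. \<phi> (y - c) \<noteq> 0} = {y. y - c \<in> closure {y. \<phi> y \<noteq> 0}}"
proof -
  have "{y. \<phi> (y - c) \<noteq> 0} = (+) c ` {y. \<phi> y \<noteq> 0}"
    by (auto intro!: image_eqI[where x="x - c" for x])
  then have "closure {y. \<phi> (y - c) \<noteq> 0} = (+) c ` closure {y. \<phi> y \<noteq> 0}"
    by (simp add: closure_translation)
  also have "\<dots> = {y. y - c \<in> closure {y. \<phi> y \<noteq> 0}}"
    by (auto intro!: image_eqI[where x="x - c" for x])
  finally show ?thesis .
qed

lemma closure_nonzero_per: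
  assumes "\<phi> \<in> circle_test" "y \<in> closure {y. \<phi> y \<noteq> 0}"
  shows "y + 2 * pi * of_int k \<in> closure {y. \<phi> y \<noteq> 0}"
proof -
  have "\<phi> (y - 2 * pi * of_int k) = \<phi> y" for y
    using periodic_int_shift[of \<phi> y "- k", OF circle_test_per0[OF assms(1)]] by simp
  then have eq: "closure {y. \<phi> y \<noteq> 0} = {y. y - 2 * pi * of_int k \<in> closure {y. \<phi> y \<noteq> 0}}"
    using closure_nonzero_shift[of \<phi> "2 * pi * of_int k"] by simp
  show ?thesis using assms(2) by (subst eq) simp
qed

lemma near_closure:
  assumes "y \<in> closure {y. \<rho> (y - x) \<noteq> (0::complex)}" "\<And>z. \<rho> z \<noteq> 0 \<Longrightarrow> near e z" "e < d"
  shows "near d (y - x)"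
proof -
  obtain z where z: "\<rho> (z - x) \<noteq> 0" "dist z y < d - e"
    using assms(1)[unfolded closure_approachable, rule_format, of "d - e"] assms(3) by auto
  then obtain k :: int where "\<bar>z - x - 2 * pi * of_int k\<bar> < e"
    using assms(2) by (auto simp: near_def)
  then have "\<bar>y - x - 2 * pi * of_int k\<bar> < d" using z(2) by (auto simp: dist_real_def)
  then show ?thesis by (auto simp: near_def)
qed

lemma moll_near: "moll n x \<noteq> 0 \<Longrightarrow> near (1 / real (Suc n)) x"
  by (rule moll[of n]) (auto simp: mollifier_def)

lemma eventually_moll_small: "e > 0 \<Longrightarrow> \<exists>N. \<forall>n\<ge>N. 1 / real (Suc n) < e"
  using order_tendstoD(2)[OF LIMSEQ_inverse_real_of_nat, of e]
  by (auto simp: eventually_sequentially inverse_eq_divide)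

text \<open>
  The mollified distributions determine \<open>f\<close>, and do so locally. This does the work of partitions of
  unity.
\<close>

lemma dist_zero_of_smear_zero:
  assumes f: "f \<in> circle_dist" and \<phi>: "\<phi> \<in> circle_test"
    and z: "\<And>n x. n \<ge> N \<Longrightarrow> \<phi> x \<noteq> 0 \<Longrightarrow> x \<in> {- pi..pi} \<Longrightarrow> smear f (moll n) x = 0"
  shows "f \<phi> = 0"
proof -
  have "integral {- pi..pi} (\<lambda>x. \<phi> x * smear f (moll n) x) = 0" if "n \<ge> N" for n
  proof -
    have "integral {- pi..pi} (\<lambda>x. \<phi> x * smear f (moll n) x) = integral {- pi..pi} (\<lambda>x. 0)"
      by (rule Henstock_Kurzweil_Integration.integral_cong) (use z[OF that] in force)
    then show ?thesis by simp
  qed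
  then have "\<forall>\<^sub>F n in sequentially. integral {- pi..pi} (\<lambda>x. \<phi> x * smear f (moll n) x) = 0"
    unfolding eventually_sequentially by blast
  then have "(\<lambda>n. integral {- pi..pi} (\<lambda>x. \<phi> x * smear f (moll n) x)) \<longlonglongrightarrow> 0"
    by (rule tendsto_eventually)
  then show ?thesis using smear_tendsto[OF f \<phi>] LIMSEQ_unique by blast
qed

text \<open>
  The support is defined through local vanishing. By compactness there is one radius \<open>d\<close> such that
  \<open>f\<close> vanishes on the \<open>d\<close>-ball around each point of the support of \<open>\<phi>\<close>; there, mollifiers supported
  within less than \<open>d\<close> give zero.
\<close>

lemma dist_vanishes_off_supp:
  assumes f: "f \<in> circle_dist" and \<phi>: "\<phi> \<in> circle_test"
    and disj: "closure {x. \<phi> x \<noteq> 0} \<inter> dist_supp f = {}"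
  shows "f \<phi> = 0"
proof -
  let ?K = "closure {x. \<phi> x \<noteq> 0} \<inter> {- pi..pi}"
  define \<G> where "\<G> = {U. open U \<and> dist_eq_on U f (\<lambda>_. 0)}"
  have "compact ?K" by (simp add: closed_Int_compact)
  moreover have "?K \<subseteq> \<Union>\<G>" using disj by (auto simp: dist_supp_def \<G>_def)
  ultimately obtain d where d: "d > 0" "\<And>x. x \<in> ?K \<Longrightarrow> \<exists>U\<in>\<G>. ball x d \<subseteq> U"
    by (rule Heine_Borel_lemma) (auto simp: \<G>_def)
  obtain N where N: "\<And>n. n \<ge> N \<Longrightarrow> 1 / real (Suc n) < d" using eventually_moll_small[OF d(1)] by blast
  show ?thesis
  proof (rule dist_zero_of_smear_zero[OF f \<phi>])
    fix n x assume n: "N \<le> n" and "\<phi> x \<noteq> 0" "x \<in> {- pi..pi}"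
    then have "x \<in> ?K" using closure_subset[of "{x. \<phi> x \<noteq> 0}"] by auto
    then obtain U where "ball x d \<subseteq> U" "dist_eq_on U f (\<lambda>_. 0)" using d(2) unfolding \<G>_def by blast
    then have "dist_eq_on (ball x d) f (\<lambda>_. 0)" by (rule dist_eq_on_mono[rotated])
    moreover have "closure {y. moll n (y - x) \<noteq> 0} \<subseteq> periodize (ball x d)"
      unfolding mem_periodize_ball subset_iff
      using near_closure[of _ "moll n" x _ d] moll_near N[OF n] by fastforce
    ultimately show "smear f (moll n) x = 0"
      unfolding smear_def by (intro dist_eq_on_zeroD[of "ball x d"] circle_test_shift'(3)[OF moll_test])
  qed
qed

text \<open>
  This and its converse \<open>smear_nonzero_at_supp\<close> let the support of a distribution be read off from
  the continuous functions obtained by mollification.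
\<close>

lemma smear_nonzero_near_supp:
  assumes f: "f \<in> circle_dist" and \<rho>: "\<rho> \<in> circle_test" and e: "\<And>z. \<rho> z \<noteq> 0 \<Longrightarrow> near e z" "e < d"
    and nz: "smear f \<rho> x \<noteq> 0"
  shows "\<exists>p\<in>dist_supp f. \<bar>p - x\<bar> < d"
proof -
  have "closure {y. \<rho> (y - x) \<noteq> 0} \<inter> dist_supp f \<noteq> {}"
    using dist_vanishes_off_supp[OF f circle_test_shift'(3)[OF \<rho>]] nz unfolding smear_def by blast
  then obtain y where y: "y \<in> closure {y. \<rho> (y - x) \<noteq> 0}" "y \<in> dist_supp f" by blast
  obtain k :: int where k: "\<bar>y - x - 2 * pi * of_int k\<bar> < d"
    using near_closure[OF y(1) e] by (auto simp: near_def)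
  show ?thesis
  proof (rule bexI)
    show "y - 2 * pi * of_int k \<in> dist_supp f" using y(2) dist_supp_shift[of y "- k"] by simp
    show "\<bar>y - 2 * pi * of_int k - x\<bar> < d" using k by (simp add: algebra_simps)
  qed
qed

lemma smear_nonzero_at_supp:
  assumes f: "f \<in> circle_dist" and p: "p \<in> dist_supp f" and d: "d > 0"
  shows "\<exists>n\<ge>N. \<exists>x. \<bar>x - p\<bar> < d \<and> smear f (moll n) x \<noteq> 0"
proof (rule ccontr)
  assume "\<not> ?thesis"
  then have z: "smear f (moll n) x = 0" if "n \<ge> N" "\<bar>x - p\<bar> < d" for n x using that by blast
  have "dist_eq_on (ball p d) f (\<lambda>_. 0)"
    unfolding dist_eq_on_def
  proof (intro ballI impI)
    fix \<phi> assume \<phi>: "\<phi> \<in> circle_test" and sub: "closure {x. \<phi> x \<noteq> 0} \<subseteq> periodize (ball p d)"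
    show "f \<phi> = 0"
    proof (rule dist_zero_of_smear_zero[OF f \<phi>])
      fix n x assume n: "N \<le> n" and "\<phi> x \<noteq> 0"
      then have "near d (x - p)"
        using sub closure_subset[of "{x. \<phi> x \<noteq> 0}"] mem_periodize_ball by blast
      then obtain k :: int where k: "\<bar>x - p - 2 * pi * of_int k\<bar> < d" by (auto simp: near_def)
      have "smear f (moll n) (x - 2 * pi * of_int k) = 0"
        by (rule z[OF n]) (use k in \<open>simp add: algebra_simps\<close>)
      then show "smear f (moll n) x = 0"
        using periodic_int_shift[of "smear f (moll n)" x "- k", OF smear_per[OF moll_test]] by simp
    qed
  qed
  then show False using p d notin_dist_supp_iff by blast
qed

text \<open>
  By periodicity one of the summands may be taken from a single compact period.
\<close>

lemma closed_per_sums: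
  assumes "closed A" "closed B" "\<And>x k. x \<in> A \<Longrightarrow> x + 2 * pi * of_int k \<in> A" "\<And>x k. x \<in> B \<Longrightarrow> x + 2 * pi * of_int k \<in> B"
  shows "closed {a + b | a b. a \<in> A \<and> b \<in> B}"
proof -
  have "{a + b | a b. a \<in> A \<and> b \<in> B} = (\<Union>x\<in>A. \<Union>y\<in>B \<inter> {0..2*pi}. {x + y})"
  proof (intro equalityI subsetI)
    fix z assume "z \<in> {a + b | a b. a \<in> A \<and> b \<in> B}"
    then obtain a b where ab: "a \<in> A" "b \<in> B" "z = a + b" by blast
    obtain k where k: "0 \<le> b - 2 * pi * of_int k" "b - 2 * pi * of_int k < 0 + 2 * pi" by (rule reduce_mod_2pi)
    have "a + 2 * pi * of_int k \<in> A" "b - 2 * pi * of_int k \<in> B \<inter> {0..2*pi}"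
      using assms(3)[OF ab(1), of k] assms(4)[OF ab(2), of "- k"] k by auto
    then show "z \<in> (\<Union>x\<in>A. \<Union>y\<in>B \<inter> {0..2*pi}. {x + y})"
      unfolding ab(3) by (intro UN_I[of "a + 2 * pi * of_int k"] UN_I[of "b - 2 * pi * of_int k"]) auto
  qed auto
  then show ?thesis
    using closed_compact_sums[OF assms(1), of "B \<inter> {0..2*pi}"] assms(2) by (simp add: closed_Int_compact)
qed

text \<open>
  Let \<open>\<phi>\<close> be supported near a point off the closed set \<open>supp f + supp g\<close>, and let \<open>K\<close> be its support. Then
  \<open>a \<mapsto> g (\<phi> (a + \<cdot>))\<close> is supported in \<open>K - supp g\<close>, which does not meet \<open>supp f\<close>.
\<close>

lemma dist_supp_conv:
  assumes f: "f \<in> circle_dist" and g: "g \<in> circle_dist"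
  shows "dist_supp (dist_conv f g) \<subseteq> {p + q | p q. p \<in> dist_supp f \<and> q \<in> dist_supp g}" (is "_ \<subseteq> ?S")
proof
  fix x assume x: "x \<in> dist_supp (dist_conv f g)"
  show "x \<in> ?S"
  proof (rule ccontr)
    assume "x \<notin> ?S"
    have "closed ?S"
      by (rule closed_per_sums) (use closed_dist_supp dist_supp_shift in auto)
    then have "open (- ?S)" "x \<in> - ?S" using \<open>x \<notin> ?S\<close> by (simp_all only: open_Compl Compl_iff not_False_eq_True)
    then obtain d where "d > 0" "ball x d \<subseteq> - ?S" by (rule openE)
    then have d: "d > 0" "ball x d \<inter> ?S = {}" by (simp_all only: disjoint_eq_subset_Compl)
    have "dist_eq_on (ball x d) (dist_conv f g) (\<lambda>_. 0)"
      unfolding dist_eq_on_def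
    proof (intro ballI impI)
      fix \<phi> assume \<phi>: "\<phi> \<in> circle_test" and sub: "closure {x. \<phi> x \<noteq> 0} \<subseteq> periodize (ball x d)"
      define K where "K = closure {x. \<phi> x \<noteq> 0}"
      define R where "R = {a + b | a b. a \<in> K \<and> b \<in> uminus ` dist_supp g}"
      have Kper: "y + 2 * pi * of_int k \<in> K" if "y \<in> K" for y k
        using that closure_nonzero_per[OF \<phi>] by (simp add: K_def)
      have "closed R"
        unfolding R_def
      proof (rule closed_per_sums)
        show "closed K" by (simp add: K_def)
        show "closed (uminus ` dist_supp g)" by (rule closed_negations[OF closed_dist_supp])
        fix y k assume "y \<in> uminus ` dist_supp g"
        then have "- y + 2 * pi * of_int (- k) \<in> dist_supp g" unfolding dist_supp_shift by auto
        then show "y + 2 * pi * of_int k \<in> uminus ` dist_supp g"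
          by (intro image_eqI[of _ _ "- y + 2 * pi * of_int (- k)"]) auto
      qed (use Kper in auto)
      moreover have "{a. g (\<lambda>y. \<phi> (a + y)) \<noteq> 0} \<subseteq> R"
      proof
        fix a assume "a \<in> {a. g (\<lambda>y. \<phi> (a + y)) \<noteq> 0}"
        then have "g (\<lambda>y. \<phi> (y - (- a))) \<noteq> 0" by (simp add: add.commute)
        then have "closure {y. \<phi> (y - (- a)) \<noteq> 0} \<inter> dist_supp g \<noteq> {}"
          using dist_vanishes_off_supp[OF g circle_test_shift'(3)[OF \<phi>, of "- a"]] by blast
        then obtain q where q: "q \<in> dist_supp g" "q + a \<in> K"
          unfolding closure_nonzero_shift K_def by auto
        then have "- q \<in> uminus ` dist_supp g" "a = (q + a) + (- q)" by auto
        then show "a \<in> R" unfolding R_def using q(2) by blast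
      qed
      ultimately have cl: "closure {a. g (\<lambda>y. \<phi> (a + y)) \<noteq> 0} \<subseteq> R" by (rule closure_minimal[rotated])
      have "R \<inter> dist_supp f = {}"
      proof (rule ccontr)
        assume "R \<inter> dist_supp f \<noteq> {}"
        then obtain a q where aq: "a \<in> K" "q \<in> dist_supp g" "a - q \<in> dist_supp f" unfolding R_def by auto
        from aq(1) sub have "near d (a - x)" by (auto simp: K_def mem_periodize_ball)
        then obtain k :: int where k: "\<bar>a - x - 2 * pi * of_int k\<bar> < d" by (auto simp: near_def)
        have "a - q - 2 * pi * of_int k \<in> dist_supp f" using aq(3) dist_supp_shift[of "a - q" "- k"] by simp
        moreover have "a - 2 * pi * of_int k = (a - q - 2 * pi * of_int k) + q" by simp
        ultimately have "a - 2 * pi * of_int k \<in> ?S" using aq(2) by blast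
        moreover have "a - 2 * pi * of_int k \<in> ball x d" using k by (simp add: dist_real_def abs_minus_commute algebra_simps)
        ultimately show False using d(2) by blast
      qed
      then have "f (\<lambda>a. g (\<lambda>y. \<phi> (a + y))) = 0"
        using cl by (intro dist_vanishes_off_supp[OF f circle_dist_translate(1)[OF g \<phi>]]) blast
      then show "dist_conv f g \<phi> = 0" by (simp add: dist_conv_def)
    qed
    then show False using x d(1) notin_dist_supp_iff by blast
  qed
qed

section \<open>Supports modulo a half turn\<close>

lemma punctured_distD:
  assumes "f \<in> punctured_dist"
  shows "f \<in> circle_dist" "x \<in> dist_supp f \<Longrightarrow> x \<noteq> pi / 2 + of_int k * pi"
proof -
  show "f \<in> circle_dist" using assms by (simp add: punctured_dist_def)
  assume x: "x \<in> dist_supp f"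
  show "x \<noteq> pi / 2 + of_int k * pi"
  proof
    assume eq: "x = pi / 2 + of_int k * pi"
    have "x \<in> periodize {- pi / 2, pi / 2}"
    proof (cases "even k")
      case True
      then obtain j where "k = 2 * j" by blast
      then show ?thesis unfolding periodize_def eq by (auto intro!: exI[of _ "pi / 2"] exI[of _ j])
    next
      case False
      then obtain j where "k = 2 * j + 1" by (meson oddE)
      then show ?thesis unfolding periodize_def eq
        by (intro CollectI exI[of _ "- pi / 2"] exI[of _ "j + 1"]) (auto simp: algebra_simps)
    qed
    then show False using assms x by (auto simp: punctured_dist_def punctured_circle_def)
  qed
qed

lemma punctured_distI:
  assumes "f \<in> circle_dist" "\<And>x k. x \<in> dist_supp f \<Longrightarrow> x \<noteq> pi / 2 + of_int k * pi"
  shows "f \<in> punctured_dist"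
proof -
  have "x \<notin> periodize {- pi / 2, pi / 2}" if "x \<in> dist_supp f" for x
  proof
    assume "x \<in> periodize {- pi / 2, pi / 2}"
    then obtain k :: int where "x = - pi / 2 + 2 * pi * of_int k \<or> x = pi / 2 + 2 * pi * of_int k"
      unfolding periodize_def by blast
    then have "x = pi / 2 + of_int (2 * k - 1) * pi \<or> x = pi / 2 + of_int (2 * k) * pi"
      by (auto simp: algebra_simps)
    then show False using assms(2)[OF that] by blast
  qed
  then show ?thesis using assms(1) by (auto simp: punctured_dist_def punctured_circle_def)
qed

lemma dist_supp_mod_pi:
  assumes f: "f \<in> punctured_dist" and p: "p \<in> dist_supp f"
  obtains p0 k where "p0 \<in> supp_mod_pi f" "p = p0 + of_int k * pi"
proof -
  obtain k where k: "- pi / 2 \<le> p - 2 * pi * of_int k" "p - 2 * pi * of_int k < - pi / 2 + 2 * pi" by (rule reduce_mod_2pi)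
  define q where "q = p - 2 * pi * of_int k"
  have q: "q \<in> dist_supp f" using p dist_supp_shift[of p "- k"] by (simp add: q_def)
  have ne: "q \<noteq> pi / 2" "q \<noteq> - pi / 2"
    using punctured_distD(2)[OF f q, of 0] punctured_distD(2)[OF f q, of "- 1"] by auto
  show ?thesis
  proof (cases "q < pi / 2")
    case True
    show ?thesis
    proof (rule that)
      show "q \<in> supp_mod_pi f" using True q k ne unfolding supp_mod_pi_def by (auto simp: q_def)
      show "p = q + of_int (2 * k) * pi" by (simp add: q_def)
    qed
  next
    case False
    show ?thesis
    proof (rule that)
      show "q - pi \<in> supp_mod_pi f" using False q k ne unfolding supp_mod_pi_def by (auto simp: q_def)
      show "p = q - pi + of_int (2 * k + 1) * pi" by (simp add: q_def algebra_simps)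
    qed
  qed
qed

lemma supp_mod_pi_bounds: "p \<in> supp_mod_pi f \<Longrightarrow> - pi / 2 < p \<and> p < pi / 2"
  by (auto simp: supp_mod_pi_def)

lemma eq_of_shift_mod_pi:
  fixes x y :: real
  assumes "\<bar>x - y\<bar> < pi" "x = y + of_int k * pi"
  shows "x = y"
proof -
  have "\<bar>of_int k * pi\<bar> < 1 * pi" using assms by simp
  then have "\<bar>of_int k\<bar> < (1::real)" unfolding abs_mult by (simp add: mult_less_cancel_right)
  then have "k = 0" by linarith
  then show ?thesis using assms by simp
qed

text \<open>
  As the support of \<open>f\<close> avoids \<open>\<plusminus>\<pi>/2\<close>, the open interval in the definition may be replaced by the closed
  one.
\<close>

lemma compact_supp_mod_pi:
  assumes f: "f \<in> punctured_dist"
  shows "compact (supp_mod_pi f)"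
proof -
  have "supp_mod_pi f = {- pi / 2..pi / 2} \<inter> (dist_supp f \<union> (\<lambda>x. x - pi) ` dist_supp f)"
  proof (intro equalityI subsetI)
    fix p assume "p \<in> supp_mod_pi f"
    then show "p \<in> {- pi / 2..pi / 2} \<inter> (dist_supp f \<union> (\<lambda>x. x - pi) ` dist_supp f)"
      by (auto simp: supp_mod_pi_def intro!: image_eqI[of _ _ "p + pi"])
  next
    fix p assume p: "p \<in> {- pi / 2..pi / 2} \<inter> (dist_supp f \<union> (\<lambda>x. x - pi) ` dist_supp f)"
    then have *: "p \<in> dist_supp f \<or> p + pi \<in> dist_supp f" by auto
    have "p \<noteq> pi / 2 + of_int k * pi" for k
    proof
      assume eq: "p = pi / 2 + of_int k * pi"
      then have "p + pi = pi / 2 + of_int (k + 1) * pi" by (simp add: algebra_simps)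
      then show False using * punctured_distD(2)[OF f] eq by blast
    qed
    from this[of 0] this[of "- 1"] show "p \<in> supp_mod_pi f"
      using p * by (auto simp: supp_mod_pi_def less_le)
  qed
  moreover have "closed (dist_supp f \<union> (\<lambda>x. x - pi) ` dist_supp f)"
    by (intro closed_Un closed_dist_supp closed_translation_subtract)
  ultimately show ?thesis by (simp add: compact_Int_closed)
qed

lemma supp_mod_pi_nonempty:
  assumes f: "f \<in> punctured_dist" "f \<noteq> (\<lambda>_. 0)"
  shows "supp_mod_pi f \<noteq> {}"
proof
  assume e: "supp_mod_pi f = {}"
  then have "dist_supp f = {}" using dist_supp_mod_pi[OF f(1)] by blast
  then have "f \<phi> = 0" for \<phi>
    using dist_vanishes_off_supp[of f \<phi>] circle_dist_outside[of f \<phi>] punctured_distD(1)[OF f(1)] by blast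
  then show False using f(2) by blast
qed

text \<open>
  A point of \<open>supp (f * g)\<close> is \<open>p + q\<close> up to a multiple of \<open>\<pi>\<close>, with \<open>p\<close> and \<open>q\<close> in the supports modulo
  \<open>\<pi>\<close>. The assumption puts \<open>p + q\<close> in the open interval of length \<open>\<pi>\<close>, so the multiple is determined.
\<close>

lemma supp_mod_pi_conv:
  assumes f: "f \<in> punctured_dist" and g: "g \<in> punctured_dist"
    and sum: "{p + q | p q. p \<in> supp_mod_pi f \<and> q \<in> supp_mod_pi g} \<subseteq> {- pi / 2 <..< pi / 2}"
  shows "dist_conv f g \<in> punctured_dist"
    and "supp_mod_pi (dist_conv f g) \<subseteq> {p + q | p q. p \<in> supp_mod_pi f \<and> q \<in> supp_mod_pi g}"
proof -
  note f' = punctured_distD(1)[OF f] and g' = punctured_distD(1)[OF g]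
  have rep: "\<exists>p\<in>supp_mod_pi f. \<exists>q\<in>supp_mod_pi g. \<exists>k. x = p + q + of_int k * pi" if "x \<in> dist_supp (dist_conv f g)" for x
  proof -
    have "x \<in> {a + b | a b. a \<in> dist_supp f \<and> b \<in> dist_supp g}" by (rule subsetD[OF dist_supp_conv[OF f' g'] that])
    then obtain a b where "a \<in> dist_supp f" "b \<in> dist_supp g" "x = a + b" by blast
    moreover obtain p k where "p \<in> supp_mod_pi f" "a = p + of_int k * pi" using dist_supp_mod_pi[OF f \<open>a \<in> dist_supp f\<close>] .
    moreover obtain q j where "q \<in> supp_mod_pi g" "b = q + of_int j * pi" using dist_supp_mod_pi[OF g \<open>b \<in> dist_supp g\<close>] .
    ultimately have "p \<in> supp_mod_pi f" "q \<in> supp_mod_pi g" "x = p + q + of_int (k + j) * pi" by (auto simp: algebra_simps)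
    then show ?thesis by blast
  qed
  show "dist_conv f g \<in> punctured_dist"
  proof (rule punctured_distI[OF dist_conv_circle_dist[OF f' g']])
    fix x k assume "x \<in> dist_supp (dist_conv f g)"
    then obtain p q j where pq: "p \<in> supp_mod_pi f" "q \<in> supp_mod_pi g" "x = p + q + of_int j * pi" using rep by blast
    then have b: "p + q \<in> {- pi / 2 <..< pi / 2}" using sum by blast
    show "x \<noteq> pi / 2 + of_int k * pi"
    proof
      assume "x = pi / 2 + of_int k * pi"
      then have "p + q = pi / 2 + of_int (k - j) * pi" using pq(3) by (simp add: algebra_simps)
      then have "p + q = pi / 2" by (rule eq_of_shift_mod_pi[rotated]) (use b in auto)
      then show False using b by simp
    qed
  qed
  show "supp_mod_pi (dist_conv f g) \<subseteq> {p + q | p q. p \<in> supp_mod_pi f \<and> q \<in> supp_mod_pi g}"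
  proof
    fix r assume r: "r \<in> supp_mod_pi (dist_conv f g)"
    then have "\<exists>p\<in>supp_mod_pi f. \<exists>q\<in>supp_mod_pi g. \<exists>k. r = p + q + of_int k * pi"
    proof (cases "r \<in> dist_supp (dist_conv f g)")
      case False
      then have "r + pi \<in> dist_supp (dist_conv f g)" using r by (auto simp: supp_mod_pi_def)
      then obtain p q j where pq: "p \<in> supp_mod_pi f" "q \<in> supp_mod_pi g" "r + pi = p + q + of_int j * pi" using rep by blast
      then have "r = p + q + of_int (j - 1) * pi" by (simp add: algebra_simps)
      then show ?thesis using pq by blast
    qed (use rep in auto)
    then obtain p q k where pq: "p \<in> supp_mod_pi f" "q \<in> supp_mod_pi g" "r = p + q + of_int k * pi" by blast
    then have "p + q \<in> {- pi / 2 <..< pi / 2}" using sum by blast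
    then have "\<bar>r - (p + q)\<bar> < pi" using supp_mod_pi_bounds[OF r] by auto
    then have "r = p + q" using pq(3) by (rule eq_of_shift_mod_pi)
    then show "r \<in> {p + q | p q. p \<in> supp_mod_pi f \<and> q \<in> supp_mod_pi g}" using pq by blast
  qed
qed

section \<open>Parity under the half turn\<close>

text \<open>
  Twice the component of \<open>f\<close> that is even (\<open>s = 1\<close>) or odd (\<open>s = - 1\<close>) under the half turn.
\<close>

definition parity :: "complex \<Rightarrow> functional \<Rightarrow> functional" where
  "parity s f = (\<lambda>\<phi>. f \<phi> + s * shift_pi f \<phi>)"

lemma circle_test_shift_iff: "(\<lambda>x. \<phi> (x - c)) \<in> circle_test \<longleftrightarrow> \<phi> \<in> circle_test"
  using circle_test_shift(1)[of "\<lambda>x. \<phi> (x - c)" c] circle_test_shift'(3)[of \<phi> c] by auto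

lemma parity_circle_dist:
  assumes f: "f \<in> circle_dist"
  shows "parity s f \<in> circle_dist"
proof -
  obtain C N where "order_bound C N f" by (rule circle_dist_bound[OF f])
  note CN = order_boundD[OF this]
  show ?thesis
  proof (rule circle_distI[where C="C + norm s * C" and N=N])
    fix \<phi> assume "\<phi> \<notin> circle_test"
    then show "parity s f \<phi> = 0"
      using circle_dist_outside[OF f] circle_test_shift_iff[of \<phi> pi] by (simp add: parity_def shift_pi_def)
  next
    fix \<phi> \<psi> assume *: "\<phi> \<in> circle_test" "\<psi> \<in> circle_test"
    show "parity s f (\<lambda>x. \<phi> x + \<psi> x) = parity s f \<phi> + parity s f \<psi>"
      unfolding parity_def shift_pi_def circle_dist_add[OF f *]
        circle_dist_add[OF f circle_test_shift'(3)[OF *(1)] circle_test_shift'(3)[OF *(2)]]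
      by (simp add: algebra_simps)
  next
    fix c \<phi> assume *: "\<phi> \<in> circle_test"
    show "parity s f (\<lambda>x. c * \<phi> x) = c * parity s f \<phi>"
      unfolding parity_def shift_pi_def circle_dist_scale[OF f *] circle_dist_scale[OF f circle_test_shift'(3)[OF *]]
      by (simp add: algebra_simps)
  next
    fix \<phi> e assume *: "\<phi> \<in> circle_test" and e: "\<And>k x. k \<le> N \<Longrightarrow> norm (nth_deriv k \<phi> x) \<le> e"
    have 1: "norm (f \<phi>) \<le> C * e" by (rule CN(2)[OF * e])
    have 2: "norm (f (\<lambda>x. \<phi> (x - pi))) \<le> C * e"
      by (rule CN(2)[OF circle_test_shift'(3)[OF *]]) (simp add: circle_test_shift'(4)[OF *] e)
    have "norm (parity s f \<phi>) \<le> norm (f \<phi>) + norm (s * f (\<lambda>x. \<phi> (x - pi)))"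
      unfolding parity_def shift_pi_def by (rule norm_triangle_ineq)
    also have "\<dots> \<le> C * e + norm s * (C * e)"
      using 1 mult_left_mono[OF 2, of "norm s"] by (simp add: norm_mult)
    finally show "norm (parity s f \<phi>) \<le> (C + norm s * C) * e" by (simp add: algebra_simps)
  qed (use CN(1) in auto)
qed

lemma shift_pi_twice:
  assumes "f \<in> circle_dist"
  shows "f (\<lambda>x. \<phi> (x - pi - pi)) = f \<phi>"
proof (cases "\<phi> \<in> circle_test")
  case True
  have "\<phi> (x - pi - pi) = \<phi> x" for x
    using circle_test_per0[OF True, of "x - pi - pi"] by (simp add: algebra_simps)
  then show ?thesis by simp
next
  case False
  then have "(\<lambda>x. \<phi> (x - pi - pi)) \<notin> circle_test"
    using circle_test_shift_iff[of \<phi> "2 * pi"] by (simp add: algebra_simps)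
  then show ?thesis using False circle_dist_outside[OF assms] by simp
qed

lemma shift_pi_parity:
  assumes "f \<in> circle_dist" "s * s = 1"
  shows "shift_pi (parity s f) \<phi> = s * parity s f \<phi>"
  unfolding parity_def shift_pi_def shift_pi_twice[OF assms(1)] distrib_left mult.assoc[symmetric] assms(2)
  by simp

lemma notin_dist_supp_common:
  assumes "x \<notin> dist_supp f" "y \<notin> dist_supp g"
  obtains d where "d > 0" "dist_eq_on (ball x d) f (\<lambda>_. 0)" "dist_eq_on (ball y d) g (\<lambda>_. 0)"
proof -
  obtain d e where "d > 0" "dist_eq_on (ball x d) f (\<lambda>_. 0)" "e > 0" "dist_eq_on (ball y e) g (\<lambda>_. 0)"
    using assms unfolding notin_dist_supp_iff by blast
  then show ?thesis
    by (intro that[of "min d e"]) (auto elim!: dist_eq_on_mono)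
qed

lemma dist_supp_parity: "dist_supp (parity s f) \<subseteq> dist_supp f \<union> {x. x + pi \<in> dist_supp f}"
proof
  fix x assume x: "x \<in> dist_supp (parity s f)"
  show "x \<in> dist_supp f \<union> {x. x + pi \<in> dist_supp f}"
  proof (rule ccontr)
    assume "x \<notin> dist_supp f \<union> {x. x + pi \<in> dist_supp f}"
    then have "x \<notin> dist_supp f" "x + pi \<notin> dist_supp f" by auto
    then obtain d where d: "d > 0" "dist_eq_on (ball x d) f (\<lambda>_. 0)" "dist_eq_on (ball (x + pi) d) f (\<lambda>_. 0)"
      by (rule notin_dist_supp_common)
    have "dist_eq_on (ball x d) (parity s f) (\<lambda>_. 0)"
      unfolding dist_eq_on_def
    proof (intro ballI impI)
      fix \<phi> assume \<phi>: "\<phi> \<in> circle_test" and sub: "closure {x. \<phi> x \<noteq> 0} \<subseteq> periodize (ball x d)"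
      have "f \<phi> = 0" by (rule dist_eq_on_zeroD[OF d(2) \<phi> sub])
      moreover have "f (\<lambda>y. \<phi> (y - pi)) = 0"
      proof (rule dist_eq_on_zeroD[OF d(3) circle_test_shift'(3)[OF \<phi>]])
        show "closure {y. \<phi> (y - pi) \<noteq> 0} \<subseteq> periodize (ball (x + pi) d)"
          unfolding closure_nonzero_shift
          using sub by (auto simp: mem_periodize_ball algebra_simps)
      qed
      ultimately show "parity s f \<phi> = 0" by (simp add: parity_def shift_pi_def)
    qed
    then show False using x d(1) notin_dist_supp_iff by blast
  qed
qed

lemma dist_supp_shift_2pi: "x + 2 * pi \<in> dist_supp f \<longleftrightarrow> x \<in> dist_supp f"
  using dist_supp_shift[of x 1 f] by simp

lemma parity_punctured:
  assumes f: "f \<in> punctured_dist"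
  shows "parity s f \<in> punctured_dist"
proof (rule punctured_distI[OF parity_circle_dist[OF punctured_distD(1)[OF f]]])
  fix x k assume "x \<in> dist_supp (parity s f)"
  then have "x \<in> dist_supp f \<or> x + pi \<in> dist_supp f" using dist_supp_parity by blast
  then show "x \<noteq> pi / 2 + of_int k * pi"
    using punctured_distD(2)[OF f, of x k] punctured_distD(2)[OF f, of "x + pi" "k + 1"]
    by (auto simp: algebra_simps)
qed

lemma supp_mod_pi_parity: "supp_mod_pi (parity s f) \<subseteq> supp_mod_pi f"
proof
  fix p assume "p \<in> supp_mod_pi (parity s f)"
  then have b: "p \<in> {- pi / 2 <..< pi / 2}" and "p \<in> dist_supp (parity s f) \<or> p + pi \<in> dist_supp (parity s f)"
    by (auto simp: supp_mod_pi_def)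
  then have "p \<in> dist_supp f \<or> p + pi \<in> dist_supp f \<or> p + pi + pi \<in> dist_supp f"
    using dist_supp_parity[of s f] by blast
  moreover have "p + pi + pi \<in> dist_supp f \<longleftrightarrow> p \<in> dist_supp f"
    using dist_supp_shift_2pi[of p f] by (simp add: algebra_simps)
  ultimately show "p \<in> supp_mod_pi f" using b by (auto simp: supp_mod_pi_def)
qed

lemma dist_supp_le_paritys: "dist_supp f \<subseteq> dist_supp (parity 1 f) \<union> dist_supp (parity (- 1) f)"
proof
  fix x assume x: "x \<in> dist_supp f"
  show "x \<in> dist_supp (parity 1 f) \<union> dist_supp (parity (- 1) f)"
  proof (rule ccontr)
    assume "x \<notin> dist_supp (parity 1 f) \<union> dist_supp (parity (- 1) f)"
    then have "x \<notin> dist_supp (parity 1 f)" "x \<notin> dist_supp (parity (- 1) f)" by auto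
    then obtain d where d: "d > 0" "dist_eq_on (ball x d) (parity 1 f) (\<lambda>_. 0)" "dist_eq_on (ball x d) (parity (- 1) f) (\<lambda>_. 0)"
      by (rule notin_dist_supp_common)
    have "dist_eq_on (ball x d) f (\<lambda>_. 0)"
      using d(2,3) unfolding dist_eq_on_def parity_def by fastforce
    then show False using x d(1) notin_dist_supp_iff by blast
  qed
qed

lemma supp_mod_pi_paritys: "supp_mod_pi f = supp_mod_pi (parity 1 f) \<union> supp_mod_pi (parity (- 1) f)"
proof
  show "supp_mod_pi f \<subseteq> supp_mod_pi (parity 1 f) \<union> supp_mod_pi (parity (- 1) f)"
    using dist_supp_le_paritys[of f] unfolding supp_mod_pi_def by blast
qed (use supp_mod_pi_parity in blast)

lemma inf_supp_paritys: "inf_supp f = min (inf_supp (parity 1 f)) (inf_supp (parity (- 1) f))"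
  unfolding inf_supp_def by (subst supp_mod_pi_paritys) (simp add: image_Un Inf_union_distrib inf_min)

lemma inf_supp_le: "p \<in> supp_mod_pi f \<Longrightarrow> inf_supp f \<le> ereal p"
  unfolding inf_supp_def by (intro Inf_lower) auto

lemma inf_supp_ge: "(\<And>p. p \<in> supp_mod_pi f \<Longrightarrow> t \<le> ereal p) \<Longrightarrow> t \<le> inf_supp f"
  unfolding inf_supp_def by (intro Inf_greatest) auto

lemma dist_supp_shift_pi_iff:
  assumes F: "\<And>\<phi>. shift_pi F \<phi> = s * F \<phi>"
  shows "x + pi \<in> dist_supp F \<longleftrightarrow> x \<in> dist_supp F"
proof -
  have step: "x + pi \<notin> dist_supp F" if x: "x \<notin> dist_supp F" for x
  proof -
    obtain d where d: "d > 0" "dist_eq_on (ball x d) F (\<lambda>_. 0)" using x unfolding notin_dist_supp_iff by blast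
    have "dist_eq_on (ball (x + pi) d) F (\<lambda>_. 0)"
      unfolding dist_eq_on_def
    proof (intro ballI impI)
      fix \<phi> assume \<phi>: "\<phi> \<in> circle_test" and sub: "closure {x. \<phi> x \<noteq> 0} \<subseteq> periodize (ball (x + pi) d)"
      have "F (\<lambda>y. \<phi> (y - (- pi))) = 0"
      proof (rule dist_eq_on_zeroD[OF d(2) circle_test_shift'(3)[OF \<phi>]])
        show "closure {y. \<phi> (y - (- pi)) \<noteq> 0} \<subseteq> periodize (ball x d)"
          unfolding closure_nonzero_shift
        proof
          fix y assume "y \<in> {y. y - - pi \<in> closure {y. \<phi> y \<noteq> 0}}"
          then have "y + pi \<in> periodize (ball (x + pi) d)" using subsetD[OF sub] by simp
          then show "y \<in> periodize (ball x d)" by (simp add: mem_periodize_ball)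
        qed
      qed
      then show "F \<phi> = 0" using F[of "\<lambda>y. \<phi> (y - (- pi))"] by (simp add: shift_pi_def)
    qed
    then show ?thesis using d(1) notin_dist_supp_iff by blast
  qed
  show ?thesis using step[of x] step[of "x + pi"] dist_supp_shift_2pi[of x F] by (auto simp: add.assoc)
qed

text \<open>
  When \<open>S\<^sub>\<pi> F = s F\<close>, the points \<open>p\<close> and \<open>p + \<pi>\<close> belong to the support together, so the support modulo
  \<open>\<pi>\<close> is seen on the interval \<open>(-\<pi>/2, \<pi>/2)\<close> alone. If \<open>t > \<pi>/2\<close>, then
  both sides say that \<open>F = 0\<close>.
\<close>

lemma vanish_left_iff:
  assumes F: "F \<in> punctured_dist" and S: "\<And>\<phi>. shift_pi F \<phi> = s * F \<phi>"
  shows "dist_eq_on {x. - pi / 2 < x \<and> ereal x < t} F (\<lambda>_. 0) \<longleftrightarrow> t \<le> inf_supp F"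
proof
  assume v: "dist_eq_on {x. - pi / 2 < x \<and> ereal x < t} F (\<lambda>_. 0)"
  show "t \<le> inf_supp F"
  proof (rule inf_supp_ge, rule ccontr)
    fix p assume p: "p \<in> supp_mod_pi F" and "\<not> t \<le> ereal p"
    then have "p \<in> {x. - pi / 2 < x \<and> ereal x < t}" using supp_mod_pi_bounds[OF p] by auto
    moreover have "open {x. - pi / 2 < x \<and> ereal x < t}"
      by (intro open_Collect_conj open_Collect_less continuous_intros continuous_on_ereal)
    ultimately have "p \<notin> dist_supp F" using v notin_dist_suppI by blast
    then show False using p dist_supp_shift_pi_iff[OF S] by (auto simp: supp_mod_pi_def)
  qed
next
  assume t: "t \<le> inf_supp F"
  show "dist_eq_on {x. - pi / 2 < x \<and> ereal x < t} F (\<lambda>_. 0)"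
    unfolding dist_eq_on_def
  proof (intro ballI impI)
    fix \<phi> assume \<phi>: "\<phi> \<in> circle_test"
      and sub: "closure {x. \<phi> x \<noteq> 0} \<subseteq> periodize {x. - pi / 2 < x \<and> ereal x < t}"
    have "y \<notin> dist_supp F" if cl: "y \<in> closure {x. \<phi> x \<noteq> 0}" for y
    proof
      assume y: "y \<in> dist_supp F"
      obtain x k where x: "- pi / 2 < x" "ereal x < t" "y = x + 2 * pi * of_int k"
        using subsetD[OF sub cl] unfolding periodize_def by blast
      then have "x \<in> dist_supp F" using y dist_supp_shift by blast
      then obtain p j where p: "p \<in> supp_mod_pi F" "x = p + of_int j * pi" using dist_supp_mod_pi[OF F] by blast
      have "ereal x < ereal p" using x(2) t inf_supp_le[OF p(1)] by (meson less_le_trans)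
      then have "x < p" by simp
      have "x = p" by (rule eq_of_shift_mod_pi[OF _ p(2)]) (use \<open>x < p\<close> x(1) supp_mod_pi_bounds[OF p(1)] in auto)
      then show False using \<open>x < p\<close> by simp
    qed
    then show "F \<phi> = 0" using dist_vanishes_off_supp[OF punctured_distD(1)[OF F] \<phi>] by blast
  qed
qed

text \<open>
  The equation \<open>f = s S\<^sub>\<pi> f\<close> on an open set is the vanishing of the component of the opposite sign.
\<close>

lemma L_class_iff:
  assumes f: "f \<in> punctured_dist" "f \<noteq> (\<lambda>_. 0)" and s: "s * s = 1"
  shows "f \<in> L_class s \<kappa> \<longleftrightarrow> inf_supp f + ereal \<kappa> \<le> inf_supp (parity (- s) f)"
proof -
  have "dist_eq_on U f (\<lambda>\<phi>. s * shift_pi f \<phi>) \<longleftrightarrow> dist_eq_on U (parity (- s) f) (\<lambda>_. 0)" for U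
    by (simp add: dist_eq_on_def parity_def)
  moreover have S: "shift_pi (parity (- s) f) \<phi> = - s * parity (- s) f \<phi>" for \<phi>
    by (rule shift_pi_parity[OF punctured_distD(1)[OF f(1)]]) (use s in simp)
  ultimately show ?thesis
    unfolding L_class_def using f vanish_left_iff[OF parity_punctured[OF f(1)] S, of "inf_supp f + ereal \<kappa>"] by simp
qed

text \<open>
  Of the four terms of the left side, two are \<open>f * g\<close> (because \<open>s\<^sup>2 = 1\<close> and \<open>S\<^sub>\<pi>\<close> is an involution) and two are
  \<open>s S\<^sub>\<pi> (f * g)\<close>.
\<close>

lemma parity_dist_conv:
  assumes f: "f \<in> circle_dist" and g: "g \<in> circle_dist" and s: "s * s = 1"
  shows "dist_conv (parity s f) (parity s g) \<phi> = 2 * parity s (dist_conv f g) \<phi>"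
proof (cases "\<phi> \<in> circle_test")
  case True
  define H where "H = (\<lambda>x. g (\<lambda>y. \<phi> (x + y)))"
  have H: "H \<in> circle_test" unfolding H_def by (rule circle_dist_translate(1)[OF g True])
  have 1: "parity s g (\<lambda>y. \<phi> (x + y)) = H x + s * H (x - pi)" for x
    by (simp add: parity_def shift_pi_def H_def algebra_simps)
  have H': "(\<lambda>x. H (x - pi)) \<in> circle_test" "(\<lambda>x. s * H (x - pi)) \<in> circle_test"
    by (intro circle_test_scale circle_test_shift' H)+
  have "parity s f (\<lambda>x. H x + s * H (x - pi)) = parity s f H + s * parity s f (\<lambda>x. H (x - pi))"
    unfolding circle_dist_add[OF parity_circle_dist[OF f] H H'(2)] circle_dist_scale[OF parity_circle_dist[OF f] H'(1)] ..
  also have "parity s f (\<lambda>x. H (x - pi)) = s * parity s f H"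
    using shift_pi_parity[OF f s, of H] by (simp add: shift_pi_def)
  also have "parity s f H + s * (s * parity s f H) = 2 * parity s f H"
    by (simp add: mult.assoc[symmetric] s)
  also have "parity s f H = parity s (dist_conv f g) \<phi>"
  proof -
    have "H (x - pi) = g (\<lambda>y. \<phi> (x + y - pi))" for x by (simp add: H_def algebra_simps)
    then have "shift_pi f H = shift_pi (dist_conv f g) \<phi>"
      using circle_test_shift'(3)[OF True, of pi] by (simp add: shift_pi_def dist_conv_def)
    moreover have "f H = dist_conv f g \<phi>" using True by (simp add: H_def dist_conv_def)
    ultimately show ?thesis by (simp add: parity_def)
  qed
  finally show ?thesis using True by (simp add: dist_conv_def 1)
next
  case False
  then have "(\<lambda>x. \<phi> (x - pi)) \<notin> circle_test" by (simp add: circle_test_shift_iff)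
  then show ?thesis using False by (simp add: dist_conv_def parity_def shift_pi_def)
qed

lemma inf_supp_parity_conv:
  assumes "f \<in> circle_dist" "g \<in> circle_dist" "s * s = 1"
  shows "inf_supp (parity s (dist_conv f g)) = inf_supp (dist_conv (parity s f) (parity s g))"
proof -
  have "dist_supp (parity s (dist_conv f g)) = dist_supp (dist_conv (parity s f) (parity s g))"
    unfolding dist_supp_def dist_eq_on_def parity_dist_conv[OF assms] by simp
  then show ?thesis by (simp add: inf_supp_def supp_mod_pi_def)
qed

section \<open>Additivity of the infimum of the support\<close>

lemma inf_supp_conv_ge:
  assumes "f \<in> punctured_dist" "g \<in> punctured_dist"
    "{p + q | p q. p \<in> supp_mod_pi f \<and> q \<in> supp_mod_pi g} \<subseteq> {- pi / 2 <..< pi / 2}"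
  shows "inf_supp f + inf_supp g \<le> inf_supp (dist_conv f g)"
proof (rule inf_supp_ge)
  fix r assume "r \<in> supp_mod_pi (dist_conv f g)"
  then obtain p q where "p \<in> supp_mod_pi f" "q \<in> supp_mod_pi g" "r = p + q"
    using supp_mod_pi_conv(2)[OF assms] by blast
  then show "inf_supp f + inf_supp g \<le> ereal r"
    using add_mono[OF inf_supp_le inf_supp_le] by fastforce
qed

text \<open>
  Cutting off at \<open>\<plusminus>\<pi>/2\<close> keeps \<open>h\<close> continuous, because \<open>h\<close> vanishes there already.
\<close>

lemma Cc_cut:
  fixes h :: "real \<Rightarrow> complex"
  assumes h: "continuous_on UNIV h" and c: "c < pi / 2" "\<And>x. \<bar>x\<bar> \<le> pi / 2 \<Longrightarrow> h x \<noteq> 0 \<Longrightarrow> \<bar>x\<bar> \<le> c"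
  shows "(\<lambda>x. if \<bar>x\<bar> \<le> pi / 2 then h x else 0) \<in> Cc"
proof -
  let ?u = "\<lambda>x. if \<bar>x\<bar> \<le> pi / 2 then h x else 0"
  have "continuous_on {x. \<bar>x\<bar> < pi / 2} ?u"
    using continuous_on_subset[OF h, of "{x. \<bar>x\<bar> < pi / 2}"] by (rule continuous_on_eq) auto
  moreover have "continuous_on {x. c < \<bar>x\<bar>} ?u"
    using continuous_on_const[of "{x. c < \<bar>x\<bar>}" "0::complex"] by (rule continuous_on_eq) (use c(2) in force)
  moreover have "open {x::real. \<bar>x\<bar> < pi / 2}" "open {x::real. c < \<bar>x\<bar>}"
    by (intro open_Collect_less continuous_intros)+
  ultimately have "continuous_on ({x. \<bar>x\<bar> < pi / 2} \<union> {x. c < \<bar>x\<bar>}) ?u"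
    by (intro continuous_on_open_Un)
  moreover have "{x. \<bar>x\<bar> < pi / 2} \<union> {x. c < \<bar>x\<bar>} = UNIV" using c(1) by auto
  ultimately have "continuous_on UNIV ?u" by simp
  then show ?thesis unfolding Cc_def by (auto intro!: exI[of _ "pi / 2"])
qed

lemma integral_half_period:
  fixes h :: "real \<Rightarrow> complex"
  assumes h: "continuous_on UNIV h" and per: "\<And>x. h (x + pi) = h x"
  shows "integral {- pi..pi} h = 2 * integral {- pi / 2..pi / 2} h"
proof -
  have per2: "h (x + 2 * pi) = h x" for x using per[of x] per[of "x + pi"] by (simp add: algebra_simps)
  have int: "h integrable_on {a..b}" for a b
    by (rule integrable_continuous_real[OF continuous_on_subset[OF h]]) simp
  have "integral {- pi..pi} h = integral {- pi / 2..pi / 2 + pi} h"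
    using integral_period_shift[OF h per2, of "pi / 2"] by simp
  also have "\<dots> = integral {- pi / 2..pi / 2} h + integral {pi / 2..pi / 2 + pi} h"
    by (rule Henstock_Kurzweil_Integration.integral_combine[symmetric]) (use int in auto)
  also have "integral {pi / 2..pi / 2 + pi} h = integral {- pi / 2..pi / 2} h"
    using integral_shift_Icc_real[of "- pi / 2" "pi / 2" h pi] per by (simp add: o_def add.commute[of pi])
  finally show ?thesis by simp
qed

lemma smear_shift_pi:
  assumes "\<And>\<phi>. shift_pi F \<phi> = s * F \<phi>"
  shows "smear F \<rho> (x + pi) = s * smear F \<rho> x"
  using assms[of "\<lambda>y. \<rho> (y - x)"] by (simp add: smear_def shift_pi_def algebra_simps)

lemma avg_near:
  assumes "avg \<rho> (- pi) pi \<sigma> y \<noteq> 0" "\<And>z. \<rho> z \<noteq> 0 \<Longrightarrow> near d z" "\<And>z. \<sigma> z \<noteq> 0 \<Longrightarrow> near e z"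
  shows "near (d + e) y"
proof -
  have "\<exists>s. \<rho> s * \<sigma> (y - s) \<noteq> 0"
  proof (rule ccontr)
    assume "\<not> ?thesis"
    then have "(\<lambda>s. \<rho> s * \<sigma> (y - s)) = (\<lambda>s. 0)" by auto
    then show False using assms(1) by (simp add: avg_def)
  qed
  then obtain s where "\<rho> s \<noteq> 0" "\<sigma> (y - s) \<noteq> 0" by auto
  then obtain j k :: int where "\<bar>s - 2 * pi * of_int j\<bar> < d" "\<bar>y - s - 2 * pi * of_int k\<bar> < e"
    using assms(2,3) unfolding near_def by blast
  then have "\<bar>y - 2 * pi * of_int (j + k)\<bar> < d + e" by (simp add: algebra_simps)
  then show ?thesis unfolding near_def by blast
qed

lemma smear_nonzero_near_supp_mod_pi:
  assumes F: "F \<in> punctured_dist" and \<rho>: "\<rho> \<in> circle_test" "\<And>z. \<rho> z \<noteq> 0 \<Longrightarrow> near e z" "e < \<eta>"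
    and nz: "smear F \<rho> z \<noteq> 0"
  shows "\<exists>p\<in>supp_mod_pi F. \<exists>k. \<bar>p + of_int k * pi - z\<bar> < \<eta>"
    and "\<bar>z\<bar> \<le> pi / 2 \<Longrightarrow> (\<And>p. p \<in> supp_mod_pi F \<Longrightarrow> \<bar>p\<bar> + \<eta> \<le> pi / 2) \<Longrightarrow>
      \<exists>p\<in>supp_mod_pi F. \<bar>p - z\<bar> < \<eta>"
proof -
  show *: "\<exists>p\<in>supp_mod_pi F. \<exists>k. \<bar>p + of_int k * pi - z\<bar> < \<eta>"
    using smear_nonzero_near_supp[OF punctured_distD(1)[OF F] \<rho> nz] dist_supp_mod_pi[OF F] by metis
  assume z: "\<bar>z\<bar> \<le> pi / 2" and room: "\<And>p. p \<in> supp_mod_pi F \<Longrightarrow> \<bar>p\<bar> + \<eta> \<le> pi / 2"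
  obtain p k where p: "p \<in> supp_mod_pi F" "\<bar>p + of_int k * pi - z\<bar> < \<eta>" using * by blast
  have "\<bar>p + of_int k * pi - p\<bar> < pi" using p(2) z room[OF p(1)] by linarith
  then have "p + of_int k * pi = p" by (rule eq_of_shift_mod_pi[OF _ refl])
  then show "\<exists>p\<in>supp_mod_pi F. \<bar>p - z\<bar> < \<eta>" using p by auto
qed

text \<open>
  Suppose \<open>F * G\<close> started to the right of \<open>a + b\<close>, the sum of the leftmost points of the supports.
  Mollify \<open>F\<close> and \<open>G\<close> so little that the supports move by less than a small \<open>\<eta>\<close>, and restrict to
  \<open>[-\<pi>/2, \<pi>/2]\<close>. By Titchmarsh's theorem the convolution of the resulting functions on the line is
  nonzero somewhere before \<open>a + b + 2\<eta>\<close>. It is half the circle convolution there, which is a mollification of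
  \<open>F * G\<close>, so \<open>F * G\<close> has a point of its support close to this place.
\<close>

lemma inf_supp_conv_le:
  assumes F: "F \<in> punctured_dist" and G: "G \<in> punctured_dist"
    and sum: "{p + q | p q. p \<in> supp_mod_pi F \<and> q \<in> supp_mod_pi G} \<subseteq> {- pi / 2 <..< pi / 2}"
    and SF: "\<And>\<phi>. shift_pi F \<phi> = s * F \<phi>" and SG: "\<And>\<phi>. shift_pi G \<phi> = s * G \<phi>" and s: "s * s = 1"
  shows "inf_supp (dist_conv F G) \<le> inf_supp F + inf_supp G"
proof (cases "supp_mod_pi F = {} \<or> supp_mod_pi G = {}")
  case True
  have "inf_supp F \<noteq> - \<infinity>" "inf_supp G \<noteq> - \<infinity>"
    using inf_supp_ge[of F "ereal (- pi / 2)"] inf_supp_ge[of G "ereal (- pi / 2)"] supp_mod_pi_bounds by fastforce+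
  moreover have "inf_supp F = \<infinity> \<or> inf_supp G = \<infinity>" using True by (auto simp: inf_supp_def top_ereal_def)
  ultimately show ?thesis by auto
next
  case False
  note F' = punctured_distD(1)[OF F] and G' = punctured_distD(1)[OF G]
  obtain a where a: "a \<in> supp_mod_pi F" "\<And>p. p \<in> supp_mod_pi F \<Longrightarrow> a \<le> p"
    using compact_attains_inf[OF compact_supp_mod_pi[OF F]] False by blast
  obtain a' where a': "a' \<in> supp_mod_pi F" "\<And>p. p \<in> supp_mod_pi F \<Longrightarrow> p \<le> a'"
    using compact_attains_sup[OF compact_supp_mod_pi[OF F]] False by blast
  obtain b where b: "b \<in> supp_mod_pi G" "\<And>p. p \<in> supp_mod_pi G \<Longrightarrow> b \<le> p"
    using compact_attains_inf[OF compact_supp_mod_pi[OF G]] False by blast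
  obtain b' where b': "b' \<in> supp_mod_pi G" "\<And>p. p \<in> supp_mod_pi G \<Longrightarrow> p \<le> b'"
    using compact_attains_sup[OF compact_supp_mod_pi[OF G]] False by blast
  have "a + b \<in> {- pi / 2 <..< pi / 2}" by (rule subsetD[OF sum]) (use a(1) b(1) in blast)
  moreover have "a' + b' \<in> {- pi / 2 <..< pi / 2}" by (rule subsetD[OF sum]) (use a'(1) b'(1) in blast)
  ultimately have sums: "- pi / 2 < a + b" "a' + b' < pi / 2" by auto
  have ab: "ereal a \<le> inf_supp F" "ereal b \<le> inf_supp G" using a b by (auto intro: inf_supp_ge)
  show ?thesis
  proof (rule ccontr)
    assume "\<not> ?thesis"
    then have "ereal (a + b) < inf_supp (dist_conv F G)"
      using add_mono[OF ab] by (simp add: not_le)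
    then obtain t where t: "ereal (a + b) < ereal t" "ereal t < inf_supp (dist_conv F G)"
      using ereal_dense2 by blast
    \<comment> \<open>\<open>\<eta>\<close> is small against all the gaps that have to survive several shifts by \<open>\<eta>\<close>.\<close>
    define Z where "Z = {a + pi / 2, pi / 2 - a', b + pi / 2, pi / 2 - b', a + b + pi / 2, pi / 2 - (a' + b'), t - (a + b)}"
    define \<eta> where "\<eta> = Min Z / 8"
    have "\<forall>z\<in>Z. z > 0"
      using supp_mod_pi_bounds[OF a(1)] supp_mod_pi_bounds[OF a'(1)] supp_mod_pi_bounds[OF b(1)]
        supp_mod_pi_bounds[OF b'(1)] sums t(1) by (auto simp: Z_def)
    then have "Min Z > 0" by (subst Min_gr_iff) (auto simp: Z_def)
    then have \<eta>: "\<eta> > 0" by (simp add: \<eta>_def)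
    have "8 * \<eta> \<le> z" if "z \<in> Z" for z
    proof -
      have "finite Z" by (simp add: Z_def)
      from Min_le[OF this that] show ?thesis by (simp add: \<eta>_def)
    qed
    then have room: "8 * \<eta> \<le> a + pi / 2" "8 * \<eta> \<le> pi / 2 - a'" "8 * \<eta> \<le> b + pi / 2" "8 * \<eta> \<le> pi / 2 - b'"
      "8 * \<eta> \<le> a + b + pi / 2" "8 * \<eta> \<le> pi / 2 - (a' + b')" "8 * \<eta> \<le> t - (a + b)"
      by (simp_all add: Z_def)
    obtain N where N: "\<And>n. n \<ge> N \<Longrightarrow> 1 / real (Suc n) < \<eta>" using eventually_moll_small[OF \<eta>] by blast
    have "a \<in> dist_supp F" "b \<in> dist_supp G"
      using a(1) b(1) dist_supp_shift_pi_iff[OF SF] dist_supp_shift_pi_iff[OF SG] by (auto simp: supp_mod_pi_def)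
    then obtain n m x y where n: "n \<ge> N" "\<bar>x - a\<bar> < \<eta>" "smear F (moll n) x \<noteq> 0"
      and m: "m \<ge> N" "\<bar>y - b\<bar> < \<eta>" "smear G (moll m) y \<noteq> 0"
      using smear_nonzero_at_supp[OF F' _ \<eta>] smear_nonzero_at_supp[OF G' _ \<eta>] by meson
    define \<rho> where "\<rho> = moll n"
    define \<sigma> where "\<sigma> = moll m"
    have \<rho>: "\<rho> \<in> circle_test" and \<sigma>: "\<sigma> \<in> circle_test" unfolding \<rho>_def \<sigma>_def by (rule moll_test)+
    have near\<rho>: "near (1 / real (Suc n)) z" if "\<rho> z \<noteq> 0" for z using that moll_near by (simp add: \<rho>_def)
    have near\<sigma>: "near (1 / real (Suc m)) z" if "\<sigma> z \<noteq> 0" for z using that moll_near by (simp add: \<sigma>_def)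
    define P where "P = smear F \<rho>"
    define Q where "Q = smear G \<sigma>"
    have Pc: "continuous_on X P" and Qc: "continuous_on X Q" for X
      unfolding P_def Q_def using smear_continuous[OF F' \<rho>] smear_continuous[OF G' \<sigma>] continuous_on_subset by blast+
    have inF: "\<bar>p\<bar> + \<eta> \<le> pi / 2" if "p \<in> supp_mod_pi F" for p using a(2)[OF that] a'(2)[OF that] room \<eta> by linarith
    have inG: "\<bar>q\<bar> + \<eta> \<le> pi / 2" if "q \<in> supp_mod_pi G" for q using b(2)[OF that] b'(2)[OF that] room \<eta> by linarith
    have Pnz: "\<exists>p\<in>supp_mod_pi F. \<exists>k. \<bar>p + of_int k * pi - z\<bar> < \<eta>" "\<bar>z\<bar> \<le> pi / 2 \<Longrightarrow> \<exists>p\<in>supp_mod_pi F. \<bar>p - z\<bar> < \<eta>" if "P z \<noteq> 0" for z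
      using smear_nonzero_near_supp_mod_pi[OF F \<rho> near\<rho> N[OF n(1)] that[unfolded P_def]] inF by blast+
    have Qnz: "\<bar>z\<bar> \<le> pi / 2 \<Longrightarrow> \<exists>q\<in>supp_mod_pi G. \<bar>q - z\<bar> < \<eta>" if "Q z \<noteq> 0" for z
      using smear_nonzero_near_supp_mod_pi(2)[OF G \<sigma> near\<sigma> N[OF m(1)] that[unfolded Q_def]] inG by blast
    have PC: "a - \<eta> < z \<and> z < a' + \<eta>" if "P z \<noteq> 0" "\<bar>z\<bar> \<le> pi / 2" for z
      using Pnz(2)[OF that] a(2) a'(2) by fastforce
    have QC: "b - \<eta> < z \<and> z < b' + \<eta>" if "Q z \<noteq> 0" "\<bar>z\<bar> \<le> pi / 2" for z
      using Qnz[OF that] b(2) b'(2) by fastforce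
    define u where "u = (\<lambda>z. if \<bar>z\<bar> \<le> pi / 2 then P z else 0)"
    define v where "v = (\<lambda>z. if \<bar>z\<bar> \<le> pi / 2 then Q z else 0)"
    have u: "u \<in> Cc" unfolding u_def
      by (rule Cc_cut[OF Pc, of "pi / 2 - \<eta>"]) (use \<eta> in simp, use PC room in \<open>smt (verit)\<close>)
    have v: "v \<in> Cc" unfolding v_def
      by (rule Cc_cut[OF Qc, of "pi / 2 - \<eta>"]) (use \<eta> in simp, use QC room in \<open>smt (verit)\<close>)
    have uv: "u x \<noteq> 0" "v y \<noteq> 0"
      using n m room \<eta> a(2)[OF a'(1)] b(2)[OF b'(1)] by (auto simp: u_def v_def P_def Q_def \<rho>_def \<sigma>_def abs_if split: if_splits)
    have "x + y < a + b + 2 * \<eta>" using n(2) m(2) by linarith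
    then obtain w where w: "w < a + b + 2 * \<eta>" "line_conv u v w \<noteq> 0"
      using titchmarsh_convolution[OF u v, of "a + b + 2 * \<eta>" x y] uv by blast
    have "\<exists>z. u (w - z) * v z \<noteq> 0"
    proof (rule ccontr)
      assume "\<not> ?thesis"
      then have "(\<lambda>z. u (w - z) * v z) = (\<lambda>z. 0)" by auto
      then show False using w(2) by (simp add: line_conv_def)
    qed
    then obtain z where z: "u (w - z) \<noteq> 0" "v z \<noteq> 0" by auto
    have wb: "a + b - 2 * \<eta> < w" "w < a' + b' + 2 * \<eta>"
      using z PC[of "w - z"] QC[of z] by (auto simp: u_def v_def split: if_splits)
    \<comment> \<open>No wrap-around: where the left side is nonzero, \<open>w - z\<close> lies in \<open>[-\<pi>/2, \<pi>/2]\<close>, because \<open>w\<close> does and the sums of the supports stay inside.\<close>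
    have prod: "P (w - z) * Q z = u (w - z) * v z" if z: "\<bar>z\<bar> \<le> pi / 2" for z
    proof (cases "P (w - z) = 0 \<or> Q z = 0")
      case False
      then obtain p k where p: "p \<in> supp_mod_pi F" "\<bar>p + of_int k * pi - (w - z)\<bar> < \<eta>" using Pnz(1) by blast
      from False z obtain q where q: "q \<in> supp_mod_pi G" and q': "\<bar>q - z\<bar> < \<eta>" using Qnz[OF _ z] by blast
      have "a + b \<le> p + q" "p + q \<le> a' + b'" using a(2)[OF p(1)] a'(2)[OF p(1)] b(2)[OF q(1)] b'(2)[OF q(1)] by auto
      then have "\<bar>p + of_int k * pi - p\<bar> < pi"
        using p(2) q' wb room \<eta> by linarith
      then have "p + of_int k * pi = p" by (rule eq_of_shift_mod_pi[OF _ refl])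
      then have "\<bar>w - z\<bar> \<le> pi / 2" using p(2) a(2)[OF p(1)] a'(2)[OF p(1)] room \<eta> by linarith
      then show ?thesis using z by (simp add: u_def v_def)
    qed (auto simp: u_def v_def)
    have "smear (dist_conv F G) (avg \<rho> (- pi) pi \<sigma>) w = integral {- pi..pi} (\<lambda>z. P (w - z) * Q z)"
      unfolding P_def Q_def by (rule smear_conv[OF F' G' \<rho> \<sigma>])
    also have "\<dots> = 2 * integral {- pi / 2..pi / 2} (\<lambda>z. P (w - z) * Q z)"
    proof (rule integral_half_period)
      show "continuous_on UNIV (\<lambda>z. P (w - z) * Q z)"
        by (intro continuous_intros Qc continuous_on_compose2[OF Pc[of UNIV]]) auto
      fix z
      have e: "w - (z + pi) + pi = w - z" by simp
      have "P (w - z) = s * P (w - (z + pi))"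
        using smear_shift_pi[OF SF, of \<rho> "w - (z + pi)"] unfolding e P_def .
      then have "P (w - (z + pi)) = s * P (w - z)" by (simp add: mult.assoc[symmetric] s)
      moreover have "Q (z + pi) = s * Q z" unfolding Q_def by (rule smear_shift_pi[OF SG])
      ultimately have "P (w - (z + pi)) * Q (z + pi) = (s * s) * (P (w - z) * Q z)" by simp
      then show "P (w - (z + pi)) * Q (z + pi) = P (w - z) * Q z" by (simp add: s)
    qed
    also have "integral {- pi / 2..pi / 2} (\<lambda>z. P (w - z) * Q z) = integral {- pi / 2..pi / 2} (\<lambda>z. u (w - z) * v z)"
      by (rule Henstock_Kurzweil_Integration.integral_cong, rule prod) auto
    also have "\<dots> = line_conv u v w"
      unfolding line_conv_def
    proof (rule lborel_integral_eq_interval[symmetric])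
      have cu: "continuous_on UNIV u" and cv: "continuous_on UNIV v" using u v by (auto simp: Cc_def)
      show "continuous_on {- pi / 2..pi / 2} (\<lambda>z. u (w - z) * v z)"
        by (intro continuous_intros continuous_on_compose2[OF cu] continuous_on_subset[OF cv]) auto
    qed (auto simp: v_def)
    finally have nz: "smear (dist_conv F G) (avg \<rho> (- pi) pi \<sigma>) w \<noteq> 0" using w(2) by simp
    have "\<exists>r\<in>dist_supp (dist_conv F G). \<bar>r - w\<bar> < 2 * \<eta>"
    proof (rule smear_nonzero_near_supp[OF dist_conv_circle_dist[OF F' G'] avg_test(1)[OF circle_test_cont0[OF \<rho>] \<sigma>] _ _ nz])
      show "near (1 / real (Suc n) + 1 / real (Suc m)) z" if "avg \<rho> (- pi) pi \<sigma> z \<noteq> 0" for z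
        by (rule avg_near[OF that near\<rho> near\<sigma>])
      show "1 / real (Suc n) + 1 / real (Suc m) < 2 * \<eta>" using N[OF n(1)] N[OF m(1)] by linarith
    qed
    then obtain r where r: "r \<in> dist_supp (dist_conv F G)" "\<bar>r - w\<bar> < 2 * \<eta>" by blast
    have "r \<in> supp_mod_pi (dist_conv F G)"
      unfolding supp_mod_pi_def using r wb room \<eta> by auto
    then have "ereal t < ereal r" using t(2) inf_supp_le by (meson less_le_trans)
    then show False using r(2) w(1) room \<eta> by auto
  qed
qed

text \<open>
  If the first sum is large and \<open>a1\<close> is the smaller of \<open>a1\<close>, \<open>a2\<close>, then \<open>b1\<close> must be large; so \<open>b2\<close> is the
  smaller of \<open>b1\<close>, \<open>b2\<close>, and the second sum makes \<open>a2\<close> large.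
\<close>

lemma ereal_min_sum_ge_iff:
  fixes a1 a2 b1 b2 :: ereal and a b \<kappa> :: real
  assumes "min a1 a2 = ereal a" "min b1 b2 = ereal b" "\<kappa> > 0"
  shows "ereal a + ereal b + ereal \<kappa> \<le> min (a1 + b1) (a2 + b2) \<longleftrightarrow>
    (ereal a + ereal \<kappa> \<le> a1 \<and> ereal b + ereal \<kappa> \<le> b2) \<or> (ereal a + ereal \<kappa> \<le> a2 \<and> ereal b + ereal \<kappa> \<le> b1)"
  using assms by (cases a1; cases a2; cases b1; cases b2) (auto simp: min_def split: if_splits)

lemma inf_supp_finite:
  assumes "f \<in> punctured_dist" "f \<noteq> (\<lambda>_. 0)"
  obtains a where "inf_supp f = ereal a"
proof -
  obtain p where "p \<in> supp_mod_pi f" using supp_mod_pi_nonempty[OF assms] by blast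
  then have "inf_supp f \<le> ereal p" by (rule inf_supp_le)
  moreover have "ereal (- pi / 2) \<le> inf_supp f"
    by (rule inf_supp_ge) (use supp_mod_pi_bounds in fastforce)
  ultimately show ?thesis by (cases "inf_supp f") (auto intro: that)
qed

text \<open>
  The supports of the parity components of \<open>f * g\<close> start at the sums of the starting points of those of \<open>f\<close>
  and \<open>g\<close>, and the rest is \<open>ereal_min_sum_ge_iff\<close>.
\<close>

theorem inf_supp_conv_iff:
  assumes f: "f \<in> punctured_dist" "f \<noteq> (\<lambda>_. 0)" and g: "g \<in> punctured_dist" "g \<noteq> (\<lambda>_. 0)"
    and sum: "{p + q | p q. p \<in> supp_mod_pi f \<and> q \<in> supp_mod_pi g} \<subseteq> {- pi / 2 <..< pi / 2}"
    and "\<kappa> > 0"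
  shows "inf_supp (dist_conv f g) \<ge> inf_supp f + inf_supp g + ereal \<kappa> \<longleftrightarrow>
    (f \<in> L_class (- 1) \<kappa> \<and> g \<in> L_class 1 \<kappa>) \<or> (f \<in> L_class 1 \<kappa> \<and> g \<in> L_class (- 1) \<kappa>)"
proof -
  note f' = punctured_distD(1)[OF f(1)] and g' = punctured_distD(1)[OF g(1)]
  have add: "inf_supp (parity s (dist_conv f g)) = inf_supp (parity s f) + inf_supp (parity s g)" if s: "s * s = 1" for s
  proof -
    have sub: "{p + q | p q. p \<in> supp_mod_pi (parity s f) \<and> q \<in> supp_mod_pi (parity s g)} \<subseteq> {- pi / 2 <..< pi / 2}"
      using sum supp_mod_pi_parity by blast
    note p = parity_punctured[OF f(1), of s] parity_punctured[OF g(1), of s]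
    show ?thesis
      unfolding inf_supp_parity_conv[OF f' g' s]
      by (intro antisym inf_supp_conv_ge[OF p sub]
          inf_supp_conv_le[OF p sub shift_pi_parity[OF f' s] shift_pi_parity[OF g' s] s])
  qed
  obtain a where a: "inf_supp f = ereal a" by (rule inf_supp_finite[OF f])
  obtain b where b: "inf_supp g = ereal b" by (rule inf_supp_finite[OF g])
  have "inf_supp (dist_conv f g) = min (inf_supp (parity 1 f) + inf_supp (parity 1 g)) (inf_supp (parity (- 1) f) + inf_supp (parity (- 1) g))"
    by (subst inf_supp_paritys) (simp add: add)
  then show ?thesis
    using ereal_min_sum_ge_iff[OF inf_supp_paritys[of f, symmetric, unfolded a] inf_supp_paritys[of g, symmetric, unfolded b] \<open>\<kappa> > 0\<close>]
    by (simp add: a b L_class_iff f g)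
qed

section \<open>Reflection and the theorem\<close>

definition refl_dist :: "functional \<Rightarrow> functional" where
  "refl_dist f = (\<lambda>\<phi>. f (\<lambda>x. \<phi> (- x)))"

lemma eq_uminus_image:
  fixes A B :: "real set"
  assumes "\<And>x. x \<in> A \<longleftrightarrow> - x \<in> B"
  shows "A = uminus ` B"
proof (intro set_eqI iffI)
  fix x assume "x \<in> A"
  then have "- x \<in> B" using assms by blast
  then show "x \<in> uminus ` B" by (intro image_eqI[of _ _ "- x"]) auto
next
  fix x assume "x \<in> uminus ` B"
  then obtain z where "z \<in> B" "x = - z" by (rule imageE)
  then show "x \<in> A" using assms[of x] by simp
qed

lemma refl_dist_refl_dist [simp]: "refl_dist (refl_dist f) = f"
  by (simp add: refl_dist_def)

lemma circle_test_reflect_iff: "(\<lambda>x. \<phi> (- x)) \<in> circle_test \<longleftrightarrow> \<phi> \<in> circle_test"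
  using circle_test_reflect(1)[of \<phi>] circle_test_reflect(1)[of "\<lambda>x. \<phi> (- x)"] by auto

lemma refl_circle_dist:
  assumes f: "f \<in> circle_dist"
  shows "refl_dist f \<in> circle_dist"
proof -
  obtain C N where "order_bound C N f" by (rule circle_dist_bound[OF f])
  note CN = order_boundD[OF this]
  show ?thesis
  proof (rule circle_distI[where C=C and N=N])
    fix \<phi> assume "\<phi> \<notin> circle_test"
    then show "refl_dist f \<phi> = 0"
      using circle_dist_outside[OF f] circle_test_reflect_iff[of \<phi>] by (simp add: refl_dist_def)
  next
    fix \<phi> \<psi> assume *: "\<phi> \<in> circle_test" "\<psi> \<in> circle_test"
    show "refl_dist f (\<lambda>x. \<phi> x + \<psi> x) = refl_dist f \<phi> + refl_dist f \<psi>"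
      unfolding refl_dist_def by (rule circle_dist_add[OF f circle_test_reflect(1)[OF *(1)] circle_test_reflect(1)[OF *(2)]])
  next
    fix c \<phi> assume *: "\<phi> \<in> circle_test"
    show "refl_dist f (\<lambda>x. c * \<phi> x) = c * refl_dist f \<phi>"
      unfolding refl_dist_def by (rule circle_dist_scale[OF f circle_test_reflect(1)[OF *]])
  next
    fix \<phi> e assume *: "\<phi> \<in> circle_test" and e: "\<And>k x. k \<le> N \<Longrightarrow> norm (nth_deriv k \<phi> x) \<le> e"
    show "norm (refl_dist f \<phi>) \<le> C * e"
      unfolding refl_dist_def
      by (rule CN(2)[OF circle_test_reflect(1)[OF *]]) (simp add: circle_test_reflect(2)[OF *] norm_mult norm_power e)
  qed (use CN(1) in auto)
qed

lemma periodize_uminus: "x \<in> periodize (uminus ` U) \<longleftrightarrow> - x \<in> periodize U"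
proof
  assume "x \<in> periodize (uminus ` U)"
  then obtain u k where "u \<in> U" "x = - u + 2 * pi * of_int k" by (auto simp: periodize_def)
  then have "- x = u + 2 * pi * of_int (- k)" by simp
  then show "- x \<in> periodize U" using \<open>u \<in> U\<close> unfolding periodize_def by blast
next
  assume "- x \<in> periodize U"
  then obtain u k where "u \<in> U" "- x = u + 2 * pi * of_int k" by (auto simp: periodize_def)
  then have "x = - u + 2 * pi * of_int (- k)" by simp
  then show "x \<in> periodize (uminus ` U)" using \<open>u \<in> U\<close> unfolding periodize_def by blast
qed

lemma closure_nonzero_reflect:
  fixes \<phi> :: "real \<Rightarrow> complex"
  shows "closure {y. \<phi> (- y) \<noteq> 0} \<subseteq> uminus ` closure {y. \<phi> y \<noteq> 0}"
proof (rule closure_minimal)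
  have eq: "{y. \<phi> (- y) \<noteq> 0} = uminus ` {y. \<phi> y \<noteq> 0}"
    by (auto intro!: image_eqI[where x="- x" for x])
  show "{y. \<phi> (- y) \<noteq> 0} \<subseteq> uminus ` closure {y. \<phi> y \<noteq> 0}"
    unfolding eq by (rule image_mono[OF closure_subset])
qed (simp add: closed_negations)

lemma dist_eq_on_reflect:
  assumes "dist_eq_on U f g"
  shows "dist_eq_on (uminus ` U) (refl_dist f) (refl_dist g)"
  unfolding dist_eq_on_def
proof (intro ballI impI)
  fix \<phi> assume \<phi>: "\<phi> \<in> circle_test" and sub: "closure {x. \<phi> x \<noteq> 0} \<subseteq> periodize (uminus ` U)"
  have "closure {x. \<phi> (- x) \<noteq> 0} \<subseteq> periodize U"
  proof
    fix x assume "x \<in> closure {x. \<phi> (- x) \<noteq> 0}"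
    then have "x \<in> uminus ` closure {x. \<phi> x \<noteq> 0}" by (rule subsetD[OF closure_nonzero_reflect])
    then obtain z where "z \<in> closure {x. \<phi> x \<noteq> 0}" "x = - z" by (rule imageE)
    then have "- x \<in> closure {x. \<phi> x \<noteq> 0}" by simp
    then have "- x \<in> periodize (uminus ` U)" by (rule subsetD[OF sub])
    then show "x \<in> periodize U" by (simp add: periodize_uminus)
  qed
  then show "refl_dist f \<phi> = refl_dist g \<phi>"
    using assms circle_test_reflect(1)[OF \<phi>] by (simp add: dist_eq_on_def refl_dist_def)
qed

lemma dist_supp_reflect: "x \<in> dist_supp (refl_dist f) \<longleftrightarrow> - x \<in> dist_supp f"
proof -
  have step: "- x \<notin> dist_supp (refl_dist f)" if x: "x \<notin> dist_supp f" for x f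
  proof -
    obtain d where d: "d > 0" "dist_eq_on (ball x d) f (\<lambda>_. 0)" using x unfolding notin_dist_supp_iff by blast
    have "refl_dist (\<lambda>_. 0) = (\<lambda>_. 0)" by (simp add: refl_dist_def)
    then have "dist_eq_on (uminus ` ball x d) (refl_dist f) (\<lambda>_. 0)"
      using dist_eq_on_reflect[OF d(2)] by simp
    moreover have "open (uminus ` ball x d)" by (rule open_negations) simp
    ultimately show ?thesis using d(1) by (intro notin_dist_suppI) auto
  qed
  show ?thesis using step[of "- x" f] step[of x "refl_dist f"] by auto
qed

lemma refl_punctured:
  assumes f: "f \<in> punctured_dist"
  shows "refl_dist f \<in> punctured_dist"
proof (rule punctured_distI[OF refl_circle_dist[OF punctured_distD(1)[OF f]]])
  fix x k assume "x \<in> dist_supp (refl_dist f)"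
  then have "- x \<in> dist_supp f" by (simp add: dist_supp_reflect)
  then have "- x \<noteq> pi / 2 + of_int (- k - 1) * pi" by (rule punctured_distD(2)[OF f])
  then show "x \<noteq> pi / 2 + of_int k * pi" by (auto simp: algebra_simps)
qed

lemma refl_punctured_iff: "refl_dist f \<in> punctured_dist \<longleftrightarrow> f \<in> punctured_dist"
  using refl_punctured[of f] refl_punctured[of "refl_dist f"] by auto

lemma refl_eq_zero_iff: "refl_dist f = (\<lambda>_. 0) \<longleftrightarrow> f = (\<lambda>_. 0)"
proof
  assume "refl_dist f = (\<lambda>_. 0)"
  then have "refl_dist (refl_dist f) = refl_dist (\<lambda>_. 0)" by simp
  then show "f = (\<lambda>_. 0)" unfolding refl_dist_refl_dist by (simp add: refl_dist_def)
qed (simp add: refl_dist_def)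

lemma supp_mod_pi_reflect: "supp_mod_pi (refl_dist f) = uminus ` supp_mod_pi f"
proof -
  have "p \<in> supp_mod_pi (refl_dist f) \<longleftrightarrow> - p \<in> supp_mod_pi f" for p
    using dist_supp_shift_2pi[of "- p - pi" f] by (auto simp: supp_mod_pi_def dist_supp_reflect algebra_simps)
  then show ?thesis by (rule eq_uminus_image)
qed

lemma inf_supp_reflect: "inf_supp (refl_dist f) = - sup_supp f"
proof -
  have "ereal ` uminus ` supp_mod_pi f = uminus ` ereal ` supp_mod_pi f" by (simp add: image_image)
  then show ?thesis
    unfolding inf_supp_def sup_supp_def supp_mod_pi_reflect by (simp add: ereal_Inf_uminus_image_eq)
qed

lemma dist_conv_reflect: "dist_conv (refl_dist f) (refl_dist g) = refl_dist (dist_conv f g)"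
  by (rule ext) (simp add: dist_conv_def refl_dist_def circle_test_reflect_iff algebra_simps)

lemma shift_pi_reflect:
  assumes "\<phi> \<in> circle_test"
  shows "shift_pi (refl_dist f) \<phi> = refl_dist (shift_pi f) \<phi>"
proof -
  have "\<phi> (- x - pi) = \<phi> (- (x - pi))" for x
    using circle_test_per0[OF assms, of "- x - pi"] by (simp add: algebra_simps)
  then show ?thesis by (simp add: shift_pi_def refl_dist_def)
qed

lemma L_class_reflect: "refl_dist f \<in> L_class s \<kappa> \<longleftrightarrow> f \<in> R_class s \<kappa>"
proof -
  define R where "R = {x. sup_supp f - ereal \<kappa> < ereal x \<and> x < pi / 2}"
  define L where "L = {x. - pi / 2 < x \<and> ereal x < inf_supp (refl_dist f) + ereal \<kappa>}"
  have LR: "x \<in> L \<longleftrightarrow> - x \<in> R" for x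
  proof -
    have "ereal x < - sup_supp f + ereal \<kappa> \<longleftrightarrow> sup_supp f - ereal \<kappa> < ereal (- x)"
      by (cases "sup_supp f") auto
    then show ?thesis by (auto simp: L_def R_def inf_supp_reflect)
  qed
  from LR have "- x \<in> L \<longleftrightarrow> x \<in> R" for x by (metis minus_minus)
  then have RL: "R = uminus ` L" by (intro eq_uminus_image) blast
  have LR: "L = uminus ` R" by (rule eq_uminus_image) (rule LR)
  have "dist_eq_on L (refl_dist f) (\<lambda>\<phi>. s * shift_pi (refl_dist f) \<phi>) \<longleftrightarrow>
      dist_eq_on L (refl_dist f) (refl_dist (\<lambda>\<phi>. s * shift_pi f \<phi>))"
    unfolding dist_eq_on_def using shift_pi_reflect by (auto simp: refl_dist_def)
  also have "\<dots> \<longleftrightarrow> dist_eq_on R f (\<lambda>\<phi>. s * shift_pi f \<phi>)"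
    using dist_eq_on_reflect[of R f "\<lambda>\<phi>. s * shift_pi f \<phi>"]
      dist_eq_on_reflect[of L "refl_dist f" "refl_dist (\<lambda>\<phi>. s * shift_pi f \<phi>)"] unfolding LR[symmetric] RL[symmetric] refl_dist_refl_dist by blast
  finally show ?thesis
    by (simp add: L_class_def R_class_def refl_punctured_iff refl_eq_zero_iff L_def R_def)
qed

theorem theorem7p4:
  fixes f g :: "(real \<Rightarrow> complex) \<Rightarrow> complex"
  assumes "f \<in> punctured_dist" and "g \<in> punctured_dist"
    and "f \<noteq> (\<lambda>_. 0)" and "g \<noteq> (\<lambda>_. 0)"
    and "{p + q | p q. p \<in> supp_mod_pi f \<and> q \<in> supp_mod_pi g} \<subseteq> {- pi / 2 <..< pi / 2}"
  shows "dist_conv f g \<in> punctured_dist \<and>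
    (\<forall>\<kappa>::real. \<kappa> > 0 \<longrightarrow>
      (inf_supp (dist_conv f g) \<ge> inf_supp f + inf_supp g + ereal \<kappa> \<longleftrightarrow>
        (f \<in> L_class (- 1) \<kappa> \<and> g \<in> L_class 1 \<kappa>) \<or> (f \<in> L_class 1 \<kappa> \<and> g \<in> L_class (- 1) \<kappa>)) \<and>
      (sup_supp (dist_conv f g) \<le> sup_supp f + sup_supp g - ereal \<kappa> \<longleftrightarrow>
        (f \<in> R_class (- 1) \<kappa> \<and> g \<in> R_class 1 \<kappa>) \<or> (f \<in> R_class 1 \<kappa> \<and> g \<in> R_class (- 1) \<kappa>)))"
proof (intro conjI allI impI)
  show "dist_conv f g \<in> punctured_dist" by (rule supp_mod_pi_conv(1)[OF assms(1,2,5)])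
  fix \<kappa> :: real assume \<kappa>: "\<kappa> > 0"
  show "inf_supp (dist_conv f g) \<ge> inf_supp f + inf_supp g + ereal \<kappa> \<longleftrightarrow>
        (f \<in> L_class (- 1) \<kappa> \<and> g \<in> L_class 1 \<kappa>) \<or> (f \<in> L_class 1 \<kappa> \<and> g \<in> L_class (- 1) \<kappa>)"
    by (rule inf_supp_conv_iff[OF assms(1,3,2,4,5) \<kappa>])
  have sum: "{p + q | p q. p \<in> supp_mod_pi (refl_dist f) \<and> q \<in> supp_mod_pi (refl_dist g)} \<subseteq> {- pi / 2 <..< pi / 2}"
  proof
    fix r assume "r \<in> {p + q | p q. p \<in> supp_mod_pi (refl_dist f) \<and> q \<in> supp_mod_pi (refl_dist g)}"
    then obtain p q where pq: "p \<in> supp_mod_pi f" "q \<in> supp_mod_pi g" "r = - p + - q"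
      unfolding supp_mod_pi_reflect by blast
    then have "p + q \<in> {- pi / 2 <..< pi / 2}" using assms(5) by blast
    then show "r \<in> {- pi / 2 <..< pi / 2}" using pq(3) by auto
  qed
  have "inf_supp (dist_conv (refl_dist f) (refl_dist g)) \<ge> inf_supp (refl_dist f) + inf_supp (refl_dist g) + ereal \<kappa> \<longleftrightarrow>
     (refl_dist f \<in> L_class (- 1) \<kappa> \<and> refl_dist g \<in> L_class 1 \<kappa>) \<or> (refl_dist f \<in> L_class 1 \<kappa> \<and> refl_dist g \<in> L_class (- 1) \<kappa>)"
    by (rule inf_supp_conv_iff[OF _ _ _ _ sum \<kappa>]) (use assms in \<open>simp_all add: refl_punctured_iff refl_eq_zero_iff\<close>)
  moreover have "inf_supp (refl_dist f) + inf_supp (refl_dist g) + ereal \<kappa> \<le> inf_supp (dist_conv (refl_dist f) (refl_dist g)) \<longleftrightarrow>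
     sup_supp (dist_conv f g) \<le> sup_supp f + sup_supp g - ereal \<kappa>"
  proof -
    obtain a where "inf_supp (refl_dist f) = ereal a"
      by (rule inf_supp_finite[of "refl_dist f"]) (use assms in \<open>simp_all add: refl_punctured_iff refl_eq_zero_iff\<close>)
    moreover obtain b where "inf_supp (refl_dist g) = ereal b"
      by (rule inf_supp_finite[of "refl_dist g"]) (use assms in \<open>simp_all add: refl_punctured_iff refl_eq_zero_iff\<close>)
    ultimately have "sup_supp f = ereal (- a)" "sup_supp g = ereal (- b)"
      by (simp_all add: inf_supp_reflect ereal_uminus_eq_reorder)
    then show ?thesis
      unfolding dist_conv_reflect inf_supp_reflect by (cases "sup_supp (dist_conv f g)") auto
  qed
  ultimately show "sup_supp (dist_conv f g) \<le> sup_supp f + sup_supp g - ereal \<kappa> \<longleftrightarrow>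
        (f \<in> R_class (- 1) \<kappa> \<and> g \<in> R_class 1 \<kappa>) \<or> (f \<in> R_class 1 \<kappa> \<and> g \<in> R_class (- 1) \<kappa>)"
    by (simp add: L_class_reflect)
qed

end
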